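(* Let $(G,\mathfrak{B})$ be a Rota-Baxter Lie $\mathbb{Q}$-group with limit-weight zero. Let $\mathfrak{g}=T_eG$ be the Lie algebra of $G$ and $B:\mathfrak{g}\to\mathfrak{g}$ the tangent map of $\mathfrak{B}$ at the identity $e$. Then $(\mathfrak{g},B)$ is a Rota-Baxter Lie algebra with limit-weight $\lim_{n\to\infty}\big(\tfrac1n\mathrm{id}_{\mathfrak{g}},\,n\,\mathrm{id}_{\mathfrak{g}}\big)$, and hence a Rota-Baxter Lie algebra with weight zero, that is, $$[B(u),B(v)]=B\big([B(u),v]+[u,B(v)]\big),\quad u,v\in\mathfrak{g}.$$
   Context: $\mathbb{P}$ is the set of positive integers. A topological group $G$ is a $\mathbb{Q}$-group if for each nonzero integer $n$ the map $P_n:G\to G$, $a\mapsto a^n$, is bijective (write $a^{1/n}:=P_n^{-1}(a)$) and, for each $a\in G$, $\lim_{n\to\infty}a^{1/n}$ uniquely exists and equals $e$. Let $T$ be a topological space and $f_n:T\times T\to T$, $n\in\mathbb{P}$, maps such that $\lim_n f_n(a,b)$ uniquely exists for all $(a,b)$. The limit function is synchronized if for all sequences $a_n\to a$, $b_n\to b$ in $T$, $\lim_n f_n(a,b)=\lim_n f_n(a_n,b_n)$. A $\mathbb{Q}$-group $G$ is a $\lim_{n\to\infty}(P_n^{-1},P_n)$-group if $\lim_{n\to\infty}(a^{1/n}b^{1/n})^n$ uniquely exists for all $(a,b)\in G\times G$ and the resulting map $G\times G\to G$ is synchronized. Let $G$ be a $\mathbb{Q}$-group which is also a $\lim_{n\to\infty}(P_n^{-1},P_n)$-group.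 A map $\mathfrak{B}:G\to G$ is a Rota-Baxter operator with limit-weight zero if for all $(a,b)\in G\times G$ the limit $\lim_{n\to\infty}\big(a^{1/n}\mathfrak{B}(a)b^{1/n}\mathfrak{B}(a)^{-1}\big)^n$ uniquely exists and $$\mathfrak{B}(a)\mathfrak{B}(b)=\mathfrak{B}\Big(\lim_{n\to\infty}\big(a^{1/n}\mathfrak{B}(a)b^{1/n}\mathfrak{B}(a)^{-1}\big)^n\Big).$$ If moreover $G$ is a Lie group and $\mathfrak{B}$ is smooth, $(G,\mathfrak{B})$ is a Rota-Baxter Lie $\mathbb{Q}$-group with limit-weight zero. For a Lie algebra $\mathfrak{g}$ with a topology and linear maps $\phi_{1/n},\psi_{1/n},B:\mathfrak{g}\to\mathfrak{g}$ ($n\in\mathbb{P}$), $(\mathfrak{g},B)$ is a Rota-Baxter Lie algebra with limit-weight $\lim_{n\to\infty}(\phi_{1/n},\psi_{1/n})$ if: $\phi_{1/n}\psi_{1/n}=\mathrm{id}_{\mathfrak{g}}$ for all $n$; $\lim_n\psi_{1/n}([\phi_{1/n}(u),\phi_{1/n}(v)])$ uniquely exists for all $u,v$ and defines a synchronized map $\mathfrak{g}\times\mathfrak{g}\to\mathfrak{g}$; and for all $u,v$ the limit $\lim_n\psi_{1/n}([B(u),\phi_{1/n}(v)])$ uniquely exists and $$[B(u),B(v)]=B\Big(\lim_{n\to\infty}\psi_{1/n}\big([B(u),\phi_{1/n}(v)]+[\phi_{1/n}(u),B(v)]+[\phi_{1/n}(u),\phi_{1/n}(v)]\big)\Big).$$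 The topology on $\mathfrak{g}=T_eG$ is the one induced from $G$: its open sets are the inverse images of the open sets of $G$ under $\exp:\mathfrak{g}\to G$. *)

theory Defs
  imports "HOL-Analysis.Analysis" "HOL-Algebra.Group" "HOL-Library.Function_Algebras"
begin

text \<open>Topologies are not assumed to be Hausdorff here, so uniqueness of a limit is a separate
  requirement. Sequences are indexed by all natural numbers; the value at index 0 never matters
  for a limit.\<close>

definition unique_limit :: "'a topology \<Rightarrow> (nat \<Rightarrow> 'a) \<Rightarrow> 'a \<Rightarrow> bool" where
  "unique_limit T f l \<longleftrightarrow>
     limitin T f l sequentially \<and> (\<forall>l'. limitin T f l' sequentially \<longrightarrow> l' = l)"

definition synchronized :: "'a topology \<Rightarrow> (nat \<Rightarrow> 'a \<Rightarrow> 'a \<Rightarrow> 'a) \<Rightarrow> bool" where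
  "synchronized T f \<longleftrightarrow>
     (\<forall>a\<in>topspace T. \<forall>b\<in>topspace T.
        \<exists>l. unique_limit T (\<lambda>n. f n a b) l \<and>
          (\<forall>\<alpha> \<beta>. range \<alpha> \<subseteq> topspace T \<longrightarrow> range \<beta> \<subseteq> topspace T \<longrightarrow>
             limitin T \<alpha> a sequentially \<longrightarrow> limitin T \<beta> b sequentially \<longrightarrow>
             unique_limit T (\<lambda>n. f n (\<alpha> n) (\<beta> n)) l))"

definition topological_group :: "('g, 'm) monoid_scheme \<Rightarrow> 'g topology \<Rightarrow> bool" where
  "topological_group G T \<longleftrightarrow>
     group G \<and> topspace T = carrier G \<and>
     continuous_map (prod_topology T T) T (\<lambda>(x, y). x \<otimes>\<^bsub>G\<^esub> y) \<and>
     continuous_map T T (\<lambda>x. inv\<^bsub>G\<^esub> x)"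

definition group_root :: "('g, 'm) monoid_scheme \<Rightarrow> int \<Rightarrow> 'g \<Rightarrow> 'g" where
  "group_root G n = inv_into (carrier G) (\<lambda>x. x [^]\<^bsub>G\<^esub> n)"

definition Q_group :: "('g, 'm) monoid_scheme \<Rightarrow> 'g topology \<Rightarrow> bool" where
  "Q_group G T \<longleftrightarrow>
     topological_group G T \<and>
     (\<forall>n::int. n \<noteq> 0 \<longrightarrow> bij_betw (\<lambda>x. x [^]\<^bsub>G\<^esub> n) (carrier G) (carrier G)) \<and>
     (\<forall>a\<in>carrier G. unique_limit T (\<lambda>n. group_root G (int n) a) \<one>\<^bsub>G\<^esub>)"

definition lim_root_power_group :: "('g, 'm) monoid_scheme \<Rightarrow> 'g topology \<Rightarrow> bool" where
  "lim_root_power_group G T \<longleftrightarrow>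
     Q_group G T \<and>
     synchronized T (\<lambda>n a b. (group_root G (int n) a \<otimes>\<^bsub>G\<^esub> group_root G (int n) b) [^]\<^bsub>G\<^esub> n)"

definition rota_baxter_operator_limit_weight_zero ::
  "('g, 'm) monoid_scheme \<Rightarrow> 'g topology \<Rightarrow> ('g \<Rightarrow> 'g) \<Rightarrow> bool" where
  "rota_baxter_operator_limit_weight_zero G T \<BB> \<longleftrightarrow>
     \<BB> \<in> carrier G \<rightarrow> carrier G \<and>
     (\<forall>a\<in>carrier G. \<forall>b\<in>carrier G.
        \<exists>l. unique_limit T
              (\<lambda>n. (group_root G (int n) a \<otimes>\<^bsub>G\<^esub> \<BB> a \<otimes>\<^bsub>G\<^esub> group_root G (int n) b
                      \<otimes>\<^bsub>G\<^esub> inv\<^bsub>G\<^esub> (\<BB> a)) [^]\<^bsub>G\<^esub> n) l \<and>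
            \<BB> a \<otimes>\<^bsub>G\<^esub> \<BB> b = \<BB> l)"

text \<open>\<open>C_on k S f\<close>: \<open>f\<close> is \<open>k\<close> times continuously differentiable on \<open>S\<close>. It is meant for sets
  \<open>S\<close> that are open, or contained in a zero-dimensional space (where every map is smooth).\<close>

primrec C_on :: "nat \<Rightarrow> 'a::euclidean_space set \<Rightarrow> ('a \<Rightarrow> 'b::euclidean_space) \<Rightarrow> bool" where
  "C_on 0 S f \<longleftrightarrow> continuous_on S f"
| "C_on (Suc k) S f \<longleftrightarrow>
     (\<forall>x\<in>S. f differentiable (at x within S)) \<and>
     (\<forall>v. C_on k S (\<lambda>x. frechet_derivative f (at x within S) v))"

definition smooth_on :: "'a::euclidean_space set \<Rightarrow> ('a \<Rightarrow> 'b::euclidean_space) \<Rightarrow> bool" where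
  "smooth_on S f \<longleftrightarrow> (\<forall>k. C_on k S f)"

text \<open>A chart is given by its domain and its coordinate map; outside of the domain the values of
  the coordinate map are irrelevant.\<close>

type_synonym ('p, 'e) chart = "'p set \<times> ('p \<Rightarrow> 'e)"

text \<open>The model space \<open>E\<close> is either the full Euclidean space or \<open>{0}\<close>. The latter provides the
  manifolds of dimension 0, since types of class \<^class>\<open>euclidean_space\<close> have positive dimension.\<close>

definition smooth_atlas :: "'p topology \<Rightarrow> ('p, 'e::euclidean_space) chart set \<Rightarrow> bool" where
  "smooth_atlas T A \<longleftrightarrow>
     (\<Union>(U, \<phi>)\<in>A. U) = topspace T \<and>
     (\<exists>E\<in>{UNIV, {0}}. \<forall>(U, \<phi>)\<in>A.
        openin T U \<and> openin (top_of_set E) (\<phi> ` U) \<and>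
        homeomorphic_map (subtopology T U) (top_of_set (\<phi> ` U)) \<phi>) \<and>
     (\<forall>(U, \<phi>)\<in>A. \<forall>(V, \<psi>)\<in>A. smooth_on (\<phi> ` (U \<inter> V)) (\<psi> \<circ> inv_into U \<phi>))"

definition smooth_manifold :: "'p topology \<Rightarrow> ('p, 'e::euclidean_space) chart set \<Rightarrow> bool" where
  "smooth_manifold T A \<longleftrightarrow> Hausdorff_space T \<and> second_countable T \<and> smooth_atlas T A"

definition smooth_map ::
  "'p topology \<Rightarrow> ('p, 'e::euclidean_space) chart set \<Rightarrow>
   'q topology \<Rightarrow> ('q, 'f::euclidean_space) chart set \<Rightarrow> ('p \<Rightarrow> 'q) \<Rightarrow> bool" where
  "smooth_map T A T' A' f \<longleftrightarrow>
     continuous_map T T' f \<and>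
     (\<forall>(U, \<phi>)\<in>A. \<forall>(V, \<psi>)\<in>A'.
        smooth_on (\<phi> ` {x\<in>U. f x \<in> V}) (\<psi> \<circ> f \<circ> inv_into U \<phi>))"

definition prod_atlas ::
  "('p, 'e) chart set \<Rightarrow> ('q, 'f) chart set \<Rightarrow> ('p \<times> 'q, 'e \<times> 'f) chart set" where
  "prod_atlas A A' = {(U \<times> V, map_prod \<phi> \<psi>) | U \<phi> V \<psi>. (U, \<phi>) \<in> A \<and> (V, \<psi>) \<in> A'}"

definition smooth_curve_on ::
  "real set \<Rightarrow> 'p topology \<Rightarrow> ('p, 'e::euclidean_space) chart set \<Rightarrow> (real \<Rightarrow> 'p) \<Rightarrow> bool" where
  "smooth_curve_on J T A \<gamma> \<longleftrightarrow> smooth_map (top_of_set J) {(J, \<lambda>t. t)} T A \<gamma>"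

definition smooth_near ::
  "'p topology \<Rightarrow> ('p, 'e::euclidean_space) chart set \<Rightarrow> 'p \<Rightarrow> ('p \<Rightarrow> real) \<Rightarrow> bool" where
  "smooth_near T A p f \<longleftrightarrow>
     (\<exists>W. openin T W \<and> p \<in> W \<and> (\<forall>(U, \<phi>)\<in>A. smooth_on (\<phi> ` (U \<inter> W)) (f \<circ> inv_into U \<phi>)))"

instantiation "fun" :: (type, real_vector) real_vector
begin

definition scaleR_fun :: "real \<Rightarrow> ('a \<Rightarrow> 'b) \<Rightarrow> 'a \<Rightarrow> 'b" where
  "scaleR_fun c f = (\<lambda>x. c *\<^sub>R f x)"

instance
  by standard (simp_all add: scaleR_fun_def plus_fun_def fun_eq_iff scaleR_add_right scaleR_add_left)

end

text \<open>A tangent vector at \<open>p\<close> is a class of smooth curves through \<open>p\<close>, where curves are identified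
  if they differentiate every function that is smooth near \<open>p\<close> in the same way. The class is
  represented by the directional derivative it induces on these functions (extended by 0 to all
  other functions), and the vector space structure is the pointwise one.\<close>

type_synonym 'p tangent = "('p \<Rightarrow> real) \<Rightarrow> real"

definition velocity ::
  "'p topology \<Rightarrow> ('p, 'e::euclidean_space) chart set \<Rightarrow> (real \<Rightarrow> 'p) \<Rightarrow> 'p tangent" where
  "velocity T A \<gamma> = (\<lambda>f. if smooth_near T A (\<gamma> 0) f then deriv (\<lambda>t. f (\<gamma> t)) 0 else 0)"

definition tangent_space ::
  "'p topology \<Rightarrow> ('p, 'e::euclidean_space) chart set \<Rightarrow> 'p \<Rightarrow> 'p tangent set" where
  "tangent_space T A p =
     {velocity T A \<gamma> | \<gamma> \<epsilon>. \<epsilon> > 0 \<and> smooth_curve_on {-\<epsilon><..<\<epsilon>} T A \<gamma> \<and> \<gamma> 0 = p}"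

definition tangent_map ::
  "'p topology \<Rightarrow> ('p, 'e::euclidean_space) chart set \<Rightarrow>
   'q topology \<Rightarrow> ('q, 'f::euclidean_space) chart set \<Rightarrow>
   ('p \<Rightarrow> 'q) \<Rightarrow> 'p \<Rightarrow> 'p tangent \<Rightarrow> 'q tangent" where
  "tangent_map T A T' A' F p v = (\<lambda>f. if smooth_near T' A' (F p) f then v (f \<circ> F) else 0)"

definition lie_group ::
  "('g, 'm) monoid_scheme \<Rightarrow> 'g topology \<Rightarrow> ('g, 'e::euclidean_space) chart set \<Rightarrow> bool" where
  "lie_group G T A \<longleftrightarrow>
     group G \<and> topspace T = carrier G \<and> smooth_manifold T A \<and>
     smooth_map (prod_topology T T) (prod_atlas A A) T A (\<lambda>(x, y). x \<otimes>\<^bsub>G\<^esub> y) \<and>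
     smooth_map T A T A (\<lambda>x. inv\<^bsub>G\<^esub> x)"

text \<open>The left-invariant vector field with value \<open>u\<close> at the identity: its value at \<open>x\<close> is the image
  of \<open>u\<close> under the tangent map of the left translation by \<open>x\<close>.\<close>

definition left_invariant_field ::
  "('g, 'm) monoid_scheme \<Rightarrow> 'g tangent \<Rightarrow> ('g \<Rightarrow> real) \<Rightarrow> 'g \<Rightarrow> real" where
  "left_invariant_field G u f = (\<lambda>x. u (\<lambda>y. f (x \<otimes>\<^bsub>G\<^esub> y)))"

text \<open>The value at the identity of the commutator of the left-invariant fields of \<open>u\<close> and \<open>v\<close>.\<close>

definition lie_bracket ::
  "('g, 'm) monoid_scheme \<Rightarrow> 'g topology \<Rightarrow> ('g, 'e::euclidean_space) chart set \<Rightarrow>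
   'g tangent \<Rightarrow> 'g tangent \<Rightarrow> 'g tangent" where
  "lie_bracket G T A u v =
     (\<lambda>f. if smooth_near T A \<one>\<^bsub>G\<^esub> f
          then u (left_invariant_field G v f) - v (left_invariant_field G u f) else 0)"

definition one_parameter_subgroup ::
  "('g, 'm) monoid_scheme \<Rightarrow> 'g topology \<Rightarrow> ('g, 'e::euclidean_space) chart set \<Rightarrow>
   (real \<Rightarrow> 'g) \<Rightarrow> bool" where
  "one_parameter_subgroup G T A \<gamma> \<longleftrightarrow>
     smooth_curve_on UNIV T A \<gamma> \<and> (\<forall>s t. \<gamma> (s + t) = \<gamma> s \<otimes>\<^bsub>G\<^esub> \<gamma> t)"

definition lie_exp ::
  "('g, 'm) monoid_scheme \<Rightarrow> 'g topology \<Rightarrow> ('g, 'e::euclidean_space) chart set \<Rightarrow>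
   'g tangent \<Rightarrow> 'g" where
  "lie_exp G T A u = (THE \<gamma>. one_parameter_subgroup G T A \<gamma> \<and> velocity T A \<gamma> = u) 1"

definition exp_topology ::
  "('g, 'm) monoid_scheme \<Rightarrow> 'g topology \<Rightarrow> ('g, 'e::euclidean_space) chart set \<Rightarrow>
   'g tangent topology" where
  "exp_topology G T A = pullback_topology (tangent_space T A \<one>\<^bsub>G\<^esub>) (lie_exp G T A) T"

definition rota_baxter_lie_Q_group_limit_weight_zero ::
  "('g, 'm) monoid_scheme \<Rightarrow> 'g topology \<Rightarrow> ('g, 'e::euclidean_space) chart set \<Rightarrow>
   ('g \<Rightarrow> 'g) \<Rightarrow> bool" where
  "rota_baxter_lie_Q_group_limit_weight_zero G T A \<BB> \<longleftrightarrow>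
     lie_group G T A \<and> Q_group G T \<and> lim_root_power_group G T \<and>
     rota_baxter_operator_limit_weight_zero G T \<BB> \<and> smooth_map T A T A \<BB>"

definition lie_algebra_on :: "'v::real_vector set \<Rightarrow> ('v \<Rightarrow> 'v \<Rightarrow> 'v) \<Rightarrow> bool" where
  "lie_algebra_on V br \<longleftrightarrow>
     subspace V \<and>
     (\<forall>u\<in>V. \<forall>v\<in>V. br u v \<in> V) \<and>
     (\<forall>u\<in>V. \<forall>v\<in>V. \<forall>w\<in>V. br (u + v) w = br u w + br v w \<and> br w (u + v) = br w u + br w v) \<and>
     (\<forall>c. \<forall>u\<in>V. \<forall>v\<in>V. br (c *\<^sub>R u) v = c *\<^sub>R br u v \<and> br u (c *\<^sub>R v) = c *\<^sub>R br u v) \<and>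
     (\<forall>u\<in>V. br u u = 0) \<and>
     (\<forall>u\<in>V. \<forall>v\<in>V. \<forall>w\<in>V. br u (br v w) + br v (br w u) + br w (br u v) = 0)"

definition linear_endo_on :: "'v::real_vector set \<Rightarrow> ('v \<Rightarrow> 'v) \<Rightarrow> bool" where
  "linear_endo_on V f \<longleftrightarrow>
     f \<in> V \<rightarrow> V \<and> (\<forall>u\<in>V. \<forall>v\<in>V. f (u + v) = f u + f v) \<and> (\<forall>c. \<forall>u\<in>V. f (c *\<^sub>R u) = c *\<^sub>R f u)"

text \<open>Here \<open>\<phi> n\<close> and \<open>\<psi> n\<close> are the maps that are indexed by \<open>1/n\<close> in the mathematical notation.\<close>

definition rota_baxter_lie_algebra_limit_weight ::
  "'v::real_vector set \<Rightarrow> ('v \<Rightarrow> 'v \<Rightarrow> 'v) \<Rightarrow> 'v topology \<Rightarrow>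
   (nat \<Rightarrow> 'v \<Rightarrow> 'v) \<Rightarrow> (nat \<Rightarrow> 'v \<Rightarrow> 'v) \<Rightarrow> ('v \<Rightarrow> 'v) \<Rightarrow> bool" where
  "rota_baxter_lie_algebra_limit_weight V br X \<phi> \<psi> B \<longleftrightarrow>
     lie_algebra_on V br \<and> topspace X = V \<and> linear_endo_on V B \<and>
     (\<forall>n\<ge>1. linear_endo_on V (\<phi> n) \<and> linear_endo_on V (\<psi> n)) \<and>
     (\<forall>n\<ge>1. \<forall>u\<in>V. \<phi> n (\<psi> n u) = u) \<and>
     synchronized X (\<lambda>n u v. \<psi> n (br (\<phi> n u) (\<phi> n v))) \<and>
     (\<forall>u\<in>V. \<forall>v\<in>V.
        (\<exists>l. unique_limit X (\<lambda>n. \<psi> n (br (B u) (\<phi> n v))) l) \<and>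
        (\<exists>l. unique_limit X
               (\<lambda>n. \<psi> n (br (B u) (\<phi> n v) + br (\<phi> n u) (B v) + br (\<phi> n u) (\<phi> n v))) l \<and>
             br (B u) (B v) = B l))"

definition rota_baxter_lie_algebra_weight_zero ::
  "'v::real_vector set \<Rightarrow> ('v \<Rightarrow> 'v \<Rightarrow> 'v) \<Rightarrow> ('v \<Rightarrow> 'v) \<Rightarrow> bool" where
  "rota_baxter_lie_algebra_weight_zero V br B \<longleftrightarrow>
     lie_algebra_on V br \<and> linear_endo_on V B \<and>
     (\<forall>u\<in>V. \<forall>v\<in>V. br (B u) (B v) = B (br (B u) v + br u (B v)))"

end

theory Submission
  imports Defs
begin

text \<open>
  Let \<open>m\<close> be the multiplication of \<open>G\<close> in a chart that is centred at the identity, and let \<open>\<beta>\<close> be its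
  mixed second derivative at the origin. Since \<open>m(x, 0) = x\<close> and \<open>m(0, y) = y\<close>, one has
  \<open>m(x, y) = x + y + \<beta>(x, y) + o(\<bar>x\<bar> \<bar>y\<bar>)\<close>, and in coordinates the Lie bracket is
  \<open>[u, v] = \<beta>(u, v) - \<beta>(v, u)\<close> (\<open>lie_bracket_tan\<close>).

  The one-parameter subgroups are the solutions of the differential equation of the left-invariant
  fields, so Picard iteration in the chart provides the exponential map \<open>E\<close>. The same estimates
  show that \<open>E\<close> is strictly differentiable at \<open>0\<close> with the identity as its derivative (\<open>e_strict\<close>).
  In a \<open>\<rat>\<close>-group the root \<open>E(u)\<^sup>1\<^sup>/\<^sup>n\<close> is \<open>E(u/n)\<close>, and the uniqueness of roots spreads the
  injectivity of \<open>E\<close> from a neighbourhood of \<open>0\<close> to the whole Lie algebra. By invariance of domain,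
  \<open>E\<close> is then open. Therefore a sequence converges in the topology induced by \<open>exp\<close> if and only if
  its coordinates converge (\<open>limitin_X_iff\<close>), and the limits in the definition of a Rota-Baxter Lie
  algebra with limit-weight reduce to \<open>\<beta>(x\<^sub>n, y\<^sub>n) / n \<rightarrow> 0\<close>.

  It remains to prove the identity of weight zero. For \<open>a = E(u)\<close> and \<open>b = E(v)\<close>, the product formula
  \<open>(E(u/n) E(w/n))\<^sup>n \<rightarrow> E(u + w)\<close> (\<open>trotter\<close>) evaluates the limit in the Rota-Baxter condition, which
  becomes \<open>\<BB>(E(u)) \<BB>(E(v)) = \<BB>(E(u + Ad v))\<close> with \<open>Ad = Ad(\<BB>(E(u)))\<close> (\<open>rota_baxter_identity\<close>).
  Now write \<open>su\<close>, \<open>sv\<close> for \<open>u\<close>, \<open>v\<close>, subtract the identity with \<open>u\<close> and \<open>v\<close> exchanged, divide by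
  \<open>s\<^sup>2\<close> and let \<open>s\<close> tend to \<open>0\<close> (\<open>coordinate_rota_baxter\<close>). The difference of the products tends to
  \<open>[Bu, Bv]\<close>. Because of \<open>Ad(x) v = v + [x, v] + o(x)\<close> (\<open>Ad_derivative\<close>), the arguments of \<open>\<BB> \<circ> E\<close> on
  the right differ by \<open>s\<^sup>2 ([Bu, v] - [Bv, u]) + o(s\<^sup>2)\<close>, and \<open>\<BB> \<circ> E\<close> is strictly differentiable at \<open>0\<close>
  with derivative \<open>B\<close>. The second-order contributions of \<open>\<BB>\<close> and \<open>E\<close> are
  symmetric in \<open>u\<close> and \<open>v\<close>, so they cancel in the difference.

  When the model space is \<open>{0}\<close>, the group is discrete, and then the condition that \<open>a\<^sup>1\<^sup>/\<^sup>n\<close> tends to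
  the identity forces it to be trivial.
\<close>

section \<open>Maps of class \<open>C^k\<close> on open sets\<close>

lemma C_on_cong_imp:
  assumes "C_on k S f" "\<And>x. x \<in> S \<Longrightarrow> f x = g x"
  shows "C_on k S g"
  using assms
proof (induction k arbitrary: f g)
  case 0
  then show ?case by (simp cong: continuous_on_cong)
next
  case (Suc k)
  have d: "(f has_derivative f') (at x within S) \<longleftrightarrow> (g has_derivative f') (at x within S)" if "x \<in> S" for x f'
    using has_derivative_transform[OF that, of g f f'] has_derivative_transform[OF that, of f g f'] Suc.prems(2) by auto
  then have "frechet_derivative f (at x within S) = frechet_derivative g (at x within S)" if "x \<in> S" for x
    using that by (simp add: frechet_derivative_def)
  moreover have "g differentiable at x within S" if "x \<in> S" for x
  proof -
    from Suc.prems(1) that obtain D where "(f has_derivative D) (at x within S)"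
      by (auto simp: differentiable_def)
    with d[OF that, of D] show ?thesis by (auto simp: differentiable_def)
  qed
  moreover have "C_on k S (\<lambda>x. frechet_derivative f (at x within S) v)" for v
    using Suc.prems(1) by simp
  ultimately have "C_on k S (\<lambda>x. frechet_derivative g (at x within S) v)"
    and "x \<in> S \<Longrightarrow> g differentiable at x within S" for v x
    using Suc.IH[of "\<lambda>x. frechet_derivative f (at x within S) v"
        "\<lambda>x. frechet_derivative g (at x within S) v"] by auto
  then show ?case by simp
qed

lemma C_on_cong: "(\<And>x. x \<in> S \<Longrightarrow> f x = g x) \<Longrightarrow> C_on k S f \<longleftrightarrow> C_on k S g"
  using C_on_cong_imp[of k S f g] C_on_cong_imp[of k S g f] by auto

text \<open>On an open set the derivative within the set is the full derivative. This turns the recursion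
  for \<open>C_on\<close> into an introduction rule, for any candidate of the derivative, and a destruction rule.\<close>

lemma C_on_SucI:
  assumes "open S" "\<And>x. x \<in> S \<Longrightarrow> (f has_derivative f' x) (at x)"
    "\<And>v. C_on k S (\<lambda>x. f' x v)"
  shows "C_on (Suc k) S f"
proof -
  have d: "(f has_derivative f' x) (at x within S)" if "x \<in> S" for x
    using assms(2)[OF that] has_derivative_at_withinI by blast
  have "frechet_derivative f (at x within S) = f' x" if "x \<in> S" for x
    using assms(1,2) that frechet_derivative_at[of f "f' x" x] at_within_open[of x S] by metis
  then have "C_on k S (\<lambda>x. frechet_derivative f (at x within S) v)" for v
    using assms(3)[of v] by (simp cong: C_on_cong)
  then show ?thesis using d by (auto simp: differentiable_def)
qed

lemma C_on_SucD:
  assumes "C_on (Suc k) S f" "open S"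
  shows "x \<in> S \<Longrightarrow> (f has_derivative frechet_derivative f (at x)) (at x)"
    and "C_on k S (\<lambda>x. frechet_derivative f (at x) v)"
proof -
  show "(f has_derivative frechet_derivative f (at x)) (at x)" if "x \<in> S" for x
    using assms that at_within_open[of x S] by (auto simp: frechet_derivative_works[symmetric])
  have "frechet_derivative f (at x) v = frechet_derivative f (at x within S) v" if "x \<in> S" for x
    using assms(2) that at_within_open[of x S] by simp
  then show "C_on k S (\<lambda>x. frechet_derivative f (at x) v)"
    using assms(1) by (simp cong: C_on_cong)
qed

lemma C_on_pred: "open S \<Longrightarrow> C_on (Suc k) S f \<Longrightarrow> C_on k S f"
proof (induction k arbitrary: f)
  case 0
  then have "continuous (at x) f" if "x \<in> S" for x
    using that C_on_SucD(1)[of 0 S f x] has_derivative_continuous by blast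
  then show ?case by (simp add: continuous_at_imp_continuous_on)
next
  case (Suc k)
  show ?case
    by (rule C_on_SucI[OF Suc.prems(1) C_on_SucD(1)[OF Suc.prems(2,1)]
          Suc.IH[OF Suc.prems(1) C_on_SucD(2)[OF Suc.prems(2,1)]]])
qed

lemma C_on_mono: "open S \<Longrightarrow> open S' \<Longrightarrow> S' \<subseteq> S \<Longrightarrow> C_on k S f \<Longrightarrow> C_on k S' f"
proof (induction k arbitrary: f)
  case 0
  then show ?case using continuous_on_subset by auto
next
  case (Suc k)
  show ?case
    by (rule C_on_SucI[OF Suc.prems(2) C_on_SucD(1)[OF Suc.prems(4,1)]
          Suc.IH[OF Suc.prems(1-3) C_on_SucD(2)[OF Suc.prems(4,1)]]])
       (use Suc.prems(3) in blast)
qed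

lemma C_on_local:
  "open S \<Longrightarrow> (\<And>x. x \<in> S \<Longrightarrow> \<exists>W. open W \<and> x \<in> W \<and> W \<subseteq> S \<and> C_on k W f) \<Longrightarrow> C_on k S f"
proof (induction k arbitrary: f)
  case 0
  have "continuous (at x) f" if "x \<in> S" for x
    using 0(2)[OF that] by (auto simp: continuous_on_eq_continuous_at)
  then show ?case by (simp add: continuous_at_imp_continuous_on)
next
  case (Suc k)
  show ?case
  proof (rule C_on_SucI[OF Suc.prems(1)])
    show "(f has_derivative frechet_derivative f (at x)) (at x)" if "x \<in> S" for x
      using Suc.prems(2)[OF that] C_on_SucD(1) by blast
    show "C_on k S (\<lambda>x. frechet_derivative f (at x) v)" for v
    proof (rule Suc.IH[OF Suc.prems(1)])
      fix x assume "x \<in> S"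
      from Suc.prems(2)[OF this] obtain W where W: "open W" "x \<in> W" "W \<subseteq> S" "C_on (Suc k) W f"
        by blast
      then show "\<exists>W. open W \<and> x \<in> W \<and> W \<subseteq> S \<and> C_on k W (\<lambda>x. frechet_derivative f (at x) v)"
        using C_on_SucD(2)[OF W(4,1), of v] by blast
    qed
  qed
qed

lemma C_on_const: "open S \<Longrightarrow> C_on k S (\<lambda>x. c)"
proof (induction k arbitrary: c)
  case (Suc k)
  then show ?case by (intro C_on_SucI[where f'="\<lambda>_ _. 0"]) auto
qed simp

lemma C_on_bounded_linear_comp:
  assumes "open S" "C_on k S f" "bounded_linear L"
  shows "C_on k S (\<lambda>x. L (f x))"
  using assms
proof (induction k arbitrary: f)
  case 0
  then show ?case by (simp add: linear_continuous_on_compose bounded_linear.continuous_on)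
next
  case (Suc k)
  show ?case
  proof (rule C_on_SucI[OF Suc.prems(1)])
    show "((\<lambda>x. L (f x)) has_derivative (\<lambda>v. L (frechet_derivative f (at x) v))) (at x)" if "x \<in> S" for x
      using bounded_linear.has_derivative[OF Suc.prems(3) C_on_SucD(1)[OF Suc.prems(2,1) that]] .
    show "C_on k S (\<lambda>x. L (frechet_derivative f (at x) v))" for v
      by (rule Suc.IH[OF Suc.prems(1) C_on_SucD(2)[OF Suc.prems(2,1)] Suc.prems(3)])
  qed
qed

lemma C_on_add: "open S \<Longrightarrow> C_on k S f \<Longrightarrow> C_on k S g \<Longrightarrow> C_on k S (\<lambda>x. f x + g x)"
proof (induction k arbitrary: f g)
  case 0
  then show ?case by (simp add: continuous_on_add)
next
  case (Suc k)
  show ?case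
    by (rule C_on_SucI[OF Suc.prems(1) has_derivative_add
          [OF C_on_SucD(1)[OF Suc.prems(2,1)] C_on_SucD(1)[OF Suc.prems(3,1)]]
          Suc.IH[OF Suc.prems(1) C_on_SucD(2)[OF Suc.prems(2,1)] C_on_SucD(2)[OF Suc.prems(3,1)]]])
qed

lemma C_on_sum:
  "open S \<Longrightarrow> (\<And>i. i \<in> I \<Longrightarrow> C_on k S (f i)) \<Longrightarrow> C_on k S (\<lambda>x. \<Sum>i\<in>I. f i x)"
  by (induction I rule: infinite_finite_induct) (auto intro!: C_on_const C_on_add)

lemma C_on_scaleR:
  fixes c :: "'a::euclidean_space \<Rightarrow> real"
  shows "open S \<Longrightarrow> C_on k S c \<Longrightarrow> C_on k S f \<Longrightarrow> C_on k S (\<lambda>x. c x *\<^sub>R f x)"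
proof (induction k arbitrary: c f)
  case 0
  then show ?case by (simp add: continuous_on_scaleR)
next
  case (Suc k)
  note c = C_on_SucD[OF Suc.prems(2,1)] and f = C_on_SucD[OF Suc.prems(3,1)]
  show ?case
  proof (rule C_on_SucI[OF Suc.prems(1)])
    show "((\<lambda>x. c x *\<^sub>R f x) has_derivative
       (\<lambda>v. c x *\<^sub>R frechet_derivative f (at x) v + frechet_derivative c (at x) v *\<^sub>R f x)) (at x)"
      if "x \<in> S" for x
      by (rule has_derivative_scaleR[OF c(1)[OF that] f(1)[OF that]])
    show "C_on k S (\<lambda>x. c x *\<^sub>R frechet_derivative f (at x) v + frechet_derivative c (at x) v *\<^sub>R f x)" for v
      by (rule C_on_add[OF Suc.prems(1) Suc.IH[OF Suc.prems(1) C_on_pred[OF Suc.prems(1,2)] f(2)]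
            Suc.IH[OF Suc.prems(1) c(2) C_on_pred[OF Suc.prems(1,3)]]])
  qed
qed

lemma linear_sum_Basis:
  assumes "linear f"
  shows "f w = (\<Sum>i\<in>Basis. (w \<bullet> i) *\<^sub>R f i)"
proof -
  have "f w = f (\<Sum>i\<in>Basis. (w \<bullet> i) *\<^sub>R i)"
    by (rule arg_cong[OF euclidean_representation[symmetric]])
  also have "\<dots> = (\<Sum>i\<in>Basis. (w \<bullet> i) *\<^sub>R f i)"
    by (simp only: linear_sum[OF assms] linear_scale[OF assms])
  finally show ?thesis .
qed

text \<open>Expanding the derivative of the composite in the standard basis writes it as a sum of products
  of scalar and vector functions of class \<open>C^k\<close>, so that the induction hypothesis applies to each
  partial derivative of \<open>g\<close> composed with \<open>f\<close>.\<close>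

lemma C_on_compose:
  assumes "open S" "open S'" "C_on k S f" "f ` S \<subseteq> S'" "C_on k S' g"
  shows "C_on k S (\<lambda>x. g (f x))"
  using assms
proof (induction k arbitrary: g)
  case 0
  then show ?case
    using continuous_on_compose2 by (metis C_on.simps(1))
next
  case (Suc k)
  note f = C_on_SucD[OF Suc.prems(3,1)] and g = C_on_SucD[OF Suc.prems(5,2)]
  show ?case
  proof (rule C_on_SucI[OF Suc.prems(1)])
    show "((\<lambda>x. g (f x)) has_derivative
       (\<lambda>v. \<Sum>i\<in>Basis. (frechet_derivative f (at x) v \<bullet> i) *\<^sub>R frechet_derivative g (at (f x)) i)) (at x)"
      if "x \<in> S" for x
    proof -
      have gx: "(g has_derivative frechet_derivative g (at (f x))) (at (f x))"
        using g(1) Suc.prems(4) that by blast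
      show ?thesis
        by (rule has_derivative_eq_rhs[OF has_derivative_compose[OF f(1)[OF that] gx]])
           (rule ext, rule linear_sum_Basis[OF has_derivative_linear[OF gx]])
    qed
    show "C_on k S (\<lambda>x. \<Sum>i\<in>Basis. (frechet_derivative f (at x) v \<bullet> i) *\<^sub>R frechet_derivative g (at (f x)) i)" for v
    proof (intro C_on_sum C_on_scaleR Suc.prems(1))
      fix i :: 'b assume "i \<in> Basis"
      show "C_on k S (\<lambda>x. frechet_derivative f (at x) v \<bullet> i)"
        by (rule C_on_bounded_linear_comp[OF Suc.prems(1) f(2) bounded_linear_inner_left])
      show "C_on k S (\<lambda>x. frechet_derivative g (at (f x)) i)"
        by (rule Suc.IH[OF Suc.prems(1,2) C_on_pred[OF Suc.prems(1,3)] Suc.prems(4) g(2)])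
    qed
  qed
qed

lemma C_on_Pair:
  assumes "open S" "C_on k S f" "C_on k S g"
  shows "C_on k S (\<lambda>x. (f x, g x))"
proof -
  have "bounded_linear (\<lambda>u. (u, 0))" "bounded_linear (\<lambda>u. (0, u))"
    by (auto intro!: bounded_linear_Pair bounded_linear_ident bounded_linear_zero)
  from C_on_add[OF assms(1) C_on_bounded_linear_comp[OF assms(1,2) this(1)]
      C_on_bounded_linear_comp[OF assms(1,3) this(2)]]
  show ?thesis by simp
qed

lemma smooth_on_cong: "(\<And>x. x \<in> S \<Longrightarrow> f x = g x) \<Longrightarrow> smooth_on S f \<longleftrightarrow> smooth_on S g"
  unfolding smooth_on_def using C_on_cong by blast

lemma smooth_on_cong_imp: "smooth_on S f \<Longrightarrow> (\<And>x. x \<in> S \<Longrightarrow> f x = g x) \<Longrightarrow> smooth_on S g"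
  using smooth_on_cong[of S f g] by simp

lemma smooth_on_mono: "smooth_on S f \<Longrightarrow> open S \<Longrightarrow> open S' \<Longrightarrow> S' \<subseteq> S \<Longrightarrow> smooth_on S' f"
  unfolding smooth_on_def using C_on_mono by blast

lemma smooth_on_local:
  "open S \<Longrightarrow> (\<And>x. x \<in> S \<Longrightarrow> \<exists>W. open W \<and> x \<in> W \<and> W \<subseteq> S \<and> smooth_on W f) \<Longrightarrow> smooth_on S f"
  unfolding smooth_on_def
proof (intro allI C_on_local)
  fix k x
  assume "x \<in> S" "\<And>x. x \<in> S \<Longrightarrow> \<exists>W. open W \<and> x \<in> W \<and> W \<subseteq> S \<and> (\<forall>k. C_on k W f)"
  then obtain W where "open W" "x \<in> W" "W \<subseteq> S" "\<forall>k. C_on k W f" by blast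
  then show "\<exists>W. open W \<and> x \<in> W \<and> W \<subseteq> S \<and> C_on k W f" by blast
qed

lemma smooth_on_const: "open S \<Longrightarrow> smooth_on S (\<lambda>x. c)"
  by (simp add: smooth_on_def C_on_const)

lemma smooth_on_bounded_linear_comp:
  "open S \<Longrightarrow> smooth_on S f \<Longrightarrow> bounded_linear L \<Longrightarrow> smooth_on S (\<lambda>x. L (f x))"
  by (simp add: smooth_on_def C_on_bounded_linear_comp)

lemma smooth_on_add: "open S \<Longrightarrow> smooth_on S f \<Longrightarrow> smooth_on S g \<Longrightarrow> smooth_on S (\<lambda>x. f x + g x)"
  by (simp add: smooth_on_def C_on_add)

lemma smooth_on_Pair: "open S \<Longrightarrow> smooth_on S f \<Longrightarrow> smooth_on S g \<Longrightarrow> smooth_on S (\<lambda>x. (f x, g x))"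
  by (simp add: smooth_on_def C_on_Pair)

lemma smooth_on_compose:
  "smooth_on S' g \<Longrightarrow> smooth_on S f \<Longrightarrow> open S \<Longrightarrow> open S' \<Longrightarrow> (\<And>x. x \<in> S \<Longrightarrow> f x \<in> S')
    \<Longrightarrow> smooth_on S (\<lambda>x. g (f x))"
  unfolding smooth_on_def using C_on_compose[of S S' _ f g] by blast

lemma smooth_on_id: "open S \<Longrightarrow> smooth_on S (\<lambda>x. x)"
  unfolding smooth_on_def
proof
  fix k assume S: "open S"
  show "C_on k S (\<lambda>x. x)"
  proof (cases k)
    case (Suc j)
    show ?thesis unfolding Suc
      by (rule C_on_SucI[OF S, where f'="\<lambda>_ v. v"]) (auto intro: C_on_const S)
  qed simp
qed

lemma smooth_on_bounded_linear: "open S \<Longrightarrow> bounded_linear L \<Longrightarrow> smooth_on S L"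
  using smooth_on_bounded_linear_comp[OF _ smooth_on_id] by blast

lemma smooth_on_has_derivative:
  "smooth_on S f \<Longrightarrow> open S \<Longrightarrow> x \<in> S \<Longrightarrow> (f has_derivative frechet_derivative f (at x)) (at x)"
  unfolding smooth_on_def using C_on_SucD(1) by blast

lemma smooth_on_frechet_derivative:
  "smooth_on S f \<Longrightarrow> open S \<Longrightarrow> smooth_on S (\<lambda>x. frechet_derivative f (at x) v)"
  unfolding smooth_on_def using C_on_SucD(2) by blast

lemma smooth_on_continuous_on: "smooth_on S f \<Longrightarrow> continuous_on S f"
  unfolding smooth_on_def by (metis C_on.simps(1))

lemma smooth_on_directional_derivative:
  assumes "smooth_on S' f" "open S'" "open S" "smooth_on S g" "\<And>x. x \<in> S \<Longrightarrow> g x \<in> S'" "smooth_on S h"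
  shows "smooth_on S (\<lambda>x. frechet_derivative f (at (g x)) (h x))"
proof -
  have "smooth_on S (\<lambda>x. frechet_derivative f (at (g x)) i)" for i
    by (rule smooth_on_compose[OF smooth_on_frechet_derivative[OF assms(1,2)] assms(4,3,2,5)])
  moreover have "smooth_on S (\<lambda>x. h x \<bullet> i)" for i
    by (rule smooth_on_bounded_linear_comp[OF assms(3,6) bounded_linear_inner_left])
  ultimately have "smooth_on S (\<lambda>x. \<Sum>i\<in>Basis. (h x \<bullet> i) *\<^sub>R frechet_derivative f (at (g x)) i)"
    using assms(3) unfolding smooth_on_def by (auto intro!: C_on_sum C_on_scaleR)
  moreover have "frechet_derivative f (at (g x)) (h x)
      = (\<Sum>i\<in>Basis. (h x \<bullet> i) *\<^sub>R frechet_derivative f (at (g x)) i)" if "x \<in> S" for x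
    by (rule linear_sum_Basis[OF has_derivative_linear
          [OF smooth_on_has_derivative[OF assms(1,2) assms(5)[OF that]]]])
  ultimately show ?thesis by (simp cong: smooth_on_cong)
qed

text \<open>The product rule for a derivative in a direction that varies with the point. It computes the
  derivative of a left-invariant field applied to a function.\<close>

lemma smooth_on_directional_has_derivative:
  fixes f :: "'a::euclidean_space \<Rightarrow> 'c::euclidean_space"
  assumes f: "smooth_on S f" "open S" "x \<in> S" and h: "(h has_derivative h') (at x)"
  shows "((\<lambda>a. frechet_derivative f (at a) (h a)) has_derivative
    (\<lambda>z. frechet_derivative (\<lambda>a. frechet_derivative f (at a) (h x)) (at x) z + frechet_derivative f (at x) (h' z))) (at x)"
proof -
  define D where "D = (\<lambda>i. frechet_derivative (\<lambda>a. frechet_derivative f (at a) i) (at x))"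
  have D: "((\<lambda>a. frechet_derivative f (at a) i) has_derivative D i) (at x)" for i
    unfolding D_def by (rule smooth_on_has_derivative[OF smooth_on_frechet_derivative[OF f(1,2)] f(2,3)])
  have repr: "frechet_derivative f (at a) w = (\<Sum>i\<in>Basis. (w \<bullet> i) *\<^sub>R frechet_derivative f (at a) i)"
    if "a \<in> S" for a w
    by (rule linear_sum_Basis[OF has_derivative_linear[OF smooth_on_has_derivative[OF f(1,2) that]]])
  have 1: "((\<lambda>a. \<Sum>i\<in>Basis. (h a \<bullet> i) *\<^sub>R frechet_derivative f (at a) i) has_derivative
      (\<lambda>z. \<Sum>i\<in>Basis. (h x \<bullet> i) *\<^sub>R D i z + (h' z \<bullet> i) *\<^sub>R frechet_derivative f (at x) i)) (at x)"
    by (intro has_derivative_sum has_derivative_scaleR D bounded_linear.has_derivative[OF bounded_linear_inner_left] h)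
  have 2: "((\<lambda>a. \<Sum>i\<in>Basis. (h x \<bullet> i) *\<^sub>R frechet_derivative f (at a) i) has_derivative
      (\<lambda>z. \<Sum>i\<in>Basis. (h x \<bullet> i) *\<^sub>R D i z)) (at x)"
    by (intro has_derivative_sum has_derivative_scaleR_right D)
  have "((\<lambda>a. frechet_derivative f (at a) (h x)) has_derivative
      (\<lambda>z. \<Sum>i\<in>Basis. (h x \<bullet> i) *\<^sub>R D i z)) (at x)"
    by (rule has_derivative_transform_within_open[OF 2 f(2,3)]) (rule repr[symmetric])
  from frechet_derivative_at[OF this]
  have 3: "frechet_derivative (\<lambda>a. frechet_derivative f (at a) (h x)) (at x) = (\<lambda>z. \<Sum>i\<in>Basis. (h x \<bullet> i) *\<^sub>R D i z)" ..
  have "((\<lambda>a. frechet_derivative f (at a) (h a)) has_derivative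
      (\<lambda>z. \<Sum>i\<in>Basis. (h x \<bullet> i) *\<^sub>R D i z + (h' z \<bullet> i) *\<^sub>R frechet_derivative f (at x) i)) (at x)"
    by (rule has_derivative_transform_within_open[OF 1 f(2,3)]) (rule repr[symmetric])
  then show ?thesis
  proof (rule has_derivative_eq_rhs, intro ext)
    fix z
    show "(\<Sum>i\<in>Basis. (h x \<bullet> i) *\<^sub>R D i z + (h' z \<bullet> i) *\<^sub>R frechet_derivative f (at x) i)
      = frechet_derivative (\<lambda>a. frechet_derivative f (at a) (h x)) (at x) z + frechet_derivative f (at x) (h' z)"
      unfolding 3 repr[OF f(3), of "h' z"] by (rule sum.distrib)
  qed
qed

text \<open>The mean value inequality, applied to \<open>f\<close> minus its derivative at \<open>x\<close>: the derivative of this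
  difference is small near \<open>x\<close> by continuity.\<close>

lemma smooth_on_strict_derivative:
  fixes f :: "'a::euclidean_space \<Rightarrow> 'b::euclidean_space"
  assumes f: "smooth_on S f" "open S" "x \<in> S" and "\<epsilon> > 0"
  shows "\<exists>\<delta>>0. \<forall>p\<in>ball x \<delta>. \<forall>q\<in>ball x \<delta>.
    norm (f p - f q - frechet_derivative f (at x) (p - q)) \<le> \<epsilon> * norm (p - q)"
proof -
  let ?D = "\<lambda>y. frechet_derivative f (at y)"
  have D: "(f has_derivative ?D y) (at y)" if "y \<in> S" for y
    by (rule smooth_on_has_derivative[OF f(1,2) that])
  define N where "N = (\<lambda>y. \<Sum>i\<in>Basis. norm (?D y i - ?D x i))"
  have "continuous_on S (\<lambda>y. ?D y i)" for i
    by (rule smooth_on_continuous_on[OF smooth_on_frechet_derivative[OF f(1,2)]])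
  then have "continuous_on S N" unfolding N_def by (intro continuous_intros)
  then have "isCont N x" using f(2,3) by (simp add: continuous_on_eq_continuous_at)
  then have "(N \<longlongrightarrow> N x) (nhds x)" by (simp only: isCont_def tendsto_at_iff_tendsto_nhds)
  moreover have "N x < \<epsilon>" using \<open>\<epsilon> > 0\<close> by (simp add: N_def)
  ultimately have "\<forall>\<^sub>F y in nhds x. N y < \<epsilon>" by (rule order_tendstoD(2))
  moreover have "\<forall>\<^sub>F y in nhds x. y \<in> S" using f(2,3) by (rule eventually_nhds_in_open)
  ultimately have "\<forall>\<^sub>F y in nhds x. y \<in> S \<and> N y < \<epsilon>" by eventually_elim auto
  then obtain d where d: "d > 0" "\<And>y. dist y x < d \<Longrightarrow> y \<in> S \<and> N y < \<epsilon>"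
    by (auto simp: eventually_nhds_metric)
  have "norm ((f p - ?D x p) - (f q - ?D x q)) \<le> \<epsilon> * norm (p - q)" if pq: "p \<in> ball x d" "q \<in> ball x d" for p q
  proof (rule differentiable_bound[OF convex_ball[of x d] _ _ pq])
    fix y assume "y \<in> ball x d"
    then have y: "y \<in> S" "N y < \<epsilon>" using d(2)[of y] by (auto simp: dist_commute)
    have "((\<lambda>y. f y - ?D x y) has_derivative (\<lambda>h. ?D y h - ?D x h)) (at y)"
      by (rule has_derivative_diff[OF D[OF y(1)] bounded_linear_imp_has_derivative[OF has_derivative_bounded_linear[OF D[OF f(3)]]]])
    then show "((\<lambda>y. f y - ?D x y) has_derivative (\<lambda>h. ?D y h - ?D x h)) (at y within ball x d)"
      by (rule has_derivative_at_withinI)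
    show "onorm (\<lambda>h. ?D y h - ?D x h) \<le> \<epsilon>"
    proof (rule onorm_le)
      fix h
      have "?D y h - ?D x h = (\<Sum>i\<in>Basis. (h \<bullet> i) *\<^sub>R ?D y i) - (\<Sum>i\<in>Basis. (h \<bullet> i) *\<^sub>R ?D x i)"
        by (intro arg_cong2[where f=minus] linear_sum_Basis has_derivative_linear[OF D] y(1) f(3))
      also have "\<dots> = (\<Sum>i\<in>Basis. (h \<bullet> i) *\<^sub>R (?D y i - ?D x i))"
        by (simp add: sum_subtractf scaleR_diff_right)
      also have "norm \<dots> \<le> (\<Sum>i\<in>Basis. norm h * norm (?D y i - ?D x i))"
        by (intro sum_norm_le) (simp add: mult_right_mono Basis_le_norm)
      also have "\<dots> = N y * norm h" by (simp add: N_def sum_distrib_left mult.commute)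
      also have "\<dots> \<le> \<epsilon> * norm h" using y(2) by (intro mult_right_mono) auto
      finally show "norm (?D y h - ?D x h) \<le> \<epsilon> * norm h" .
    qed
  qed
  moreover have "(f p - ?D x p) - (f q - ?D x q) = f p - f q - ?D x (p - q)" for p q
    using linear_diff[OF has_derivative_linear[OF D[OF f(3)]], of p q] by simp
  ultimately show ?thesis using d(1) by auto
qed

text \<open>The mean value inequality is applied once in each variable to \<open>f(x, y) - H x y\<close>, whose mixed
  second derivative is small near the origin. That \<open>H\<close> depends on the directions bilinearly reduces
  the uniformity over all directions to the finitely many basis vectors.\<close>

lemma mixed_difference_estimate:
  fixes f :: "'a::euclidean_space \<times> 'b::euclidean_space \<Rightarrow> 'c::euclidean_space"
  assumes f: "smooth_on D f" and D: "open D" "0 \<in> D"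
    and H: "H = (\<lambda>z w. frechet_derivative (\<lambda>p. frechet_derivative f (at p) (0, w)) (at 0) (z, 0))"
    and "\<epsilon> > 0"
  shows "\<exists>\<delta>>0. \<forall>x\<in>ball 0 \<delta>. \<forall>x'\<in>ball 0 \<delta>. \<forall>y\<in>ball 0 \<delta>. \<forall>y'\<in>ball 0 \<delta>.
     norm (f (x, y) - f (x', y) - f (x, y') + f (x', y') - H (x - x') (y - y'))
       \<le> \<epsilon> * norm (x - x') * norm (y - y')"
    and "bounded_bilinear H"
proof -
  define P where "P = (\<lambda>p w. frechet_derivative f (at p) (0, w))"
  define H' where "H' = (\<lambda>p z w. frechet_derivative (\<lambda>p. P p w) (at p) (z, 0))"
  have f': "(f has_derivative frechet_derivative f (at p)) (at p)" if "p \<in> D" for p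
    by (rule smooth_on_has_derivative[OF f D(1) that])
  have P: "smooth_on D (\<lambda>p. P p w)" for w
    unfolding P_def by (rule smooth_on_frechet_derivative[OF f D(1)])
  have P': "((\<lambda>p. P p w) has_derivative frechet_derivative (\<lambda>p. P p w) (at p)) (at p)" if "p \<in> D" for p w
    by (rule smooth_on_has_derivative[OF P D(1) that])
  have linz: "linear (\<lambda>z. H' p z w)" if "p \<in> D" for p w
  proof -
    interpret linear "frechet_derivative (\<lambda>p. P p w) (at p)"
      using P'[OF that] by (rule has_derivative_linear)
    show ?thesis
      unfolding H'_def using add[of "(_, 0)" "(_, 0)"] scale[of _ "(_, 0)"] by unfold_locales auto
  qed
  have P_lin: "linear (P p)" if "p \<in> D" for p
  proof -
    interpret linear "frechet_derivative f (at p)"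
      using f'[OF that] by (rule has_derivative_linear)
    show ?thesis
      unfolding P_def using add[of "(0, _)" "(0, _)"] scale[of _ "(0, _)"] by unfold_locales auto
  qed
  have linw: "linear (\<lambda>w. H' p z w)" if p: "p \<in> D" for p z
  proof
    fix w w' :: 'b and c :: real
    have 1: "((\<lambda>p. P p w + P p w') has_derivative
        (\<lambda>q. frechet_derivative (\<lambda>p. P p w) (at p) q + frechet_derivative (\<lambda>p. P p w') (at p) q)) (at p)"
      by (intro has_derivative_add P' p)
    have 2: "P q w + P q w' = P q (w + w')" if "q \<in> D" for q
      using linear_add[OF P_lin[OF that]] by simp
    have "((\<lambda>p. P p (w + w')) has_derivative
        (\<lambda>q. frechet_derivative (\<lambda>p. P p w) (at p) q + frechet_derivative (\<lambda>p. P p w') (at p) q)) (at p)"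
      by (rule has_derivative_transform_within_open[OF 1 D(1) p 2])
    then show "H' p z (w + w') = H' p z w + H' p z w'"
      unfolding H'_def by (rule fun_cong[OF frechet_derivative_at[symmetric]])
    have 3: "((\<lambda>p. c *\<^sub>R P p w) has_derivative (\<lambda>q. c *\<^sub>R frechet_derivative (\<lambda>p. P p w) (at p) q)) (at p)"
      by (intro has_derivative_scaleR_right P' p)
    have 4: "c *\<^sub>R P q w = P q (c *\<^sub>R w)" if "q \<in> D" for q
      using linear_scale[OF P_lin[OF that]] by simp
    have "((\<lambda>p. P p (c *\<^sub>R w)) has_derivative
        (\<lambda>q. c *\<^sub>R frechet_derivative (\<lambda>p. P p w) (at p) q)) (at p)"
      by (rule has_derivative_transform_within_open[OF 3 D(1) p 4])
    then show "H' p z (c *\<^sub>R w) = c *\<^sub>R H' p z w"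
      unfolding H'_def by (rule fun_cong[OF frechet_derivative_at[symmetric]])
  qed
  have H0: "H = H' 0" by (simp add: H H'_def P_def)
  have expand: "H' p z w = (\<Sum>i\<in>Basis. \<Sum>j\<in>Basis. ((z \<bullet> i) * (w \<bullet> j)) *\<^sub>R H' p i j)" if p: "p \<in> D" for p z w
  proof -
    have "H' p z w = (\<Sum>i\<in>Basis. (z \<bullet> i) *\<^sub>R H' p i w)"
      by (rule linear_sum_Basis[OF linz[OF p]])
    also have "\<dots> = (\<Sum>i\<in>Basis. (z \<bullet> i) *\<^sub>R (\<Sum>j\<in>Basis. (w \<bullet> j) *\<^sub>R H' p i j))"
      by (intro sum.cong refl arg_cong2[where f=scaleR] linear_sum_Basis[OF linw[OF p]])
    finally show ?thesis by (simp add: scaleR_sum_right)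
  qed
  define N where "N = (\<lambda>p. \<Sum>i\<in>Basis. \<Sum>j\<in>Basis. norm (H' p i j - H' 0 i j))"
  have N: "norm (H' p z w - H' 0 z w) \<le> N p * norm z * norm w" if p: "p \<in> D" for p z w
  proof -
    have "H' p z w - H' 0 z w
        = (\<Sum>i\<in>Basis. \<Sum>j\<in>Basis. ((z \<bullet> i) * (w \<bullet> j)) *\<^sub>R (H' p i j - H' 0 i j))"
      unfolding expand[OF p, of z w] expand[OF D(2), of z w] by (simp add: sum_subtractf scaleR_diff_right)
    also have "norm \<dots> \<le> (\<Sum>i\<in>Basis. \<Sum>j\<in>Basis. (norm z * norm w) * norm (H' p i j - H' 0 i j))"
    proof (intro sum_norm_le)
      fix i :: 'a and j :: 'b assume ij: "i \<in> Basis" "j \<in> Basis"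
      have "\<bar>z \<bullet> i\<bar> * \<bar>w \<bullet> j\<bar> \<le> norm z * norm w"
        by (intro mult_mono Basis_le_norm ij) auto
      then show "norm (((z \<bullet> i) * (w \<bullet> j)) *\<^sub>R (H' p i j - H' 0 i j)) \<le> (norm z * norm w) * norm (H' p i j - H' 0 i j)"
        by (simp add: abs_mult mult_right_mono)
    qed
    finally show ?thesis by (simp add: N_def sum_distrib_left sum_distrib_right mult_ac)
  qed
  have "continuous_on D (\<lambda>p. H' p i j)" for i j
    unfolding H'_def by (rule smooth_on_continuous_on[OF smooth_on_frechet_derivative[OF P D(1)]])
  then have "continuous_on D N"
    unfolding N_def by (intro continuous_intros)
  then have "isCont N 0" using D by (simp add: continuous_on_eq_continuous_at)
  then have "(N \<longlongrightarrow> N 0) (nhds 0)"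
    by (simp only: isCont_def tendsto_at_iff_tendsto_nhds)
  moreover have "N 0 < \<epsilon>" using \<open>\<epsilon> > 0\<close> by (simp add: N_def)
  ultimately have "\<forall>\<^sub>F p in nhds 0. N p < \<epsilon>"
    by (rule order_tendstoD(2))
  moreover have "\<forall>\<^sub>F p in nhds 0. p \<in> D" using D by (rule eventually_nhds_in_open)
  ultimately have "\<forall>\<^sub>F p in nhds 0. p \<in> D \<and> N p < \<epsilon>" by eventually_elim auto
  then obtain d where d: "d > 0" "\<And>p. dist p 0 < d \<Longrightarrow> p \<in> D \<and> N p < \<epsilon>"
    by (auto simp: eventually_nhds_metric)
  have pair: "(a, b) \<in> D \<and> N (a, b) < \<epsilon>" if "a \<in> ball 0 (d/2)" "b \<in> ball 0 (d/2)" for a b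
  proof (rule d(2))
    show "dist (a, b) 0 < d"
      using that norm_Pair_le[of a b] by simp
  qed
  show bil: "bounded_bilinear H"
    unfolding H0 bilinear_conv_bounded_bilinear[symmetric] bilinear_def using linz linw D(2) by auto
  interpret H: bounded_bilinear H by (rule bil)
  have est: "norm (f (x, y) - f (x', y) - f (x, y') + f (x', y') - H (x - x') (y - y'))
       \<le> \<epsilon> * norm (x - x') * norm (y - y')"
    if x: "x \<in> ball 0 (d/2)" "x' \<in> ball 0 (d/2)" and y: "y \<in> ball 0 (d/2)" "y' \<in> ball 0 (d/2)" for x x' y y'
  proof -
    have derP: "norm ((P (x, b) w - H x w) - (P (x', b) w - H x' w)) \<le> \<epsilon> * norm w * norm (x - x')"
      if b: "b \<in> ball 0 (d/2)" for b w
    proof (rule differentiable_bound[OF convex_ball[of 0 "d/2"] _ _ x])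
      fix a :: 'a assume a: "a \<in> ball 0 (d/2)"
      have "((\<lambda>a. P (a, b) w) has_derivative (\<lambda>z. H' (a, b) z w)) (at a)"
        unfolding H'_def
        by (rule has_derivative_compose[OF _ P', of "\<lambda>a. (a, b)" "\<lambda>z. (z, 0)"])
           (use pair[OF a b] in \<open>auto intro!: derivative_eq_intros\<close>)
      moreover have "((\<lambda>a. H a w) has_derivative (\<lambda>z. H z w)) (at a)"
        by (rule bounded_linear_imp_has_derivative[OF H.bounded_linear_left])
      ultimately show "((\<lambda>a. P (a, b) w - H a w) has_derivative (\<lambda>z. H' (a, b) z w - H z w)) (at a within ball 0 (d/2))"
        using has_derivative_at_withinI has_derivative_diff by blast
      show "onorm (\<lambda>z. H' (a, b) z w - H z w) \<le> \<epsilon> * norm w"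
      proof (rule onorm_le)
        fix z
        have "norm (H' (a, b) z w - H z w) \<le> N (a, b) * norm z * norm w"
          using N[of "(a, b)" z w] pair[OF a b] by (simp add: H0)
        also have "\<dots> \<le> \<epsilon> * norm z * norm w"
          using pair[OF a b] by (intro mult_right_mono) auto
        finally show "norm (H' (a, b) z w - H z w) \<le> \<epsilon> * norm w * norm z" by (simp add: mult_ac)
      qed
    qed
    have "norm ((f (x, y) - f (x', y) - H (x - x') y) - (f (x, y') - f (x', y') - H (x - x') y'))
        \<le> (\<epsilon> * norm (x - x')) * norm (y - y')"
    proof (rule differentiable_bound[OF convex_ball[of 0 "d/2"] _ _ y])
      fix b :: 'b assume b: "b \<in> ball 0 (d/2)"
      have "((\<lambda>b. f (a, b)) has_derivative (\<lambda>w. P (a, b) w)) (at b)" if a: "a \<in> ball 0 (d/2)" for a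
        unfolding P_def
        by (rule has_derivative_compose[OF _ f', of "\<lambda>b. (a, b)" "\<lambda>w. (0, w)"])
           (use pair[OF a b] in \<open>auto intro!: derivative_eq_intros\<close>)
      from has_derivative_diff[OF has_derivative_diff[OF this[OF x(1)] this[OF x(2)]]
          bounded_linear_imp_has_derivative[OF H.bounded_linear_right]]
      show "((\<lambda>b. f (x, b) - f (x', b) - H (x - x') b) has_derivative
          (\<lambda>w. P (x, b) w - P (x', b) w - H (x - x') w)) (at b within ball 0 (d/2))"
        using has_derivative_at_withinI by blast
      show "onorm (\<lambda>w. P (x, b) w - P (x', b) w - H (x - x') w) \<le> \<epsilon> * norm (x - x')"
      proof (rule onorm_le)
        fix w
        show "norm (P (x, b) w - P (x', b) w - H (x - x') w) \<le> \<epsilon> * norm (x - x') * norm w"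
          using derP[OF b, of w] by (simp add: H.diff_left algebra_simps)
      qed
    qed
    moreover have "(f (x, y) - f (x', y) - H (x - x') y) - (f (x, y') - f (x', y') - H (x - x') y')
       = f (x, y) - f (x', y) - f (x, y') + f (x', y') - H (x - x') (y - y')"
      by (simp add: H.diff_right)
    ultimately show ?thesis by simp
  qed
  have "d / 2 > 0" using d(1) by simp
  with est show "\<exists>\<delta>>0. \<forall>x\<in>ball 0 \<delta>. \<forall>x'\<in>ball 0 \<delta>. \<forall>y\<in>ball 0 \<delta>. \<forall>y'\<in>ball 0 \<delta>.
     norm (f (x, y) - f (x', y) - f (x, y') + f (x', y') - H (x - x') (y - y'))
       \<le> \<epsilon> * norm (x - x') * norm (y - y')" by blast
qed

text \<open>The second difference of \<open>f\<close> at \<open>x\<close> in two directions does not depend on their order, and it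
  approximates the second derivative taken in either order, up to \<open>\<epsilon>\<close> times the norms of the
  directions. Bilinearity removes the restriction to short directions.\<close>

lemma second_derivative_symmetric:
  fixes f :: "'a::euclidean_space \<Rightarrow> 'c::euclidean_space"
  assumes f: "smooth_on S f" "open S" "x \<in> S"
  shows "frechet_derivative (\<lambda>a. frechet_derivative f (at a) w) (at x) z
       = frechet_derivative (\<lambda>a. frechet_derivative f (at a) z) (at x) w"
proof -
  define l where "l = (\<lambda>p::'a \<times> 'a. x + (fst p + snd p))"
  define g where "g = (\<lambda>p. f (l p))"
  define D where "D = l -` S"
  define H where "H = (\<lambda>z w. frechet_derivative (\<lambda>p. frechet_derivative g (at p) (0, w)) (at 0) (z, 0))"
  have l': "(l has_derivative (\<lambda>q. fst q + snd q)) (at p)" for p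
    unfolding l_def by (auto intro!: derivative_eq_intros)
  have l0: "l 0 = x" by (simp add: l_def)
  have D: "open D" "0 \<in> D"
    unfolding D_def using f by (auto intro!: open_vimage simp: l_def continuous_intros)
  have "smooth_on D l"
    unfolding l_def
    by (intro smooth_on_add D smooth_on_const smooth_on_bounded_linear bounded_linear_fst bounded_linear_snd)
  then have g: "smooth_on D g"
    unfolding g_def by (rule smooth_on_compose[OF f(1) _ D(1) f(2)]) (simp add: D_def)
  have g': "frechet_derivative f (at (l p)) w = frechet_derivative g (at p) (0, w)" if "p \<in> D" for p w
  proof -
    have "l p \<in> S" using that by (simp add: D_def)
    from has_derivative_compose[OF l' smooth_on_has_derivative[OF f(1,2) this]]
    have "(g has_derivative (\<lambda>q. frechet_derivative f (at (l p)) (fst q + snd q))) (at p)"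
      by (simp add: g_def)
    from fun_cong[OF frechet_derivative_at[OF this], of "(0, w)"] show ?thesis by simp
  qed
  have H: "H z w = frechet_derivative (\<lambda>a. frechet_derivative f (at a) w) (at x) z" for z w
  proof -
    have "((\<lambda>p. frechet_derivative f (at (l p)) w) has_derivative
        (\<lambda>q. frechet_derivative (\<lambda>a. frechet_derivative f (at a) w) (at x) (fst q + snd q))) (at 0)"
      using has_derivative_compose[OF l'[of 0], unfolded l0,
          OF smooth_on_has_derivative[OF smooth_on_frechet_derivative[OF f(1,2)] f(2,3)]] .
    from frechet_derivative_at[OF has_derivative_transform_within_open[OF this D g']]
    show ?thesis unfolding H_def by (auto dest!: fun_cong[of _ _ "(z, 0)"])
  qed
  interpret H: bounded_bilinear H
    by (rule mixed_difference_estimate(2)[OF g D H_def zero_less_one])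
  have small: "norm (H z w - H w z) \<le> \<epsilon> * (2 * norm z * norm w)" if \<epsilon>: "\<epsilon> > 0" for \<epsilon>
  proof -
    obtain d where d: "d > 0" and all: "\<forall>u\<in>ball 0 d. \<forall>u'\<in>ball 0 d. \<forall>v\<in>ball 0 d. \<forall>v'\<in>ball 0 d.
        norm (g (u, v) - g (u', v) - g (u, v') + g (u', v') - H (u - u') (v - v')) \<le> \<epsilon> * norm (u - u') * norm (v - v')"
      using mixed_difference_estimate(1)[OF g D H_def \<epsilon>] by (elim exE conjE)
    have est: "norm (g (u, v) - g (0, v) - g (u, 0) + g (0, 0) - H u v) \<le> \<epsilon> * norm u * norm v"
      if "u \<in> ball 0 d" "v \<in> ball 0 d" for u v
      using bspec[OF bspec[OF bspec[OF bspec[OF all that(1)]] that(2)], of 0 0] d by simp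
    define c where "c = norm z + norm w + 1"
    define s where "s = d / (2 * c)"
    have c: "c > 0" by (simp add: c_def add_nonneg_pos)
    then have s: "s > 0" "s * c = d / 2" using d by (simp_all add: s_def)
    have "s * norm z \<le> s * c" "s * norm w \<le> s * c"
      using s(1) by (intro mult_left_mono; simp add: c_def)+
    then have ball: "s *\<^sub>R z \<in> ball 0 d" "s *\<^sub>R w \<in> ball 0 d" using s d by simp_all
    let ?z = "s *\<^sub>R z" and ?w = "s *\<^sub>R w"
    have sym: "g (?z, ?w) - g (0, ?w) - g (?z, 0) + g (0, 0) = g (?w, ?z) - g (0, ?z) - g (?w, 0) + g (0, 0)"
      by (simp add: g_def l_def algebra_simps)
    have le: "norm (H ?z ?w - H ?w ?z) \<le> \<epsilon> * norm ?w * norm ?z + \<epsilon> * norm ?z * norm ?w"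
      using norm_triangle_le_diff[OF add_mono[OF est[OF ball(2,1)] est[OF ball(1,2)]]] unfolding sym by simp
    have "H ?z ?w - H ?w ?z = (s * s) *\<^sub>R (H z w - H w z)"
      by (simp add: H.scaleR_left H.scaleR_right scaleR_diff_right)
    then have "norm (H ?z ?w - H ?w ?z) = (s * s) * norm (H z w - H w z)" by simp
    then have "(s * s) * norm (H z w - H w z) \<le> (s * s) * (\<epsilon> * (2 * norm z * norm w))"
      using le s(1) by (simp add: mult_ac)
    then show ?thesis by (rule mult_left_le_imp_le) (use s(1) in simp)
  qed
  have "H z w = H w z"
  proof (rule ccontr)
    assume "H z w \<noteq> H w z"
    then have n: "norm (H z w - H w z) > 0" by simp
    define c where "c = 2 * norm z * norm w + 1"
    have c: "c > 0" by (simp add: c_def add_nonneg_pos)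
    have "norm (H z w - H w z) \<le> norm (H z w - H w z) / c * (2 * norm z * norm w)"
      using n c by (intro small) simp
    also have "\<dots> < norm (H z w - H w z) / c * c"
      using n c by (intro mult_strict_left_mono) (simp_all add: c_def)
    finally show False using c by simp
  qed
  then show ?thesis by (simp only: H)
qed

section \<open>Ordinary differential equations and difference quotients\<close>

lemma vector_derivative_bound:
  fixes f :: "real \<Rightarrow> 'a::real_normed_vector"
  assumes "convex S" "\<And>t. t \<in> S \<Longrightarrow> (f has_vector_derivative f' t) (at t within S)"
    "\<And>t. t \<in> S \<Longrightarrow> norm (f' t) \<le> B" "s \<in> S" "t \<in> S"
  shows "norm (f s - f t) \<le> B * \<bar>s - t\<bar>"
proof -
  have "norm (f s - f t) \<le> B * norm (s - t)"
  proof (rule differentiable_bound[OF assms(1) _ _ assms(4,5)])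
    fix r assume r: "r \<in> S"
    show "(f has_derivative (\<lambda>h. h *\<^sub>R f' r)) (at r within S)"
      using assms(2)[OF r] by (simp add: has_vector_derivative_def)
    show "onorm (\<lambda>h. h *\<^sub>R f' r) \<le> B"
    proof (rule onorm_le)
      fix h :: real
      show "norm (h *\<^sub>R f' r) \<le> B * norm h"
        using mult_right_mono[OF assms(3)[OF r], of "\<bar>h\<bar>"] by (simp add: mult.commute)
    qed
  qed
  then show ?thesis by simp
qed

text \<open>At a point where the distance between the solutions is maximal, the mean value inequality bounds
  this distance by itself times \<open>C (b - a) < 1\<close>.\<close>

lemma ode_unique:
  fixes x y :: "real \<Rightarrow> 'a::real_normed_vector"
  assumes C: "0 \<le> C" "C * (b - a) < 1"
    and x: "\<And>t. t \<in> {a..b} \<Longrightarrow> (x has_vector_derivative g (x t)) (at t within {a..b})"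
    and y: "\<And>t. t \<in> {a..b} \<Longrightarrow> (y has_vector_derivative g (y t)) (at t within {a..b})"
    and B: "\<And>t. t \<in> {a..b} \<Longrightarrow> x t \<in> B" "\<And>t. t \<in> {a..b} \<Longrightarrow> y t \<in> B"
    and lip: "\<And>p q. p \<in> B \<Longrightarrow> q \<in> B \<Longrightarrow> norm (g p - g q) \<le> C * norm (p - q)"
    and t0: "t0 \<in> {a..b}" "x t0 = y t0"
    and t: "t \<in> {a..b}"
  shows "x t = y t"
proof -
  have "continuous_on {a..b} x" "continuous_on {a..b} y"
    using continuous_on_vector_derivative[OF x] continuous_on_vector_derivative[OF y] by simp_all
  then have "continuous_on {a..b} (\<lambda>t. norm (x t - y t))"
    by (intro continuous_intros)
  then obtain s where s: "s \<in> {a..b}" "\<And>t. t \<in> {a..b} \<Longrightarrow> norm (x t - y t) \<le> norm (x s - y s)"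
    using continuous_attains_sup[OF compact_Icc, of a b "\<lambda>t. norm (x t - y t)"] t by auto
  define M where "M = norm (x s - y s)"
  have "norm ((x s - y s) - (x t0 - y t0)) \<le> (C * M) * \<bar>s - t0\<bar>"
  proof (rule vector_derivative_bound[OF _ _ _ s(1) t0(1)])
    fix t assume t: "t \<in> {a..b}"
    show "((\<lambda>t. x t - y t) has_vector_derivative g (x t) - g (y t)) (at t within {a..b})"
      by (rule has_vector_derivative_diff[OF x[OF t] y[OF t]])
    have "norm (g (x t) - g (y t)) \<le> C * norm (x t - y t)" by (rule lip[OF B(1)[OF t] B(2)[OF t]])
    also have "\<dots> \<le> C * M" unfolding M_def by (rule mult_left_mono[OF s(2)[OF t] C(1)])
    finally show "norm (g (x t) - g (y t)) \<le> C * M" .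
  qed simp
  also have "\<dots> \<le> (C * M) * (b - a)"
    using s(1) t0(1) C(1) by (intro mult_left_mono) (auto simp: M_def)
  finally have "M \<le> (C * (b - a)) * M" using t0(2) by (simp add: M_def mult_ac)
  then have "M = 0"
    using mult_strict_right_mono[OF C(2), of M] by (cases "M > 0") (auto simp: M_def)
  then show ?thesis using s(2)[OF t] by (simp add: M_def)
qed

text \<open>The integral operator is a contraction for the supremum norm. Its domain consists of bounded
  continuous functions on the whole line, a complete space, so the integrals are extended from
  \<open>[-1, 1]\<close> by clamping the argument.\<close>

lemma picard:
  fixes g :: "'a::euclidean_space \<Rightarrow> 'a"
  assumes C: "0 \<le> C" "C < 1" and lip: "\<And>p q. norm (g p - g q) \<le> C * norm (p - q)"
  shows "\<exists>x. x 0 = 0 \<and> (\<forall>t\<in>{-1..1}. (x has_vector_derivative g (x t)) (at t within {-1..1}))"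
proof -
  \<comment> \<open>the integral from 0 to \<open>t\<close>, also for negative \<open>t\<close>, where \<open>{0..t}\<close> is empty\<close>
  define I where "I = (\<lambda>f (t::real). integral {-1..t} f - integral {-1..0} (f :: real \<Rightarrow> 'a))"
  have I': "(I f has_vector_derivative f t) (at t within {-1..1})"
    if "continuous_on {-1..1} f" "t \<in> {-1..1}" for f t
    unfolding I_def
    by (rule has_vector_derivative_diff[OF integral_has_vector_derivative[OF that]
          has_vector_derivative_const, simplified])
  have I0: "I f 0 = 0" for f by (simp add: I_def)
  have g_cont: "continuous_on UNIV g"
    by (rule lipschitz_on_continuous_on[of C]) (use C lip in \<open>auto simp: lipschitz_on_def dist_norm\<close>)
  have gx_cont: "continuous_on {-1..1} (\<lambda>t. g (apply_bcontfun x t))" for x :: "real \<Rightarrow>\<^sub>C 'a"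
    by (rule continuous_on_compose2[OF g_cont]) auto
  define J where "J = (\<lambda>x t. I (\<lambda>s. g (apply_bcontfun x s)) (clamp (-1) (1::real) t))"
  have J_bcont: "J x \<in> bcontfun" for x
  proof -
    have c: "continuous_on (cbox (-1) 1) (I (\<lambda>s. g (apply_bcontfun x s)))"
      using continuous_on_vector_derivative[OF I'[OF gx_cont]] by simp
    then show ?thesis
      using clamp_continuous_on[OF c, of UNIV]
        clamp_bounded[OF compact_imp_bounded[OF compact_continuous_image[OF c compact_cbox]]]
      by (simp add: bcontfun_def J_def)
  qed
  define P where "P = (\<lambda>x. Bcontfun (J x))"
  have P: "apply_bcontfun (P x) t = J x t" for x t
    unfolding P_def by (simp add: Bcontfun_inverse[OF J_bcont])
  have "dist (P x) (P y) \<le> C * dist x y" for x y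
  proof (rule dist_bound)
    fix t :: real
    define s where "s = clamp (-1) 1 t"
    have s: "s \<in> {-1..1}" using clamp_in_interval[of "-1" "1::real" t] by (simp add: s_def)
    have "norm ((I (\<lambda>t. g (apply_bcontfun x t)) s - I (\<lambda>t. g (apply_bcontfun y t)) s)
        - (I (\<lambda>t. g (apply_bcontfun x t)) 0 - I (\<lambda>t. g (apply_bcontfun y t)) 0)) \<le> (C * dist x y) * \<bar>s - 0\<bar>"
    proof (rule vector_derivative_bound[OF _ has_vector_derivative_diff[OF I'[OF gx_cont] I'[OF gx_cont]] _ s])
      fix r :: real
      have "norm (g (apply_bcontfun x r) - g (apply_bcontfun y r)) \<le> C * dist (apply_bcontfun x r) (apply_bcontfun y r)"
        using lip by (simp add: dist_norm)
      also have "\<dots> \<le> C * dist x y" by (rule mult_left_mono[OF dist_bounded C(1)])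
      finally show "norm (g (apply_bcontfun x r) - g (apply_bcontfun y r)) \<le> C * dist x y" .
    qed auto
    also have "\<dots> \<le> (C * dist x y) * 1" using s C(1) by (intro mult_left_mono) auto
    finally show "dist (apply_bcontfun (P x) t) (apply_bcontfun (P y) t) \<le> C * dist x y"
      by (simp add: P J_def s_def[symmetric] dist_norm I0)
  qed
  then obtain x where x: "P x = x"
    using banach_fix_type[OF C, of P] by blast
  have x_eq: "apply_bcontfun x t = I (\<lambda>s. g (apply_bcontfun x s)) t" if "t \<in> {-1..1}" for t
    using P[of x t] that by (simp add: x J_def)
  have "(apply_bcontfun x has_vector_derivative g (apply_bcontfun x t)) (at t within {-1..1})" if "t \<in> {-1..1}" for t
    by (rule has_vector_derivative_transform[OF that _ I'[OF gx_cont that]]) (rule x_eq)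
  moreover have "apply_bcontfun x 0 = 0" using x_eq[of 0] I0 by simp
  ultimately show ?thesis by blast
qed

text \<open>In the applications \<open>f\<close> is the remainder of an expansion divided by \<open>s\<close> or \<open>s\<^sup>2\<close>, and \<open>g\<close> is a
  quotient that converges as \<open>s\<close> tends to 0.\<close>

lemma tendsto_null_of_little_o:
  assumes small: "\<And>\<epsilon>. \<epsilon> > 0 \<Longrightarrow> \<forall>\<^sub>F s in F. norm (f s) \<le> \<epsilon> * norm (g s)" and g: "(g \<longlongrightarrow> l) F"
  shows "(f \<longlongrightarrow> 0) F"
proof (rule tendstoI)
  fix r :: real assume r: "r > 0"
  define M where "M = norm l + 1"
  have M: "M > 0" by (simp add: M_def add_nonneg_pos)
  have "\<forall>\<^sub>F s in F. norm (g s) < M"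
    by (rule order_tendstoD(2)[OF tendsto_norm[OF g]]) (simp add: M_def)
  moreover have "\<forall>\<^sub>F s in F. norm (f s) \<le> (r / M) * norm (g s)" using r M by (intro small) simp
  ultimately show "\<forall>\<^sub>F s in F. dist (f s) 0 < r"
  proof eventually_elim
    case (elim s)
    have "(r / M) * norm (g s) < (r / M) * M" using elim r M by (intro mult_strict_left_mono) auto
    with elim M show ?case by simp
  qed
qed

lemma has_vector_derivative_quotient:
  assumes "(f has_vector_derivative f') (at (x::real))"
  shows "((\<lambda>h. (1 / h) *\<^sub>R (f (x + h) - f x)) \<longlongrightarrow> f') (at 0)"
proof -
  have "((\<lambda>h. norm (f (x + h) - f x - h *\<^sub>R f') / norm h) \<longlongrightarrow> 0) (at 0)"
    using assms by (simp add: has_vector_derivative_def has_derivative_at)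
  moreover have "norm (f (x + h) - f x - h *\<^sub>R f') / norm h = norm ((1 / h) *\<^sub>R (f (x + h) - f x) - f')"
    if "h \<noteq> 0" for h
  proof -
    have "(1 / h) *\<^sub>R (f (x + h) - f x) - f' = (1 / h) *\<^sub>R (f (x + h) - f x - h *\<^sub>R f')"
      using that by (simp add: scaleR_diff_right)
    then show ?thesis by simp
  qed
  ultimately have "((\<lambda>h. norm ((1 / h) *\<^sub>R (f (x + h) - f x) - f')) \<longlongrightarrow> 0) (at 0)"
    using Lim_transform_eventually[of _ 0 "at 0"] by (auto simp: eventually_at_filter elim!: Lim_transform_eventually)
  then show ?thesis
    using LIM_zero_cancel tendsto_norm_zero_iff by blast
qed

lemma has_derivative_quotient:
  assumes "(f has_derivative f') (at x)"
  shows "((\<lambda>h::real. (1 / h) *\<^sub>R (f (x + h *\<^sub>R w) - f x)) \<longlongrightarrow> f' w) (at 0)"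
proof -
  have "((\<lambda>h::real. x + h *\<^sub>R w) has_derivative (\<lambda>h. h *\<^sub>R w)) (at 0)"
    by (auto intro!: derivative_eq_intros)
  from has_derivative_compose[OF this, of f f'] assms
  have "((\<lambda>h::real. f (x + h *\<^sub>R w)) has_derivative (\<lambda>h. f' (h *\<^sub>R w))) (at 0)" by simp
  then have "((\<lambda>h::real. f (x + h *\<^sub>R w)) has_vector_derivative f' w) (at 0)"
    by (simp add: has_vector_derivative_def linear_scale[OF has_derivative_linear[OF assms]])
  from has_vector_derivative_quotient[OF this] show ?thesis by simp
qed

lemma has_derivative_norm_le:
  assumes "(f has_derivative f') (at x)" "\<delta> > 0"
    and bound: "\<And>y. y \<in> ball x \<delta> \<Longrightarrow> norm (f y - f x) \<le> C * norm (y - x)"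
  shows "norm (f' w) \<le> C * norm w"
proof (rule tendsto_upperbound[OF tendsto_norm[OF has_derivative_quotient[OF assms(1), of w]]])
  have "((\<lambda>h::real. x + h *\<^sub>R w) \<longlongrightarrow> x + 0 *\<^sub>R w) (at 0)" by (intro tendsto_intros)
  then have "\<forall>\<^sub>F h in at 0. x + h *\<^sub>R w \<in> ball x \<delta>"
    using topological_tendstoD[OF _ open_ball, of _ x _ x \<delta>] \<open>\<delta> > 0\<close> by simp
  moreover have "\<forall>\<^sub>F h::real in at 0. h \<noteq> 0" by (simp add: eventually_at_filter)
  ultimately show "\<forall>\<^sub>F h::real in at 0. norm ((1 / h) *\<^sub>R (f (x + h *\<^sub>R w) - f x)) \<le> C * norm w"
  proof eventually_elim
    case (elim h)
    have "norm (f (x + h *\<^sub>R w) - f x) / \<bar>h\<bar> \<le> C * norm (h *\<^sub>R w) / \<bar>h\<bar>"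
      using bound[OF elim(1)] by (intro divide_right_mono) auto
    with elim(2) show ?case by simp
  qed
qed simp

section \<open>Local Lie groups\<close>

text \<open>The multiplication of a Lie group in a chart that is centred at the identity. Outside of the open
  set \<open>D\<close> the product may leave the chart, and \<open>m\<close> is arbitrary.\<close>

locale local_lie_group =
  fixes m :: "'e::euclidean_space \<times> 'e \<Rightarrow> 'e" and D :: "('e \<times> 'e) set"
  assumes smooth_m: "smooth_on D m" and open_D: "open D" and zero_D: "0 \<in> D"
    and right_unit: "(x, 0) \<in> D \<Longrightarrow> m (x, 0) = x"
    and left_unit: "(0, x) \<in> D \<Longrightarrow> m (0, x) = x"
    and assoc: "(a, b) \<in> D \<Longrightarrow> (m (a, b), c) \<in> D \<Longrightarrow> (b, c) \<in> D \<Longrightarrow> (a, m (b, c)) \<in> D \<Longrightarrow>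
      m (m (a, b), c) = m (a, m (b, c))"
begin

text \<open>The value at \<open>x\<close> of the left-invariant vector field with value \<open>w\<close> at the identity.\<close>

definition F :: "'e \<Rightarrow> 'e \<Rightarrow> 'e" where
  "F x w = frechet_derivative m (at (x, 0)) (0, w)"

text \<open>The second-order term of the multiplication.\<close>

definition \<beta> :: "'e \<Rightarrow> 'e \<Rightarrow> 'e" where
  "\<beta> = (\<lambda>z w. frechet_derivative (\<lambda>p. frechet_derivative m (at p) (0, w)) (at 0) (z, 0))"

lemma m_has_derivative: "p \<in> D \<Longrightarrow> (m has_derivative frechet_derivative m (at p)) (at p)"
  by (rule smooth_on_has_derivative[OF smooth_m open_D])

lemma m_has_derivative_snd:
  assumes "(x, y) \<in> D"
  shows "((\<lambda>c. m (x, c)) has_derivative (\<lambda>w. frechet_derivative m (at (x, y)) (0, w))) (at y)"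
  by (rule has_derivative_compose[of "\<lambda>c. (x, c)" "\<lambda>w. (0, w)", OF _ m_has_derivative[OF assms]])
     (auto intro!: derivative_eq_intros)

lemma F_linear: "(x, 0) \<in> D \<Longrightarrow> linear (F x)"
  using has_derivative_linear[OF m_has_derivative_snd[of x 0]] by (simp add: F_def[abs_def])

lemma F_zero: "F 0 w = w"
proof -
  have S: "open (Pair 0 -` D :: 'e set)" by (intro open_vimage open_D continuous_intros)
  have S0: "(0::'e) \<in> Pair 0 -` D" using zero_D by (simp add: zero_prod_def)
  have "((\<lambda>c. c) has_derivative (\<lambda>w. frechet_derivative m (at (0, 0)) (0, w))) (at 0)"
    by (rule has_derivative_transform_within_open[OF m_has_derivative_snd S S0])
       (use zero_D left_unit in \<open>auto simp: zero_prod_def\<close>)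
  from has_derivative_unique[OF this has_derivative_ident] show ?thesis
    by (simp add: F_def fun_eq_iff)
qed

lemma F_smooth: "open S \<Longrightarrow> (\<And>x. x \<in> S \<Longrightarrow> (x, 0) \<in> D) \<Longrightarrow> smooth_on S (\<lambda>x. F x w)"
  unfolding F_def
  by (rule smooth_on_compose[OF smooth_on_frechet_derivative[OF smooth_m open_D] _ _ open_D])
     (auto intro!: smooth_on_Pair smooth_on_id smooth_on_const)

lemma F_derivative: "((\<lambda>x. F x w) has_derivative (\<lambda>z. \<beta> z w)) (at 0)"
proof -
  have "((\<lambda>x. (x, 0::'e)) has_derivative (\<lambda>z. (z, 0))) (at 0)"
    by (auto intro!: derivative_eq_intros)
  from has_derivative_compose[OF this, of "\<lambda>p. frechet_derivative m (at p) (0, w)"]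
  show ?thesis
    using smooth_on_has_derivative[OF smooth_on_frechet_derivative[OF smooth_m open_D] open_D zero_D]
    unfolding F_def \<beta>_def by (simp add: zero_prod_def)
qed

lemma m_mixed_difference:
  "\<epsilon> > 0 \<Longrightarrow> \<exists>\<delta>>0. \<forall>x\<in>ball 0 \<delta>. \<forall>x'\<in>ball 0 \<delta>. \<forall>y\<in>ball 0 \<delta>. \<forall>y'\<in>ball 0 \<delta>.
    norm (m (x, y) - m (x', y) - m (x, y') + m (x', y') - \<beta> (x - x') (y - y')) \<le> \<epsilon> * norm (x - x') * norm (y - y')"
  by (rule mixed_difference_estimate(1)[OF smooth_m open_D zero_D \<beta>_def])

lemma \<beta>_bilinear: "bounded_bilinear \<beta>"
  by (rule mixed_difference_estimate(2)[OF smooth_m open_D zero_D \<beta>_def zero_less_one])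

lemma D_ball: obtains \<delta> where "\<delta> > 0" "ball 0 \<delta> \<times> ball 0 \<delta> \<subseteq> D"
proof -
  obtain A B where AB: "open A" "open B" "0 \<in> A \<times> B" "A \<times> B \<subseteq> D"
    by (rule open_prod_elim[OF open_D zero_D])
  then have "open (A \<inter> B)" "0 \<in> A \<inter> B" by (auto simp: zero_prod_def)
  then obtain d where "d > 0" "ball 0 d \<subseteq> A \<inter> B"
    using openE by blast
  then show ?thesis using that[of d] AB(4) by blast
qed

text \<open>The mixed difference of \<open>m\<close> at \<open>x\<close>, \<open>y\<close> and the origin is \<open>m(x, y) - x - y\<close>, by the unit laws.\<close>

lemma m_second_order:
  assumes "\<epsilon> > 0"
  shows "\<exists>\<delta>>0. \<forall>x\<in>ball 0 \<delta>. \<forall>y\<in>ball 0 \<delta>.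
    norm (m (x, y) - x - y - \<beta> x y) \<le> \<epsilon> * norm x * norm y"
proof -
  obtain d where d: "d > 0" "\<And>x x' y y'. x \<in> ball 0 d \<Longrightarrow> x' \<in> ball 0 d \<Longrightarrow> y \<in> ball 0 d \<Longrightarrow> y' \<in> ball 0 d \<Longrightarrow>
    norm (m (x, y) - m (x', y) - m (x, y') + m (x', y') - \<beta> (x - x') (y - y')) \<le> \<epsilon> * norm (x - x') * norm (y - y')"
    using m_mixed_difference[OF assms] by blast
  obtain r where r: "r > 0" "ball 0 r \<times> ball 0 r \<subseteq> D" by (rule D_ball)
  have "norm (m (x, y) - x - y - \<beta> x y) \<le> \<epsilon> * norm x * norm y"
    if "x \<in> ball 0 (min d r)" "y \<in> ball 0 (min d r)" for x y
  proof -
    have "(x, 0) \<in> D" "(0, y) \<in> D" "(0, 0) \<in> D" using r that by auto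
    then have "m (x, 0) = x" "m (0, y) = y" "m (0, 0) = 0"
      using right_unit left_unit by auto
    then show ?thesis using d(2)[of x 0 y 0] d(1) that by (simp add: algebra_simps)
  qed
  then show ?thesis using d(1) r(1) by (intro exI[of _ "min d r"]) auto
qed

text \<open>The mixed differences of \<open>m\<close> are close to those of \<open>\<beta>\<close>, which is bounded. This single estimate
  yields all the Lipschitz bounds for the flows; shrinking \<open>R\<close> makes \<open>L R\<close> at most 1.\<close>

lemma exists_radius:
  "\<exists>R L. 0 < R \<and> 0 < L \<and> L * R \<le> 1 \<and> ball 0 R \<times> ball 0 R \<subseteq> D \<and>
     (\<forall>x\<in>ball 0 R. \<forall>x'\<in>ball 0 R. \<forall>y\<in>ball 0 R. \<forall>y'\<in>ball 0 R.
        norm (m (x, y) - m (x', y) - m (x, y') + m (x', y')) \<le> L * norm (x - x') * norm (y - y'))"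
proof -
  interpret \<beta>: bounded_bilinear \<beta> by (rule \<beta>_bilinear)
  obtain K where K: "K > 0" "\<And>x y. norm (\<beta> x y) \<le> norm x * norm y * K" using \<beta>.pos_bounded by blast
  obtain d where d: "d > 0" "\<And>x x' y y'. x \<in> ball 0 d \<Longrightarrow> x' \<in> ball 0 d \<Longrightarrow> y \<in> ball 0 d \<Longrightarrow> y' \<in> ball 0 d \<Longrightarrow>
    norm (m (x, y) - m (x', y) - m (x, y') + m (x', y') - \<beta> (x - x') (y - y')) \<le> 1 * norm (x - x') * norm (y - y')"
    using m_mixed_difference[OF zero_less_one] by blast
  obtain r where r: "r > 0" "ball 0 r \<times> ball 0 r \<subseteq> D" by (rule D_ball)
  define L where "L = 1 + K"
  define R where "R = min (min d r) (1 / L)"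
  have L: "L > 0" using K by (simp add: L_def)
  have R: "R > 0" "R \<le> d" "R \<le> r" "R \<le> 1 / L" using d r L by (auto simp: R_def)
  have "L * R \<le> 1" using R(4) L by (simp add: field_simps)
  moreover have "ball 0 R \<times> ball 0 R \<subseteq> D" using r(2) R(3) by auto
  moreover have "norm (m (x, y) - m (x', y) - m (x, y') + m (x', y')) \<le> L * norm (x - x') * norm (y - y')"
    if "x \<in> ball 0 R" "x' \<in> ball 0 R" "y \<in> ball 0 R" "y' \<in> ball 0 R" for x x' y y'
  proof -
    have "norm (m (x, y) - m (x', y) - m (x, y') + m (x', y'))
       \<le> norm (m (x, y) - m (x', y) - m (x, y') + m (x', y') - \<beta> (x - x') (y - y')) + norm (\<beta> (x - x') (y - y'))"
      using norm_triangle_ineq[of "m (x, y) - m (x', y) - m (x, y') + m (x', y') - \<beta> (x - x') (y - y')" "\<beta> (x - x') (y - y')"] by simp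
    also have "\<dots> \<le> 1 * norm (x - x') * norm (y - y') + norm (x - x') * norm (y - y') * K"
      using that R(2) by (intro add_mono K(2) d(2)) auto
    also have "\<dots> = L * norm (x - x') * norm (y - y')" by (simp add: L_def algebra_simps)
    finally show ?thesis .
  qed
  ultimately show ?thesis using R(1) L by blast
qed

end

locale bounded_local_lie_group = local_lie_group +
  fixes R L :: real
  assumes R_pos: "0 < R" and L_pos: "0 < L" and LR: "L * R \<le> 1"
    and ball_D: "ball 0 R \<times> ball 0 R \<subseteq> D"
    and mixed_L: "\<And>x x' y y'. x \<in> ball 0 R \<Longrightarrow> x' \<in> ball 0 R \<Longrightarrow> y \<in> ball 0 R \<Longrightarrow> y' \<in> ball 0 R \<Longrightarrow>
        norm (m (x, y) - m (x', y) - m (x, y') + m (x', y')) \<le> L * norm (x - x') * norm (y - y')"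
begin

lemma in_D: "norm x < R \<Longrightarrow> norm y < R \<Longrightarrow> (x, y) \<in> D"
  using ball_D by auto

lemma m_bound:
  assumes "norm x < R" "norm y < R"
  shows "norm (m (x, y) - x - y) \<le> L * norm x * norm y"
  using mixed_L[of x 0 y 0] assms R_pos right_unit[OF in_D[of x 0]] right_unit[OF in_D[of 0 0]] left_unit[OF in_D[of 0 y]]
  by (simp add: algebra_simps)

lemma F_lipschitz:
  assumes "norm x < R" "norm x' < R"
  shows "norm (F x w - F x' w) \<le> L * norm (x - x') * norm w"
proof -
  have "((\<lambda>c. m (x, c) - m (x', c)) has_derivative (\<lambda>w. F x w - F x' w)) (at 0)"
    unfolding F_def using assms R_pos by (intro has_derivative_diff m_has_derivative_snd in_D) auto
  then show ?thesis
  proof (rule has_derivative_norm_le[OF _ R_pos])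
    fix y :: 'a assume "y \<in> ball 0 R"
    then show "norm (m (x, y) - m (x', y) - (m (x, 0) - m (x', 0))) \<le> L * norm (x - x') * norm (y - 0)"
      using mixed_L[of x x' y 0] assms R_pos by (simp add: algebra_simps)
  qed
qed

lemma F_near_id: "norm x < R \<Longrightarrow> norm (F x w - w) \<le> L * norm x * norm w"
  using F_lipschitz[of x 0 w] R_pos by (simp add: F_zero)

lemma F_norm: "norm x < R \<Longrightarrow> norm (F x w) \<le> 2 * norm w"
proof -
  assume x: "norm x < R"
  have "L * norm x \<le> 1" using LR mult_left_mono[of "norm x" R L] x L_pos by linarith
  then have "L * norm x * norm w \<le> norm w" using mult_right_mono[of _ 1 "norm w"] by fastforce
  with F_near_id[OF x, of w] norm_triangle_sub[of "F x w" w] show ?thesis by linarith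
qed

lemma F_scale: "norm x < R \<Longrightarrow> F x (c *\<^sub>R w) = c *\<^sub>R F x w"
  using linear_scale[OF F_linear[OF in_D]] R_pos by simp

text \<open>Flows with initial velocity shorter than \<open>\<rho>\<close> stay within \<open>2 \<rho> = R / 8\<close> of the origin up to time 1,
  so that products of their values stay in the ball of radius \<open>R\<close>. Moreover \<open>L \<rho> \<le> 1 / 16\<close> makes the
  integral operators contractive on time intervals of length 2.\<close>

definition \<rho> :: real where "\<rho> = R / 16"

lemma \<rho>: "0 < \<rho>" "16 * \<rho> = R" "L * \<rho> \<le> 1 / 16"
  using R_pos LR by (auto simp: \<rho>_def)

lemma L_norm: "norm w < \<rho> \<Longrightarrow> L * norm w < 1 / 8"
  using \<rho>(3) mult_left_mono[of "norm w" \<rho> L] L_pos by linarith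

text \<open>Picard iteration needs a globally Lipschitz field, so \<open>F\<close> is composed with the nearest-point
  projection to a ball. The solution is too slow to leave this ball.\<close>

lemma solution_exists:
  assumes w: "norm w < \<rho>"
  shows "\<exists>x. x 0 = 0 \<and> (\<forall>t\<in>{-1..1}. (x has_vector_derivative F (x t) w) (at t within {-1..1}) \<and> norm (x t) \<le> 2 * norm w)"
proof -
  define c where "c = closest_point (cball (0::'a) (R/2))"
  have c: "norm (c p) < R" for p
    using closest_point_in_set[of "cball (0::'a) (R/2)" p] R_pos by (auto simp: c_def)
  have c_lip: "norm (c p - c q) \<le> norm (p - q)" for p q
    using closest_point_lipschitz[of "cball (0::'a) (R/2)" p q] R_pos by (simp add: c_def dist_norm)
  have c_id: "c p = p" if "norm p \<le> R / 2" for p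
    using that unfolding c_def by (intro closest_point_self) simp
  have "norm (F (c p) w - F (c q) w) \<le> (L * norm w) * norm (p - q)" for p q
  proof -
    have "norm (F (c p) w - F (c q) w) \<le> L * norm (c p - c q) * norm w" by (rule F_lipschitz[OF c c])
    also have "\<dots> \<le> L * norm (p - q) * norm w"
      using L_pos c_lip by (intro mult_right_mono mult_left_mono) auto
    finally show ?thesis by (simp add: mult_ac)
  qed
  from picard[OF _ _ this] L_norm[OF w] L_pos
  obtain x where x: "x 0 = 0" "\<And>t. t \<in> {-1..1} \<Longrightarrow> (x has_vector_derivative F (c (x t)) w) (at t within {-1..1})"
    by auto
  have bound: "norm (x t) \<le> 2 * norm w" if t: "t \<in> {-1..1}" for t
  proof -
    have "norm (x t - x 0) \<le> (2 * norm w) * \<bar>t - 0\<bar>"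
      by (rule vector_derivative_bound[OF _ x(2) _ t]) (auto intro: F_norm c)
    also have "\<dots> \<le> (2 * norm w) * 1" using t by (intro mult_left_mono) auto
    finally show ?thesis using x(1) by simp
  qed
  moreover have "c (x t) = x t" if "t \<in> {-1..1}" for t
    using bound[OF that] w \<rho> by (intro c_id) auto
  ultimately show ?thesis using x by metis
qed

definition sol :: "'a \<Rightarrow> real \<Rightarrow> 'a" where
  "sol w = (SOME x. x 0 = 0 \<and>
     (\<forall>t\<in>{-1..1}. (x has_vector_derivative F (x t) w) (at t within {-1..1}) \<and> norm (x t) \<le> 2 * norm w))"

lemma sol_solution:
  assumes "norm w < \<rho>"
  shows "sol w 0 = 0" "t \<in> {-1..1} \<Longrightarrow> (sol w has_vector_derivative F (sol w t) w) (at t within {-1..1})"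
    "t \<in> {-1..1} \<Longrightarrow> norm (sol w t) \<le> 2 * norm w"
  using someI_ex[OF solution_exists[OF assms]] unfolding sol_def[symmetric] by blast+

lemma flow_unique:
  assumes w: "L * norm w * (b - a) < 1"
    and x: "\<And>t. t \<in> {a..b} \<Longrightarrow> (x has_vector_derivative F (x t) w) (at t within {a..b})"
       "\<And>t. t \<in> {a..b} \<Longrightarrow> norm (x t) < R"
    and y: "\<And>t. t \<in> {a..b} \<Longrightarrow> (y has_vector_derivative F (y t) w) (at t within {a..b})"
       "\<And>t. t \<in> {a..b} \<Longrightarrow> norm (y t) < R"
    and "t0 \<in> {a..b}" "x t0 = y t0" "t \<in> {a..b}"
  shows "x t = y t"
proof (rule ode_unique[where g="\<lambda>p. F p w" and C="L * norm w" and B="ball 0 R"])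
  show "norm (F p w - F q w) \<le> L * norm w * norm (p - q)" if "p \<in> ball 0 R" "q \<in> ball 0 R" for p q
    using F_lipschitz[of p q w] that by (simp add: mult_ac)
qed (use assms L_pos in auto)

text \<open>The exponential map in the chart: the value at time 1 of the flow of a left-invariant field
  through the identity.\<close>

definition e :: "'a \<Rightarrow> 'a" where "e w = sol w 1"

text \<open>Uniqueness of solutions: slowing down time scales the velocity, as \<open>F\<close> is linear in the velocity.\<close>

lemma e_line:
  assumes w: "norm w < \<rho>" and s: "s \<in> {-1..1}"
  shows "e (s *\<^sub>R w) = sol w s"
proof -
  have sw: "norm (s *\<^sub>R w) < \<rho>"
  proof -
    have "\<bar>s\<bar> * norm w \<le> 1 * norm w" using s by (intro mult_right_mono) auto
    with w show ?thesis by simp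
  qed
  have "sol (s *\<^sub>R w) 1 = sol w (s * 1)"
  proof (rule flow_unique[where a="-1" and b=1 and w="s *\<^sub>R w" and ?t0.0=0 and x="sol (s *\<^sub>R w)"
        and y="\<lambda>t. sol w (s * t)" and t=1])
    show "L * norm (s *\<^sub>R w) * (1 - - 1) < 1" using L_norm[OF sw] by simp
    fix t :: real assume t: "t \<in> {-1..1}"
    have "\<bar>s * t\<bar> \<le> 1" using s t by (auto simp: abs_mult intro!: mult_le_one)
    then have st: "s * t \<in> {-1..1}" by auto
    have sub: "(\<lambda>t. s * t) ` {-1..1} \<subseteq> {-1..1}"
    proof clarify
      fix r :: real assume "r \<in> {-1..1}"
      then have "\<bar>s * r\<bar> \<le> 1" using s by (auto simp: abs_mult intro!: mult_le_one)
      then show "s * r \<in> {-1..1}" by auto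
    qed
    have "((\<lambda>t. s * t) has_vector_derivative s) (at t within {-1..1})"
      by (auto intro!: derivative_eq_intros)
    from vector_diff_chain_within[OF this has_vector_derivative_within_subset[OF sol_solution(2)[OF w st] sub]]
    show "((\<lambda>t. sol w (s * t)) has_vector_derivative F (sol w (s * t)) (s *\<^sub>R w)) (at t within {-1..1})"
      using sol_solution(3)[OF w st] w \<rho> by (simp add: o_def F_scale)
    show "norm (sol w (s * t)) < R" using sol_solution(3)[OF w st] w \<rho> by auto
    show "norm (sol (s *\<^sub>R w) t) < R" using sol_solution(3)[OF sw t] sw \<rho> by auto
  qed (use sol_solution[OF sw] sol_solution(1)[OF w] in auto)
  then show ?thesis by (simp add: e_def)
qed

lemma e_zero: "e 0 = 0"
  using e_line[of 0 0] sol_solution(1)[of 0] \<rho>(1) by simp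

lemma e_norm: "norm w < \<rho> \<Longrightarrow> norm (e w) \<le> 2 * norm w"
  using sol_solution(3)[of w 1] by (simp add: e_def)

lemma e_in_ball: "norm w < \<rho> \<Longrightarrow> norm (e w) < R"
  using e_norm[of w] \<rho> by auto

lemma e_derivative:
  assumes "norm (t *\<^sub>R w) < \<rho>"
  shows "((\<lambda>t. e (t *\<^sub>R w)) has_vector_derivative F (e (t *\<^sub>R w)) w) (at t)"
proof -
  \<comment> \<open>rescaling by \<open>\<sigma>\<close> moves the time \<open>t\<close> into the interior of the unit interval\<close>
  obtain \<sigma> where \<sigma>: "\<bar>t\<bar> < \<sigma>" "\<sigma> * norm w < \<rho>"
  proof (cases "w = 0")
    case True
    then show ?thesis using that[of "\<bar>t\<bar> + 1"] \<rho>(1) by simp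
  next
    case False
    then have "\<bar>t\<bar> < \<rho> / norm w" using assms by (simp add: field_simps)
    then obtain \<sigma> where "\<bar>t\<bar> < \<sigma>" "\<sigma> < \<rho> / norm w" using dense by blast
    then show ?thesis using that[of \<sigma>] False by (simp add: field_simps)
  qed
  have \<sigma>_pos: "\<sigma> > 0" using \<sigma>(1) by linarith
  define v where "v = \<sigma> *\<^sub>R w"
  have v: "norm v < \<rho>" using \<sigma> by (simp add: v_def)
  have s: "t / \<sigma> \<in> {-1<..<1}" using \<sigma>(1) by (auto simp: field_simps abs_less_iff)
  have line: "e (s *\<^sub>R w) = sol v (s / \<sigma>)" if "s / \<sigma> \<in> {-1..1}" for s
    using e_line[OF v that] \<sigma>(1) by (simp add: v_def)
  have "(sol v has_vector_derivative F (sol v (t / \<sigma>)) v) (at (t / \<sigma>) within {-1..1})"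
    using sol_solution(2)[OF v, of "t / \<sigma>"] s by auto
  then have "(sol v has_vector_derivative F (sol v (t / \<sigma>)) v) (at (t / \<sigma>))"
    using at_within_Icc_at[of "-1" "t / \<sigma>" 1] s by simp
  moreover have "((\<lambda>t. t / \<sigma>) has_vector_derivative 1 / \<sigma>) (at t)"
    using DERIV_cdivide[OF DERIV_ident, of \<sigma> t UNIV] by (simp add: has_real_derivative_iff_has_vector_derivative)
  ultimately have "((\<lambda>t. sol v (t / \<sigma>)) has_vector_derivative (1 / \<sigma>) *\<^sub>R F (sol v (t / \<sigma>)) v) (at t)"
    using vector_diff_chain_at[of "\<lambda>t. t / \<sigma>" "1 / \<sigma>" t "sol v"] by (simp add: o_def)
  moreover have "(1 / \<sigma>) *\<^sub>R F (sol v (t / \<sigma>)) v = F (e (t *\<^sub>R w)) w"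
    using line[of t] s \<sigma>_pos F_scale[OF e_in_ball[OF assms], of \<sigma> w] by (simp add: v_def)
  ultimately have d: "((\<lambda>t. sol v (t / \<sigma>)) has_vector_derivative F (e (t *\<^sub>R w)) w) (at t)" by simp
  show ?thesis
  proof (rule has_vector_derivative_transform_within_open[OF d])
    show "open {-\<sigma><..<\<sigma>}" "t \<in> {-\<sigma><..<\<sigma>}" using \<sigma>(1) by auto
    show "sol v (s / \<sigma>) = e (s *\<^sub>R w)" if "s \<in> {-\<sigma><..<\<sigma>}" for s
      using that by (intro line[symmetric]) (auto simp: field_simps)
  qed
qed

text \<open>Strict differentiability at the origin, with the identity as the derivative. Let \<open>M\<close> be the
  maximal distance of the flows of \<open>u\<close> and \<open>v\<close>. Integrating the difference of the two differential
  equations bounds the deviation from \<open>t (u - v)\<close> by multiples of \<open>M\<close> and \<open>\<bar>u - v\<bar>\<close>, and also shows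
  \<open>M \<le> 2 \<bar>u - v\<bar>\<close>.\<close>

lemma e_strict:
  assumes u: "norm u < \<rho>" "norm u \<le> r" and v: "norm v < \<rho>" "norm v \<le> r"
  shows "norm (e u - e v - (u - v)) \<le> 4 * L * r * norm (u - v)"
proof -
  have conv: "norm (t *\<^sub>R w) \<le> norm w" if "t \<in> {0..1}" for t :: real and w :: 'a
    using that mult_right_mono[of t 1 "norm w"] by simp
  have cont: "continuous_on {0..1} (\<lambda>t. e (t *\<^sub>R w))" if "norm w < \<rho>" for w
  proof (intro continuous_at_imp_continuous_on ballI)
    fix t :: real assume "t \<in> {0..1}"
    then have "norm (t *\<^sub>R w) < \<rho>" using conv[of t w] that by linarith
    then show "isCont (\<lambda>t. e (t *\<^sub>R w)) t" by (rule has_vector_derivative_continuous[OF e_derivative])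
  qed
  have "continuous_on {0..1} (\<lambda>t. norm (e (t *\<^sub>R u) - e (t *\<^sub>R v)))"
    using cont[OF u(1)] cont[OF v(1)] by (intro continuous_intros)
  then obtain s where s: "s \<in> {0..1}"
    "\<And>t. t \<in> {0..1} \<Longrightarrow> norm (e (t *\<^sub>R u) - e (t *\<^sub>R v)) \<le> norm (e (s *\<^sub>R u) - e (s *\<^sub>R v))"
    using continuous_attains_sup[OF compact_Icc, of 0 "1::real" "\<lambda>t. norm (e (t *\<^sub>R u) - e (t *\<^sub>R v))"] by auto
  define M where "M = norm (e (s *\<^sub>R u) - e (s *\<^sub>R v))"
  define B where "B = L * M * r + 2 * L * r * norm (u - v)"
  have Lu: "L * norm u \<le> 1 / 8" and Lv: "L * norm v \<le> 1 / 8" using L_norm[OF u(1)] L_norm[OF v(1)] by auto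
  have deriv: "norm ((F (e (t *\<^sub>R u)) u - F (e (t *\<^sub>R v)) v) - (u - v)) \<le> L * M * norm u + 2 * L * norm v * norm (u - v)"
    if t: "t \<in> {0..1}" for t
  proof -
    have eu: "norm (e (t *\<^sub>R u)) < R" and ev: "norm (e (t *\<^sub>R v)) < R"
      using e_in_ball conv[OF t] u v by (meson le_less_trans)+
    have "norm (t *\<^sub>R v) < \<rho>" using conv[OF t, of v] v by linarith
    then have ev2: "norm (e (t *\<^sub>R v)) \<le> 2 * norm v" using e_norm conv[OF t, of v] by (meson order_trans mult_left_mono zero_le_numeral)
    have "F (e (t *\<^sub>R v)) u - F (e (t *\<^sub>R v)) v = F (e (t *\<^sub>R v)) (u - v)"
      using linear_diff[OF F_linear[OF in_D[OF ev]]] R_pos by simp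
    then have "(F (e (t *\<^sub>R u)) u - F (e (t *\<^sub>R v)) v) - (u - v)
       = (F (e (t *\<^sub>R u)) u - F (e (t *\<^sub>R v)) u) + (F (e (t *\<^sub>R v)) (u - v) - (u - v))" by (simp add: algebra_simps)
    also have "norm \<dots> \<le> L * norm (e (t *\<^sub>R u) - e (t *\<^sub>R v)) * norm u + L * norm (e (t *\<^sub>R v)) * norm (u - v)"
      by (intro norm_triangle_le add_mono F_lipschitz F_near_id eu ev)
    also have "\<dots> \<le> L * M * norm u + L * (2 * norm v) * norm (u - v)"
      using L_pos s(2)[OF t] ev2 unfolding M_def by (intro add_mono mult_right_mono mult_left_mono) auto
    finally show ?thesis by simp
  qed
  have diff: "norm ((e (t *\<^sub>R u) - e (t *\<^sub>R v) - t *\<^sub>R (u - v)) - (e (0 *\<^sub>R u) - e (0 *\<^sub>R v) - 0 *\<^sub>R (u - v)))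
      \<le> (L * M * norm u + 2 * L * norm v * norm (u - v)) * \<bar>t - 0\<bar>" if t: "t \<in> {0..1}" for t
  proof (rule vector_derivative_bound[OF _ _ deriv t])
    fix t :: real assume t: "t \<in> {0..1}"
    have "norm (t *\<^sub>R u) < \<rho>" "norm (t *\<^sub>R v) < \<rho>" using conv[OF t, of u] conv[OF t, of v] u v by linarith+
    then have "((\<lambda>t. e (t *\<^sub>R u) - e (t *\<^sub>R v) - t *\<^sub>R (u - v)) has_vector_derivative
        F (e (t *\<^sub>R u)) u - F (e (t *\<^sub>R v)) v - (u - v)) (at t)"
      by (intro has_vector_derivative_diff e_derivative) (auto intro!: derivative_eq_intros)
    then show "((\<lambda>t. e (t *\<^sub>R u) - e (t *\<^sub>R v) - t *\<^sub>R (u - v)) has_vector_derivative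
        F (e (t *\<^sub>R u)) u - F (e (t *\<^sub>R v)) v - (u - v)) (at t within {0..1})"
      by (rule has_vector_derivative_at_within)
  qed auto
  have bound: "norm (e (t *\<^sub>R u) - e (t *\<^sub>R v) - t *\<^sub>R (u - v)) \<le> L * M * norm u + 2 * L * norm v * norm (u - v)"
    if t: "t \<in> {0..1}" for t
  proof -
    have "0 \<le> L * M * norm u + 2 * L * norm v * norm (u - v)" using L_pos by (simp add: M_def)
    then have "(L * M * norm u + 2 * L * norm v * norm (u - v)) * \<bar>t\<bar> \<le> (L * M * norm u + 2 * L * norm v * norm (u - v)) * 1"
      using t by (intro mult_left_mono) auto
    with diff[OF t] show ?thesis by (simp add: e_zero)
  qed
  have "M \<le> norm (e (s *\<^sub>R u) - e (s *\<^sub>R v) - s *\<^sub>R (u - v)) + norm (s *\<^sub>R (u - v))"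
    unfolding M_def using norm_triangle_ineq[of "e (s *\<^sub>R u) - e (s *\<^sub>R v) - s *\<^sub>R (u - v)" "s *\<^sub>R (u - v)"] by simp
  also have "\<dots> \<le> (L * norm u) * M + 2 * (L * norm v) * norm (u - v) + norm (u - v)"
    using bound[OF s(1)] conv[OF s(1), of "u - v"] by (simp add: mult_ac)
  also have "\<dots> \<le> (1 / 8) * M + 2 * (1 / 8) * norm (u - v) + norm (u - v)"
    using Lu Lv by (intro add_mono mult_right_mono mult_left_mono order_refl) (auto simp: M_def)
  finally have M: "M \<le> 2 * norm (u - v)" using norm_ge_zero[of "u - v"] by linarith
  have "norm (e u - e v - (u - v)) \<le> L * M * norm u + 2 * L * norm v * norm (u - v)" using bound[of 1] by simp
  also have "\<dots> \<le> L * (2 * norm (u - v)) * r + 2 * L * r * norm (u - v)"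
    using M L_pos u v by (intro add_mono mult_mono mult_left_mono mult_right_mono) (auto simp: M_def)
  finally show ?thesis by (simp add: algebra_simps)
qed

lemma m_in_ball:
  assumes "norm a < R / 4" "norm b < R / 4"
  shows "norm (m (a, b)) < R"
proof -
  have "L * norm a \<le> L * R" using assms L_pos R_pos by (intro mult_left_mono) auto
  then have "L * norm a \<le> 1" using LR by linarith
  then have "L * norm a * norm b \<le> 1 * norm b" by (intro mult_right_mono) auto
  then have 1: "norm (m (a, b) - a - b) \<le> norm b" using m_bound[of a b] assms R_pos by simp
  have "norm (m (a, b)) \<le> norm (m (a, b) - a - b) + norm (a + b)"
    using norm_triangle_ineq[of "m (a, b) - a - b" "a + b"] by (simp add: algebra_simps)
  with norm_triangle_ineq[of a b] show ?thesis using 1 assms R_pos by linarith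
qed

text \<open>Differentiate the associative law \<open>m(m(a, b), c) = m(a, m(b, c))\<close> with respect to \<open>c\<close> at 0.\<close>

lemma F_left_invariant:
  assumes a: "norm a < R" and b: "norm b < R" and ab: "norm (m (a, b)) < R"
  shows "F (m (a, b)) w = frechet_derivative m (at (a, b)) (0, F b w)"
proof -
  let ?S = "{c. (m (a, b), c) \<in> D} \<inter> ({c. (b, c) \<in> D} \<inter> (\<lambda>c. (a, m (b, c))) -` D)"
  have op: "open {c. (p, c) \<in> D}" for p
    using open_vimage[OF open_D, of "Pair p"] by (simp add: vimage_def continuous_on_Pair continuous_on_const continuous_on_id)
  have "continuous_on {c. (b, c) \<in> D} (\<lambda>c. m (b, c))"
    by (intro continuous_at_imp_continuous_on ballI has_derivative_continuous[OF m_has_derivative_snd]) simp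
  then have "continuous_on {c. (b, c) \<in> D} (\<lambda>c. (a, m (b, c)))"
    by (intro continuous_intros)
  then have "open ({c. (b, c) \<in> D} \<inter> (\<lambda>c. (a, m (b, c))) -` D)"
    by (rule continuous_open_preimage[OF _ op open_D])
  then have S: "open ?S" by (rule open_Int[OF op])
  have mb: "m (b, 0) = b" using right_unit[OF in_D] b R_pos by simp
  have S0: "0 \<in> ?S" using in_D a b ab mb R_pos by auto
  have 1: "((\<lambda>c. m (m (a, b), c)) has_derivative F (m (a, b))) (at 0)"
    using m_has_derivative_snd[of "m (a, b)" 0] in_D ab R_pos by (simp add: F_def[abs_def])
  have 2: "((\<lambda>c. m (b, c)) has_derivative F b) (at 0)"
    using m_has_derivative_snd[of b 0] in_D b R_pos by (simp add: F_def[abs_def])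
  have "((\<lambda>c. m (a, m (b, c))) has_derivative (\<lambda>w. frechet_derivative m (at (a, b)) (0, F b w))) (at 0)"
    by (rule has_derivative_compose[OF 2, unfolded mb, OF m_has_derivative_snd[OF in_D[OF a b]]])
  then have "((\<lambda>c. m (m (a, b), c)) has_derivative (\<lambda>w. frechet_derivative m (at (a, b)) (0, F b w))) (at 0)"
    by (rule has_derivative_transform_within_open[OF _ S S0]) (use assoc[OF in_D[OF a b]] in auto)
  from has_derivative_unique[OF 1 this] show ?thesis by (rule fun_cong)
qed

lemma translate_has_vector_derivative:
  assumes y: "(y has_vector_derivative F (y t) w) (at t)"
    and n: "norm a < R" "norm (y t) < R" "norm (m (a, y t)) < R"
  shows "((\<lambda>t. m (a, y t)) has_vector_derivative F (m (a, y t)) w) (at t)"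
proof -
  have lin: "linear (frechet_derivative m (at (a, y t)))"
    by (rule has_derivative_linear[OF m_has_derivative[OF in_D[OF n(1,2)]]])
  have "((\<lambda>t. m (a, y t)) has_derivative (\<lambda>h. frechet_derivative m (at (a, y t)) (0, h *\<^sub>R F (y t) w))) (at t)"
    using has_derivative_compose[OF y[unfolded has_vector_derivative_def] m_has_derivative_snd[OF in_D[OF n(1,2)]]] .
  moreover have "frechet_derivative m (at (a, y t)) (0, h *\<^sub>R F (y t) w) = h *\<^sub>R F (m (a, y t)) w" for h
    using linear_scale[OF lin, of h "(0, F (y t) w)"] F_left_invariant[OF n] by simp
  ultimately show ?thesis by (simp add: has_vector_derivative_def)
qed

text \<open>As functions of \<open>t\<close>, both sides solve the differential equation of the left-invariant field of
  \<open>w\<close>, and they agree for \<open>t = 0\<close>.\<close>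

lemma e_add:
  assumes s: "norm (s *\<^sub>R w) < \<rho>" and t: "norm (t *\<^sub>R w) < \<rho>" and st: "norm ((s + t) *\<^sub>R w) < \<rho>"
  shows "m (e (s *\<^sub>R w), e (t *\<^sub>R w)) = e ((s + t) *\<^sub>R w)"
proof -
  define a where "a = min 0 t"
  define b where "b = max 0 t"
  have small: "norm (e v) < R / 4" if "norm v < \<rho>" for v
    using e_norm[OF that] that \<rho> by linarith
  have tr: "norm (r *\<^sub>R w) < \<rho>" and str: "norm ((s + r) *\<^sub>R w) < \<rho>" if r: "r \<in> {a..b}" for r
  proof -
    have "\<bar>r\<bar> \<le> \<bar>t\<bar>" using r by (auto simp: a_def b_def min_def max_def split: if_splits)
    then have "\<bar>r\<bar> * norm w \<le> \<bar>t\<bar> * norm w" by (intro mult_right_mono) auto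
    then show "norm (r *\<^sub>R w) < \<rho>" using t by simp
    have "\<bar>s + r\<bar> \<le> max \<bar>s\<bar> \<bar>s + t\<bar>" using r by (auto simp: a_def b_def min_def max_def split: if_splits)
    then have "\<bar>s + r\<bar> * norm w \<le> max \<bar>s\<bar> \<bar>s + t\<bar> * norm w" by (intro mult_right_mono) auto
    then show "norm ((s + r) *\<^sub>R w) < \<rho>" using s st by (auto simp: max_def split: if_splits)
  qed
  have len: "b - a = \<bar>t\<bar>" by (auto simp: a_def b_def)
  show ?thesis
  proof (rule flow_unique[where x="\<lambda>t. m (e (s *\<^sub>R w), e (t *\<^sub>R w))" and y="\<lambda>t. e ((s + t) *\<^sub>R w)"
        and a=a and b=b and w=w and ?t0.0=0 and t=t])
    show "L * norm w * (b - a) < 1"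
      using L_norm[OF t] unfolding len by (simp add: mult_ac)
    show "m (e (s *\<^sub>R w), e (0 *\<^sub>R w)) = e ((s + 0) *\<^sub>R w)"
      using right_unit[OF in_D] e_in_ball[OF s] R_pos by (simp add: e_zero)
    show "0 \<in> {a..b}" "t \<in> {a..b}" by (auto simp: a_def b_def)
    fix r assume r: "r \<in> {a..b}"
    show mR: "norm (m (e (s *\<^sub>R w), e (r *\<^sub>R w))) < R"
      by (rule m_in_ball[OF small[OF s] small[OF tr[OF r]]])
    show "norm (e ((s + r) *\<^sub>R w)) < R" by (rule e_in_ball[OF str[OF r]])
    show "((\<lambda>t. m (e (s *\<^sub>R w), e (t *\<^sub>R w))) has_vector_derivative F (m (e (s *\<^sub>R w), e (r *\<^sub>R w))) w) (at r within {a..b})"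
      by (rule has_vector_derivative_at_within[OF translate_has_vector_derivative
            [OF e_derivative[OF tr[OF r]] e_in_ball[OF s] e_in_ball[OF tr[OF r]] mR]])
    have "((\<lambda>t. s + t) has_vector_derivative 1) (at r)" by (auto intro!: derivative_eq_intros)
    from vector_diff_chain_at[OF this, of "\<lambda>t. e (t *\<^sub>R w)", OF e_derivative[OF str[OF r]]]
    show "((\<lambda>t. e ((s + t) *\<^sub>R w)) has_vector_derivative F (e ((s + r) *\<^sub>R w)) w) (at r within {a..b})"
      by (simp add: o_def has_vector_derivative_at_within)
  qed
qed

text \<open>Bootstrapping: if the flow is of class \<open>C^k\<close>, then so is its velocity, since the field is smooth.\<close>

lemma e_smooth: "smooth_on {t. norm (t *\<^sub>R w) < \<rho>} (\<lambda>t. e (t *\<^sub>R w))"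
proof -
  define I where "I = {t::real. norm (t *\<^sub>R w) < \<rho>}"
  have I: "open I" unfolding I_def by (intro open_Collect_less continuous_intros)
  have d: "((\<lambda>t. e (t *\<^sub>R w)) has_vector_derivative F (e (t *\<^sub>R w)) w) (at t)" if "t \<in> I" for t
    using e_derivative that by (simp add: I_def)
  have "C_on k I (\<lambda>t. e (t *\<^sub>R w))" for k
  proof (induction k)
    case 0
    have "isCont (\<lambda>t. e (t *\<^sub>R w)) t" if "t \<in> I" for t
      by (rule has_vector_derivative_continuous[OF d[OF that]])
    then show ?case by (simp add: continuous_at_imp_continuous_on)
  next
    case (Suc k)
    show ?case
    proof (rule C_on_SucI[OF I d[unfolded has_vector_derivative_def]])
      fix v :: real
      have F: "C_on k (ball 0 R) (\<lambda>x. F x w)"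
        using F_smooth[of "ball 0 R" w] in_D R_pos by (auto simp: smooth_on_def)
      have "(\<lambda>t. e (t *\<^sub>R w)) ` I \<subseteq> ball 0 R"
        using e_in_ball unfolding I_def mem_ball_0 image_subset_iff by blast
      then have "C_on k I (\<lambda>t. F (e (t *\<^sub>R w)) w)"
        by (rule C_on_compose[OF I open_ball Suc _ F])
      then show "C_on k I (\<lambda>t. v *\<^sub>R F (e (t *\<^sub>R w)) w)"
        by (rule C_on_bounded_linear_comp[OF I _ bounded_linear_scaleR_right])
    qed
  qed
  then show ?thesis by (simp add: smooth_on_def I_def)
qed

text \<open>Differentiating \<open>y(h) = m(y(t), y(h - t))\<close> with respect to \<open>h\<close> at \<open>h = t\<close> shows that \<open>y\<close> solves the
  differential equation of the left-invariant field of \<open>w\<close>.\<close>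

lemma local_one_parameter_unique:
  assumes \<delta>: "\<delta> > 0" and y: "\<And>t. \<bar>t\<bar> < \<delta> \<Longrightarrow> norm (y t) < R"
    and hom: "\<And>s t. \<bar>s\<bar> < \<delta> \<Longrightarrow> \<bar>t\<bar> < \<delta> \<Longrightarrow> \<bar>s + t\<bar> < \<delta> \<Longrightarrow> y (s + t) = m (y s, y t)"
    and y0: "y 0 = 0" and y': "(y has_vector_derivative w) (at 0)"
  shows "\<exists>\<eta>>0. \<forall>t. \<bar>t\<bar> < \<eta> \<longrightarrow> y t = e (t *\<^sub>R w)"
proof -
  have d: "(y has_vector_derivative F (y t) w) (at t)" if t: "\<bar>t\<bar> < \<delta>" for t
  proof -
    have "((\<lambda>h. h - t) has_vector_derivative 1) (at t)" by (auto intro!: derivative_eq_intros)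
    from vector_diff_chain_at[OF this, of y w] y'
    have "((\<lambda>h. y (h - t)) has_vector_derivative w) (at t)" by (simp add: o_def)
    from has_derivative_compose[OF this[unfolded has_vector_derivative_def], of "\<lambda>c. m (y t, c)" "F (y t)"]
      m_has_derivative_snd[OF in_D[OF y[OF t], of 0]] R_pos y0
    have "((\<lambda>h. m (y t, y (h - t))) has_derivative (\<lambda>x. F (y t) (x *\<^sub>R w))) (at t)"
      by (simp add: F_def[abs_def])
    then have "((\<lambda>h. m (y t, y (h - t))) has_vector_derivative F (y t) w) (at t)"
      by (simp add: has_vector_derivative_def F_scale[OF y[OF t]])
    then show ?thesis
    proof (rule has_vector_derivative_transform_within_open)
      show "open {h. \<bar>h\<bar> < \<delta> \<and> \<bar>h - t\<bar> < \<delta>}"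
        by (intro open_Collect_conj open_Collect_less continuous_intros)
      show "t \<in> {h. \<bar>h\<bar> < \<delta> \<and> \<bar>h - t\<bar> < \<delta>}" using t \<delta> by simp
      show "m (y t, y (h - t)) = y h" if "h \<in> {h. \<bar>h\<bar> < \<delta> \<and> \<bar>h - t\<bar> < \<delta>}" for h
        using hom[of t "h - t"] t that by simp
    qed
  qed
  define \<eta> where "\<eta> = min (\<delta> / 2) (\<rho> / (2 * (norm w + 1)))"
  have \<eta>: "\<eta> > 0" "\<eta> < \<delta>" using \<delta> \<rho>(1) by (auto simp: \<eta>_def add_nonneg_pos)
  have "\<eta> * norm w \<le> \<rho> / (2 * (norm w + 1)) * norm w" unfolding \<eta>_def by (intro mult_right_mono) auto
  also have "\<dots> < \<rho>" using \<rho>(1) by (simp add: divide_less_eq add_nonneg_pos)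
  finally have \<eta>w: "\<eta> * norm w < \<rho>" .
  have tw: "norm (t *\<^sub>R w) < \<rho>" if "t \<in> {-\<eta>..\<eta>}" for t
  proof -
    have "\<bar>t\<bar> * norm w \<le> \<eta> * norm w" using that by (intro mult_right_mono) auto
    then show ?thesis using \<eta>w by simp
  qed
  have "y t = e (t *\<^sub>R w)" if t: "t \<in> {-\<eta>..\<eta>}" for t
  proof (rule flow_unique[where a="-\<eta>" and b=\<eta> and ?t0.0=0 and y="\<lambda>t. e (t *\<^sub>R w)" and w=w])
    have "L * norm (\<eta> *\<^sub>R w) < 1 / 8" by (rule L_norm) (use \<eta>w \<eta> in simp)
    then show "L * norm w * (\<eta> - - \<eta>) < 1" using \<eta> by (simp add: algebra_simps)
    show "0 \<in> {-\<eta>..\<eta>}" "t \<in> {-\<eta>..\<eta>}" using t \<eta> by auto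
    show "y 0 = e (0 *\<^sub>R w)" by (simp add: y0 e_zero)
    fix r assume r: "r \<in> {-\<eta>..\<eta>}"
    then have "\<bar>r\<bar> < \<delta>" using \<eta> by auto
    then show "(y has_vector_derivative F (y r) w) (at r within {-\<eta>..\<eta>})" "norm (y r) < R"
      using d y has_vector_derivative_at_within by blast+
    show "((\<lambda>t. e (t *\<^sub>R w)) has_vector_derivative F (e (r *\<^sub>R w)) w) (at r within {-\<eta>..\<eta>})"
      by (rule has_vector_derivative_at_within[OF e_derivative[OF tw[OF r]]])
    show "norm (e (r *\<^sub>R w)) < R" by (rule e_in_ball[OF tw[OF r]])
  qed
  then have "\<forall>t. \<bar>t\<bar> < \<eta> \<longrightarrow> y t = e (t *\<^sub>R w)" by (simp add: abs_less_iff)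
  with \<eta>(1) show ?thesis by blast
qed

end

section \<open>Manifolds and their tangent spaces\<close>

text \<open>A topological space with charts onto open sets of a Euclidean space. The smoothness of the
  transition maps is added in \<open>pointed_manifold\<close>, so that a product qualifies by the topology of its
  charts alone.\<close>

locale charted_space =
  fixes T :: "'p topology" and A :: "('p, 'e::euclidean_space) chart set"
  assumes cover: "p \<in> topspace T \<Longrightarrow> \<exists>U \<phi>. (U, \<phi>) \<in> A \<and> p \<in> U"
    and chart_open: "(U, \<phi>) \<in> A \<Longrightarrow> openin T U"
    and chart_image_open: "(U, \<phi>) \<in> A \<Longrightarrow> open (\<phi> ` U)"
    and chart_homeo: "(U, \<phi>) \<in> A \<Longrightarrow> homeomorphic_map (subtopology T U) (top_of_set (\<phi> ` U)) \<phi>"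
begin

lemma chart_subset: "(U, \<phi>) \<in> A \<Longrightarrow> U \<subseteq> topspace T"
  using chart_open openin_subset by blast

lemma chart_topspace: "(U, \<phi>) \<in> A \<Longrightarrow> topspace (subtopology T U) = U"
  using chart_subset by (auto simp: topspace_subtopology)

lemma chart_inj: "(U, \<phi>) \<in> A \<Longrightarrow> inj_on \<phi> U"
  using homeomorphic_imp_injective_map[OF chart_homeo] chart_topspace by auto

lemma chart_preimage_open:
  assumes "(U, \<phi>) \<in> A" "open V"
  shows "openin T {x \<in> U. \<phi> x \<in> V}"
proof -
  have "continuous_map (subtopology T U) euclidean \<phi>"
    using homeomorphic_imp_continuous_map[OF chart_homeo[OF assms(1)]] continuous_map_into_fulltopology by blast
  then have "openin (subtopology T U) {x \<in> topspace (subtopology T U). \<phi> x \<in> V}"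
    using assms(2) by (intro openin_continuous_map_preimage) auto
  then show ?thesis
    unfolding chart_topspace[OF assms(1)] openin_open_subtopology[OF chart_open[OF assms(1)]] by simp
qed

lemma chart_inverse_continuous:
  assumes "(U, \<phi>) \<in> A"
  shows "continuous_map (top_of_set (\<phi> ` U)) T (inv_into U \<phi>)"
proof -
  obtain g where g: "homeomorphic_maps (subtopology T U) (top_of_set (\<phi> ` U)) \<phi> g"
    using chart_homeo[OF assms] homeomorphic_map_maps by blast
  then have "continuous_map (top_of_set (\<phi> ` U)) T g"
    unfolding homeomorphic_maps_def using continuous_map_into_fulltopology by blast
  moreover have "g y = inv_into U \<phi> y" if y: "y \<in> \<phi> ` U" for y
  proof -
    obtain x where x: "x \<in> U" "y = \<phi> x" using y by blast
    then have "g (\<phi> x) = x" using g chart_topspace[OF assms] by (auto simp: homeomorphic_maps_def)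
    then show ?thesis using x inv_into_f_f[OF chart_inj[OF assms]] by simp
  qed
  ultimately show ?thesis by (auto intro: continuous_map_eq)
qed

lemma chart_image_open_subset:
  assumes "(U, \<phi>) \<in> A" "openin T W" "W \<subseteq> U"
  shows "open (\<phi> ` W)"
proof -
  have "openin (top_of_set (\<phi> ` U)) {y \<in> topspace (top_of_set (\<phi> ` U)). inv_into U \<phi> y \<in> W}"
    by (rule openin_continuous_map_preimage[OF chart_inverse_continuous[OF assms(1)] assms(2)])
  moreover have "{y \<in> topspace (top_of_set (\<phi> ` U)). inv_into U \<phi> y \<in> W} = \<phi> ` W"
    using assms(3) inv_into_f_f[OF chart_inj[OF assms(1)]] by (auto simp: image_iff)
  ultimately show ?thesis using openin_open_eq[OF chart_image_open[OF assms(1)]] by simp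
qed

end

text \<open>Smooth maps from open sets of Euclidean spaces into a manifold. Multiplication, curves and
  coordinate maps are all compared with the charts through such maps, which are closed under
  precomposition with smooth maps and under smooth maps between manifolds.\<close>

definition smooth_into ::
  "'a::euclidean_space set \<Rightarrow> 'p topology \<Rightarrow> ('p, 'e::euclidean_space) chart set \<Rightarrow> ('a \<Rightarrow> 'p) \<Rightarrow> bool" where
  "smooth_into S T A c \<longleftrightarrow> continuous_map (top_of_set S) T c \<and>
     (\<forall>(V, \<psi>)\<in>A. smooth_on {x\<in>S. c x \<in> V} (\<lambda>x. \<psi> (c x)))"

lemma smooth_curve_on_iff: "smooth_curve_on J T A \<gamma> \<longleftrightarrow> smooth_into J T A \<gamma>"
proof -
  have "smooth_on {x \<in> J. \<gamma> x \<in> V} (\<psi> \<circ> \<gamma> \<circ> inv_into J (\<lambda>t. t)) \<longleftrightarrow> smooth_on {x \<in> J. \<gamma> x \<in> V} (\<lambda>x. \<psi> (\<gamma> x))"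
    for V and \<psi> :: "'a \<Rightarrow> 'b"
    by (rule smooth_on_cong) (auto simp: inv_into_f_f[of "\<lambda>t. t"] inj_on_def)
  then show ?thesis
    by (simp add: smooth_curve_on_def smooth_map_def smooth_into_def)
qed

lemma smooth_into_continuous: "smooth_into S T A c \<Longrightarrow> continuous_map (top_of_set S) T c"
  by (simp add: smooth_into_def)

lemma smooth_into_topspace: "smooth_into S T A c \<Longrightarrow> x \<in> S \<Longrightarrow> c x \<in> topspace T"
  using smooth_into_continuous[of S T A c] by (auto simp: continuous_map_def)

lemma smooth_into_chart: "smooth_into S T A c \<Longrightarrow> (V, \<psi>) \<in> A \<Longrightarrow> smooth_on {x\<in>S. c x \<in> V} (\<lambda>x. \<psi> (c x))"
  by (auto simp: smooth_into_def)

lemma continuous_preimage_open: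
  assumes "continuous_map (top_of_set S) T c" "open S" "openin T V"
  shows "open {x \<in> S. c x \<in> V}"
  using openin_continuous_map_preimage[OF assms(1,3)] openin_open_eq[OF assms(2)] by simp

lemma smooth_into_cong:
  assumes "smooth_into S T A c" "\<And>x. x \<in> S \<Longrightarrow> c x = d x"
  shows "smooth_into S T A d"
proof -
  have "{x\<in>S. c x \<in> V} = {x\<in>S. d x \<in> V}" for V using assms(2) by auto
  moreover have "smooth_on {x\<in>S. d x \<in> V} (\<lambda>x. \<psi> (d x))"
    if "smooth_on {x\<in>S. d x \<in> V} (\<lambda>x. \<psi> (c x))" for V and \<psi> :: "'b \<Rightarrow> 'c"
    by (rule smooth_on_cong_imp[OF that]) (use assms(2) in auto)
  moreover have "continuous_map (top_of_set S) T d"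
    by (rule continuous_map_eq[OF smooth_into_continuous[OF assms(1)]]) (use assms(2) in auto)
  ultimately show ?thesis using assms(1) by (auto simp: smooth_into_def)
qed

context charted_space
begin

lemma smooth_into_compose:
  assumes "smooth_into S T A c" "smooth_on S' h" "open S" "open S'" "\<And>x. x \<in> S' \<Longrightarrow> h x \<in> S"
  shows "smooth_into S' T A (\<lambda>x. c (h x))"
  unfolding smooth_into_def
proof (intro conjI ballI)
  have "continuous_map (top_of_set S') (top_of_set S) h"
    using smooth_on_continuous_on[OF assms(2)] assms(5) by auto
  from continuous_map_compose[OF this smooth_into_continuous[OF assms(1)]]
  show "continuous_map (top_of_set S') T (\<lambda>x. c (h x))" by (simp add: o_def)
next
  fix Y assume "Y \<in> A"
  moreover obtain V \<psi> where Y: "Y = (V, \<psi>)" by force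
  ultimately have V: "(V, \<psi>) \<in> A" by simp
  have o: "open {x \<in> S. c x \<in> V}"
    by (rule continuous_preimage_open[OF smooth_into_continuous[OF assms(1)] assms(3) chart_open[OF V]])
  have "open (S' \<inter> h -` {x \<in> S. c x \<in> V})"
    by (rule continuous_open_preimage[OF smooth_on_continuous_on[OF assms(2)] assms(4) o])
  moreover have "S' \<inter> h -` {x \<in> S. c x \<in> V} = {x \<in> S'. c (h x) \<in> V}" using assms(5) by auto
  ultimately have o': "open {x \<in> S'. c (h x) \<in> V}" by simp
  have "smooth_on {x \<in> S'. c (h x) \<in> V} (\<lambda>x. \<psi> (c (h x)))"
    by (rule smooth_on_compose[OF smooth_into_chart[OF assms(1) V] smooth_on_mono[OF assms(2,4) o'] o' o])
       (use assms(5) in auto)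
  then show "case Y of (V, \<psi>) \<Rightarrow> smooth_on {x \<in> S'. c (h x) \<in> V} (\<lambda>x. \<psi> (c (h x)))"
    by (simp add: Y)
qed

lemma smooth_into_subset: "smooth_into S T A c \<Longrightarrow> open S \<Longrightarrow> open S' \<Longrightarrow> S' \<subseteq> S \<Longrightarrow> smooth_into S' T A c"
  by (rule smooth_into_compose[where h="\<lambda>x. x", OF _ smooth_on_id _ _ subsetD])

lemma smooth_into_const: "p \<in> topspace T \<Longrightarrow> open S \<Longrightarrow> smooth_into S T A (\<lambda>x. p)"
  unfolding smooth_into_def by (auto intro!: smooth_on_const open_Collect_conj simp: case_prod_unfold)

lemma smooth_into_local:
  assumes S: "open S" and loc: "\<And>x. x \<in> S \<Longrightarrow> \<exists>W. open W \<and> x \<in> W \<and> W \<subseteq> S \<and> smooth_into W T A c"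
  shows "smooth_into S T A c"
proof -
  have op: "open {x\<in>S. c x \<in> V}" if V: "openin T V" for V
  proof (subst open_subopen, clarify)
    fix x assume x: "x \<in> S" "c x \<in> V"
    obtain W where W: "open W" "x \<in> W" "W \<subseteq> S" "smooth_into W T A c" using loc[OF x(1)] by blast
    have "open {x\<in>W. c x \<in> V}"
      by (rule continuous_preimage_open[OF smooth_into_continuous[OF W(4)] W(1) V])
    then show "\<exists>X. open X \<and> x \<in> X \<and> X \<subseteq> {x\<in>S. c x \<in> V}" using W x by blast
  qed
  show ?thesis
    unfolding smooth_into_def
  proof (intro conjI ballI)
    have "c \<in> S \<rightarrow> topspace T" using loc smooth_into_topspace by fastforce
    then show "continuous_map (top_of_set S) T c"
      using op S by (auto simp: continuous_map_def openin_open_eq)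
  next
    fix Y assume "Y \<in> A"
    moreover obtain V \<psi> where Y: "Y = (V, \<psi>)" by force
    ultimately have V: "(V, \<psi>) \<in> A" by simp
    have "smooth_on {x\<in>S. c x \<in> V} (\<lambda>x. \<psi> (c x))"
    proof (rule smooth_on_local[OF op[OF chart_open[OF V]]])
      fix x assume x: "x \<in> {x\<in>S. c x \<in> V}"
      then obtain W where W: "open W" "x \<in> W" "W \<subseteq> S" "smooth_into W T A c" using loc by blast
      have "open {x\<in>W. c x \<in> V}"
        by (rule continuous_preimage_open[OF smooth_into_continuous[OF W(4)] W(1) chart_open[OF V]])
      moreover have "smooth_on {x\<in>W. c x \<in> V} (\<lambda>x. \<psi> (c x))" by (rule smooth_into_chart[OF W(4) V])
      moreover have "x \<in> {x\<in>W. c x \<in> V}" "{x\<in>W. c x \<in> V} \<subseteq> {x\<in>S. c x \<in> V}" using W x by auto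
      ultimately show "\<exists>W. open W \<and> x \<in> W \<and> W \<subseteq> {x\<in>S. c x \<in> V} \<and> smooth_on W (\<lambda>x. \<psi> (c x))" by blast
    qed
    then show "case Y of (V, \<psi>) \<Rightarrow> smooth_on {x \<in> S. c x \<in> V} (\<lambda>x. \<psi> (c x))" by (simp add: Y)
  qed
qed

lemma smooth_into_map:
  assumes c: "smooth_into S T A c" and S: "open S" and F: "smooth_map T A T' A' F"
    and T': "charted_space T' A'"
  shows "smooth_into S T' A' (\<lambda>x. F (c x))"
  unfolding smooth_into_def
proof (intro conjI ballI)
  have F_cont: "continuous_map T T' F" using F by (simp add: smooth_map_def)
  from continuous_map_compose[OF smooth_into_continuous[OF c] F_cont]
  show Fc: "continuous_map (top_of_set S) T' (\<lambda>x. F (c x))" by (simp add: o_def)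
  fix Y assume "Y \<in> A'"
  moreover obtain V \<psi> where Y: "Y = (V, \<psi>)" by force
  ultimately have V: "(V, \<psi>) \<in> A'" by simp
  interpret T': charted_space T' A' by (rule T')
  have "smooth_on {x\<in>S. F (c x) \<in> V} (\<lambda>x. \<psi> (F (c x)))"
  proof (rule smooth_on_local[OF continuous_preimage_open[OF Fc S T'.chart_open[OF V]]])
    fix x0 assume x0: "x0 \<in> {x\<in>S. F (c x) \<in> V}"
    then obtain U \<phi> where U: "(U, \<phi>) \<in> A" "c x0 \<in> U" using cover smooth_into_topspace[OF c] by blast
    define W where "W = {q \<in> U. F q \<in> V}"
    have "openin T (U \<inter> {q \<in> topspace T. F q \<in> V})"
      by (intro openin_Int chart_open[OF U(1)] openin_continuous_map_preimage[OF F_cont] T'.chart_open[OF V])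
    moreover have "U \<inter> {q \<in> topspace T. F q \<in> V} = W" using chart_subset[OF U(1)] by (auto simp: W_def)
    ultimately have W: "openin T W" "W \<subseteq> U" by (auto simp: W_def)
    have oW: "open (\<phi> ` W)" by (rule chart_image_open_subset[OF U(1) W])
    have o: "open {x\<in>S. c x \<in> W}" by (rule continuous_preimage_open[OF smooth_into_continuous[OF c] S W(1)])
    have "{x\<in>S. c x \<in> W} \<subseteq> {x\<in>S. c x \<in> U}" using W(2) by auto
    then have \<phi>c: "smooth_on {x\<in>S. c x \<in> W} (\<lambda>x. \<phi> (c x))"
      by (rule smooth_on_mono[OF smooth_into_chart[OF c U(1)]
            continuous_preimage_open[OF smooth_into_continuous[OF c] S chart_open[OF U(1)]] o])
    have "smooth_on (\<phi> ` W) (\<psi> \<circ> F \<circ> inv_into U \<phi>)"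
      using F U(1) V unfolding smooth_map_def W_def by blast
    from smooth_on_compose[OF this \<phi>c o oW]
    have "smooth_on {x\<in>S. c x \<in> W} (\<lambda>x. (\<psi> \<circ> F \<circ> inv_into U \<phi>) (\<phi> (c x)))" by auto
    moreover have "(\<psi> \<circ> F \<circ> inv_into U \<phi>) (\<phi> (c x)) = \<psi> (F (c x))" if "x \<in> {x\<in>S. c x \<in> W}" for x
      using that W(2) inv_into_f_f[OF chart_inj[OF U(1)]] by auto
    ultimately have "smooth_on {x\<in>S. c x \<in> W} (\<lambda>x. \<psi> (F (c x)))" by (rule smooth_on_cong_imp)
    moreover have "x0 \<in> {x\<in>S. c x \<in> W}" "{x\<in>S. c x \<in> W} \<subseteq> {x\<in>S. F (c x) \<in> V}"
      using x0 U(2) by (auto simp: W_def)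
    ultimately show "\<exists>W. open W \<and> x0 \<in> W \<and> W \<subseteq> {x\<in>S. F (c x) \<in> V} \<and> smooth_on W (\<lambda>x. \<psi> (F (c x)))"
      using o by blast
  qed
  then show "case Y of (V, \<psi>) \<Rightarrow> smooth_on {x \<in> S. F (c x) \<in> V} (\<lambda>x. \<psi> (F (c x)))" by (simp add: Y)
qed

lemma charted_space_prod: "charted_space (prod_topology T T) (prod_atlas A A)"
proof
  fix p assume "p \<in> topspace (prod_topology T T)"
  then have "fst p \<in> topspace T" "snd p \<in> topspace T" by auto
  then obtain U \<phi> V \<psi> where "(U, \<phi>) \<in> A" "fst p \<in> U" "(V, \<psi>) \<in> A" "snd p \<in> V" using cover by metis
  then show "\<exists>U \<phi>. (U, \<phi>) \<in> prod_atlas A A \<and> p \<in> U"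
    unfolding prod_atlas_def by (metis (mono_tags, lifting) mem_Collect_eq mem_Times_iff)
next
  fix W \<theta> assume "(W, \<theta>) \<in> prod_atlas A A"
  then obtain U \<phi> V \<psi> where W: "W = U \<times> V" "\<theta> = map_prod \<phi> \<psi>" and U: "(U, \<phi>) \<in> A" and V: "(V, \<psi>) \<in> A"
    by (auto simp: prod_atlas_def)
  have im: "\<theta> ` W = \<phi> ` U \<times> \<psi> ` V" by (auto simp: W)
  show "openin (prod_topology T T) W" using chart_open[OF U] chart_open[OF V] by (simp add: W openin_prod_Times_iff)
  show "open (\<theta> ` W)" unfolding im by (intro open_Times chart_image_open[OF U] chart_image_open[OF V])
  obtain f where f: "homeomorphic_maps (subtopology T U) (top_of_set (\<phi> ` U)) \<phi> f"
    using chart_homeo[OF U] homeomorphic_map_maps by blast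
  obtain g where g: "homeomorphic_maps (subtopology T V) (top_of_set (\<psi> ` V)) \<psi> g"
    using chart_homeo[OF V] homeomorphic_map_maps by blast
  have "homeomorphic_maps (prod_topology (subtopology T U) (subtopology T V))
      (prod_topology (top_of_set (\<phi> ` U)) (top_of_set (\<psi> ` V))) (\<lambda>(x, y). (\<phi> x, \<psi> y)) (\<lambda>(x, y). (f x, g y))"
    using f g homeomorphic_maps_prod by blast
  moreover have "prod_topology (top_of_set (\<phi> ` U)) (top_of_set (\<psi> ` V)) = top_of_set (\<theta> ` W)"
    unfolding im by (simp add: subtopology_Times[symmetric] prod_topology_subtopology_eu)
  moreover have "prod_topology (subtopology T U) (subtopology T V) = subtopology (prod_topology T T) W"
    by (simp add: W subtopology_Times)
  moreover have "(\<lambda>(x, y). (\<phi> x, \<psi> y)) = \<theta>" by (auto simp: W)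
  ultimately show "homeomorphic_map (subtopology (prod_topology T T) W) (top_of_set (\<theta> ` W)) \<theta>"
    using homeomorphic_map_maps by metis
qed

lemma smooth_into_Pair:
  assumes c: "smooth_into S T A c" and d: "smooth_into S T A d" and S: "open S"
  shows "smooth_into S (prod_topology T T) (prod_atlas A A) (\<lambda>x. (c x, d x))"
  unfolding smooth_into_def
proof (intro conjI ballI)
  show "continuous_map (top_of_set S) (prod_topology T T) (\<lambda>x. (c x, d x))"
    by (simp add: continuous_map_paired smooth_into_continuous[OF c] smooth_into_continuous[OF d])
  fix Y assume "Y \<in> prod_atlas A A"
  then obtain U \<phi> V \<psi> where Y: "Y = (U \<times> V, map_prod \<phi> \<psi>)" and U: "(U, \<phi>) \<in> A" and V: "(V, \<psi>) \<in> A"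
    by (auto simp: prod_atlas_def)
  have oU: "open {x \<in> S. c x \<in> U}"
    by (rule continuous_preimage_open[OF smooth_into_continuous[OF c] S chart_open[OF U]])
  have oV: "open {x \<in> S. d x \<in> V}"
    by (rule continuous_preimage_open[OF smooth_into_continuous[OF d] S chart_open[OF V]])
  have eq: "{x \<in> S. (c x, d x) \<in> U \<times> V} = {x \<in> S. c x \<in> U} \<inter> {x \<in> S. d x \<in> V}" by auto
  have "smooth_on ({x \<in> S. c x \<in> U} \<inter> {x \<in> S. d x \<in> V}) (\<lambda>x. (\<phi> (c x), \<psi> (d x)))"
    by (intro smooth_on_Pair open_Int oU oV smooth_on_mono[OF smooth_into_chart[OF c U] oU]
        smooth_on_mono[OF smooth_into_chart[OF d V] oV]) auto
  then show "case Y of (V, \<psi>) \<Rightarrow> smooth_on {x \<in> S. (c x, d x) \<in> V} (\<lambda>x. \<psi> (c x, d x))"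
    unfolding Y prod.case eq map_prod_simp .
qed

end

text \<open>A manifold with a chart at the base point \<open>p\<close>. The chart is translated such that \<open>p\<close> becomes the
  origin: \<open>\<kappa>\<close> is the coordinate map and \<open>\<iota>\<close> its inverse, defined on \<open>\<Omega>\<close>.\<close>

locale pointed_manifold = charted_space T A
  for T :: "'p topology" and A :: "('p, 'e::euclidean_space) chart set" +
  fixes U :: "'p set" and \<phi> :: "'p \<Rightarrow> 'e" and p :: 'p
  assumes transition: "(V, \<psi>) \<in> A \<Longrightarrow> (V', \<psi>') \<in> A \<Longrightarrow> smooth_on (\<psi> ` (V \<inter> V')) (\<psi>' \<circ> inv_into V \<psi>)"
    and U: "(U, \<phi>) \<in> A" and p: "p \<in> U"
begin

definition \<kappa> :: "'p \<Rightarrow> 'e" where "\<kappa> q = \<phi> q - \<phi> p"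
definition \<Omega> :: "'e set" where "\<Omega> = \<kappa> ` U"
definition \<iota> :: "'e \<Rightarrow> 'p" where "\<iota> x = inv_into U \<phi> (x + \<phi> p)"

lemma \<Omega>_eq: "\<Omega> = (\<lambda>y. y - \<phi> p) ` (\<phi> ` U)"
  by (auto simp: \<Omega>_def \<kappa>_def image_image)

lemma open_\<Omega>: "open \<Omega>"
  unfolding \<Omega>_eq using open_translation[OF chart_image_open[OF U], of "- \<phi> p"] by (simp add: image_image)

lemma \<Omega>_translate: "x \<in> \<Omega> \<Longrightarrow> x + \<phi> p \<in> \<phi> ` U"
  by (auto simp: \<Omega>_eq)

lemma zero_\<Omega>: "0 \<in> \<Omega>"
  using p by (auto simp: \<Omega>_def \<kappa>_def image_iff)

lemma \<iota>_in_U: "x \<in> \<Omega> \<Longrightarrow> \<iota> x \<in> U"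
  unfolding \<iota>_def by (rule inv_into_into[OF \<Omega>_translate])

lemma \<iota>_topspace: "x \<in> \<Omega> \<Longrightarrow> \<iota> x \<in> topspace T"
  using \<iota>_in_U chart_subset[OF U] by blast

lemma \<kappa>_\<iota>: "x \<in> \<Omega> \<Longrightarrow> \<kappa> (\<iota> x) = x"
  unfolding \<kappa>_def \<iota>_def by (simp add: f_inv_into_f[OF \<Omega>_translate])

lemma \<iota>_\<kappa>: "q \<in> U \<Longrightarrow> \<iota> (\<kappa> q) = q"
  unfolding \<kappa>_def \<iota>_def by (simp add: inv_into_f_f[OF chart_inj[OF U]])

lemma \<kappa>_in_\<Omega>: "q \<in> U \<Longrightarrow> \<kappa> q \<in> \<Omega>"
  by (simp add: \<Omega>_def)

lemma \<kappa>_p: "\<kappa> p = 0"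
  by (simp add: \<kappa>_def)

lemma \<iota>_zero: "\<iota> 0 = p"
  using \<iota>_\<kappa>[OF p] by (simp add: \<kappa>_p)

lemma shift_smooth: "open S \<Longrightarrow> smooth_on S (\<lambda>x. x + c)"
  by (intro smooth_on_add smooth_on_id smooth_on_const)

lemma \<iota>_smooth: "smooth_into \<Omega> T A \<iota>"
  unfolding smooth_into_def
proof (intro conjI ballI)
  have "continuous_map (top_of_set \<Omega>) (top_of_set (\<phi> ` U)) (\<lambda>x. x + \<phi> p)"
    using \<Omega>_translate by (auto intro!: continuous_intros)
  from continuous_map_compose[OF this chart_inverse_continuous[OF U]]
  show cont: "continuous_map (top_of_set \<Omega>) T \<iota>" by (simp add: o_def \<iota>_def[abs_def])
  fix Y assume "Y \<in> A"
  moreover obtain V \<psi> where Y: "Y = (V, \<psi>)" by force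
  ultimately have V: "(V, \<psi>) \<in> A" by simp
  have o: "open {x \<in> \<Omega>. \<iota> x \<in> V}" by (rule continuous_preimage_open[OF cont open_\<Omega> chart_open[OF V]])
  have o': "open (\<phi> ` (U \<inter> V))"
    by (rule chart_image_open_subset[OF U openin_Int[OF chart_open[OF U] chart_open[OF V]]]) simp
  have "smooth_on {x \<in> \<Omega>. \<iota> x \<in> V} (\<lambda>x. (\<psi> \<circ> inv_into U \<phi>) (x + \<phi> p))"
  proof (rule smooth_on_compose[OF transition[OF U V] shift_smooth[OF o] o o'])
    fix x assume x: "x \<in> {x \<in> \<Omega>. \<iota> x \<in> V}"
    then have "x + \<phi> p = \<phi> (\<iota> x)" using \<kappa>_\<iota>[of x] by (auto simp: \<kappa>_def algebra_simps)
    then show "x + \<phi> p \<in> \<phi> ` (U \<inter> V)" using x \<iota>_in_U by auto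
  qed
  then show "case Y of (V, \<psi>) \<Rightarrow> smooth_on {x \<in> \<Omega>. \<iota> x \<in> V} (\<lambda>x. \<psi> (\<iota> x))" by (simp add: Y \<iota>_def)
qed

lemma \<kappa>_smooth_into:
  assumes c: "smooth_into S T A c" and S: "open S" and "\<And>x. x \<in> S \<Longrightarrow> c x \<in> U"
  shows "smooth_on S (\<lambda>x. \<kappa> (c x))"
proof -
  have "{x\<in>S. c x \<in> U} = S" using assms(3) by auto
  with smooth_into_chart[OF c U] have "smooth_on S (\<lambda>x. \<phi> (c x))" by simp
  then show ?thesis unfolding \<kappa>_def diff_conv_add_uminus by (intro smooth_on_add S smooth_on_const)
qed

lemma \<kappa>_preimage_open: "open N \<Longrightarrow> openin T {q \<in> U. \<kappa> q \<in> N}"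
proof -
  assume N: "open N"
  have "open ((\<lambda>y. y - \<phi> p) -` N)" by (intro open_vimage N continuous_intros)
  from chart_preimage_open[OF U this] show ?thesis by (simp add: \<kappa>_def vimage_def)
qed

text \<open>The other charts follow from the given one by the smooth transition maps.\<close>

lemma smooth_near_iff:
  assumes a: "a \<in> \<Omega>"
  shows "smooth_near T A (\<iota> a) f \<longleftrightarrow> (\<exists>N. open N \<and> a \<in> N \<and> N \<subseteq> \<Omega> \<and> smooth_on N (\<lambda>x. f (\<iota> x)))"
proof
  assume "smooth_near T A (\<iota> a) f"
  then obtain W where W: "openin T W" "\<iota> a \<in> W"
    and f: "smooth_on (\<phi> ` (U \<inter> W)) (f \<circ> inv_into U \<phi>)" unfolding smooth_near_def using U by blast
  define N where "N = {x \<in> \<Omega>. \<iota> x \<in> W}"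
  have N: "open N" unfolding N_def
    by (rule continuous_preimage_open[OF smooth_into_continuous[OF \<iota>_smooth] open_\<Omega> W(1)])
  have o: "open (\<phi> ` (U \<inter> W))"
    by (rule chart_image_open_subset[OF U openin_Int[OF chart_open[OF U] W(1)]]) simp
  have "smooth_on N (\<lambda>x. (f \<circ> inv_into U \<phi>) (x + \<phi> p))"
  proof (rule smooth_on_compose[OF f shift_smooth[OF N] N o])
    fix x assume x: "x \<in> N"
    then have "x + \<phi> p = \<phi> (\<iota> x)" using \<kappa>_\<iota>[of x] by (auto simp: N_def \<kappa>_def algebra_simps)
    then show "x + \<phi> p \<in> \<phi> ` (U \<inter> W)" using x \<iota>_in_U by (auto simp: N_def)
  qed
  then have "smooth_on N (\<lambda>x. f (\<iota> x))" by (simp add: \<iota>_def)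
  then show "\<exists>N. open N \<and> a \<in> N \<and> N \<subseteq> \<Omega> \<and> smooth_on N (\<lambda>x. f (\<iota> x))"
    using N W(2) a by (auto simp: N_def intro!: exI[of _ N])
next
  assume "\<exists>N. open N \<and> a \<in> N \<and> N \<subseteq> \<Omega> \<and> smooth_on N (\<lambda>x. f (\<iota> x))"
  then obtain N where N: "open N" "a \<in> N" "N \<subseteq> \<Omega>" "smooth_on N (\<lambda>x. f (\<iota> x))" by blast
  define W where "W = {q \<in> U. \<kappa> q \<in> N}"
  have W: "openin T W" unfolding W_def by (rule \<kappa>_preimage_open[OF N(1)])
  have "smooth_on (\<psi> ` (V \<inter> W)) (f \<circ> inv_into V \<psi>)" if V: "(V, \<psi>) \<in> A" for V \<psi>
  proof -
    have o: "open (\<psi> ` (V \<inter> W))"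
      by (rule chart_image_open_subset[OF V openin_Int[OF chart_open[OF V] W]]) simp
    have o': "open (\<psi> ` (V \<inter> U))"
      by (rule chart_image_open_subset[OF V openin_Int[OF chart_open[OF V] chart_open[OF U]]]) simp
    have "smooth_on (\<psi> ` (V \<inter> W)) (\<lambda>y. \<phi> (inv_into V \<psi> y) + - \<phi> p)"
      using smooth_on_mono[OF transition[OF V U] o' o]
      by (intro smooth_on_add o smooth_on_const) (auto simp: W_def o_def)
    then have k: "smooth_on (\<psi> ` (V \<inter> W)) (\<lambda>y. \<kappa> (inv_into V \<psi> y))" by (simp add: \<kappa>_def)
    have inv: "inv_into V \<psi> y \<in> W" if "y \<in> \<psi> ` (V \<inter> W)" for y
      using that inv_into_f_f[OF chart_inj[OF V]] by auto
    have "smooth_on (\<psi> ` (V \<inter> W)) (\<lambda>y. f (\<iota> (\<kappa> (inv_into V \<psi> y))))"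
      by (rule smooth_on_compose[OF N(4) k o N(1)]) (use inv in \<open>auto simp: W_def\<close>)
    moreover have "f (\<iota> (\<kappa> (inv_into V \<psi> y))) = (f \<circ> inv_into V \<psi>) y" if "y \<in> \<psi> ` (V \<inter> W)" for y
      using inv[OF that] \<iota>_\<kappa> by (auto simp: W_def)
    ultimately show ?thesis by (rule smooth_on_cong_imp)
  qed
  moreover have "\<iota> a \<in> W" using N a \<iota>_in_U \<kappa>_\<iota> by (auto simp: W_def)
  ultimately show "smooth_near T A (\<iota> a) f" using W by (auto simp: smooth_near_def)
qed

lemma smooth_near_p_iff:
  "smooth_near T A p f \<longleftrightarrow> (\<exists>N. open N \<and> 0 \<in> N \<and> N \<subseteq> \<Omega> \<and> smooth_on N (\<lambda>x. f (\<iota> x)))"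
  using smooth_near_iff[OF zero_\<Omega>] by (simp add: \<iota>_zero)

text \<open>The tangent vector at \<open>p\<close> with coordinate vector \<open>w\<close>.\<close>

definition tan :: "'e \<Rightarrow> 'p tangent" where
  "tan w = (\<lambda>f. if smooth_near T A p f then frechet_derivative (\<lambda>x. f (\<iota> x)) (at 0) w else 0)"

lemma tan_not_smooth: "\<not> smooth_near T A p f \<Longrightarrow> tan w f = 0"
  by (simp add: tan_def)

lemma tan_eq: "smooth_near T A p f \<Longrightarrow> ((\<lambda>x. f (\<iota> x)) has_derivative f') (at 0) \<Longrightarrow> tan w f = f' w"
  using frechet_derivative_at[of "\<lambda>x. f (\<iota> x)" f' 0] by (simp add: tan_def)

lemma smooth_near_derivative:
  "smooth_near T A p f \<Longrightarrow> ((\<lambda>x. f (\<iota> x)) has_derivative (\<lambda>w. tan w f)) (at 0)"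
proof -
  assume f: "smooth_near T A p f"
  then obtain N where N: "open N" "0 \<in> N" "smooth_on N (\<lambda>x. f (\<iota> x))"
    using smooth_near_p_iff by blast
  from smooth_on_has_derivative[OF N(3,1,2)] f show ?thesis by (simp add: tan_def)
qed

text \<open>Tangent vectors only depend on the germ of a function at \<open>p\<close>. This also covers functions that
  differ outside of the manifold.\<close>

lemma tan_cong:
  assumes N: "open N" "0 \<in> N" "N \<subseteq> \<Omega>" and eq: "\<And>x. x \<in> N \<Longrightarrow> f (\<iota> x) = g (\<iota> x)"
  shows "tan w f = tan w g"
proof -
  have imp: "smooth_near T A p g \<and> tan w f = tan w g"
    if f: "smooth_near T A p f" and eq: "\<And>x. x \<in> N \<Longrightarrow> f (\<iota> x) = g (\<iota> x)" for f g
  proof -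
    obtain M where M: "open M" "0 \<in> M" "M \<subseteq> \<Omega>" "smooth_on M (\<lambda>x. f (\<iota> x))"
      using f smooth_near_p_iff by blast
    have "smooth_on (M \<inter> N) (\<lambda>x. f (\<iota> x))" by (rule smooth_on_mono[OF M(4,1) open_Int[OF M(1) N(1)]]) simp
    then have "smooth_on (M \<inter> N) (\<lambda>x. g (\<iota> x))" by (rule smooth_on_cong_imp) (use eq in auto)
    then have g: "smooth_near T A p g" unfolding smooth_near_p_iff using M N by blast
    have "((\<lambda>x. g (\<iota> x)) has_derivative (\<lambda>w. tan w f)) (at 0)"
      by (rule has_derivative_transform_within_open[OF smooth_near_derivative[OF f] N(1,2) eq])
    from tan_eq[OF g this, of w] g show ?thesis by simp
  qed
  show ?thesis
  proof (cases "smooth_near T A p f")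
    case True
    then show ?thesis using imp[OF True eq] by simp
  next
    case False
    then have "\<not> smooth_near T A p g" using imp[of g f] eq by auto
    with False show ?thesis by (simp add: tan_not_smooth)
  qed
qed

lemma tan_linear: "linear tan"
proof
  fix w w' :: 'e and c :: real
  show "tan (w + w') = tan w + tan w'"
  proof
    fix f
    show "tan (w + w') f = (tan w + tan w') f"
      using linear_add[OF has_derivative_linear[OF smooth_near_derivative]]
      by (cases "smooth_near T A p f") (simp_all add: tan_not_smooth)
  qed
  show "tan (c *\<^sub>R w) = c *\<^sub>R tan w"
  proof
    fix f
    show "tan (c *\<^sub>R w) f = (c *\<^sub>R tan w) f"
      using linear_scale[OF has_derivative_linear[OF smooth_near_derivative]]
      by (cases "smooth_near T A p f") (simp_all add: tan_not_smooth scaleR_fun_def)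
  qed
qed

lemma smooth_near_coordinate: "smooth_near T A p (\<lambda>q. \<kappa> q \<bullet> b)"
  unfolding smooth_near_p_iff
proof (intro exI conjI)
  have "smooth_on \<Omega> (\<lambda>x. x \<bullet> b)" by (rule smooth_on_bounded_linear[OF open_\<Omega> bounded_linear_inner_left])
  then show "smooth_on \<Omega> (\<lambda>x. \<kappa> (\<iota> x) \<bullet> b)" by (rule smooth_on_cong_imp) (simp add: \<kappa>_\<iota>)
qed (auto simp: open_\<Omega> zero_\<Omega>)

lemma tan_coordinate: "tan w (\<lambda>q. \<kappa> q \<bullet> b) = w \<bullet> b"
proof (rule tan_eq[OF smooth_near_coordinate])
  have "((\<lambda>x. x \<bullet> b) has_derivative (\<lambda>w. w \<bullet> b)) (at 0)"
    by (rule bounded_linear_imp_has_derivative[OF bounded_linear_inner_left])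
  then show "((\<lambda>x. \<kappa> (\<iota> x) \<bullet> b) has_derivative (\<lambda>w. w \<bullet> b)) (at 0)"
    by (rule has_derivative_transform_within_open[OF _ open_\<Omega> zero_\<Omega>]) (simp add: \<kappa>_\<iota>)
qed

lemma tan_inject: "tan w = tan w' \<longleftrightarrow> w = w'"
proof
  assume eq: "tan w = tan w'"
  show "w = w'"
  proof (rule euclidean_eqI)
    fix b :: 'e
    show "w \<bullet> b = w' \<bullet> b"
      using tan_coordinate[of w b] tan_coordinate[of w' b] unfolding eq by (rule trans[OF sym])
  qed
qed simp

lemma velocity_eq_tan:
  assumes "\<delta> > 0" "\<And>t. \<bar>t\<bar> < \<delta> \<Longrightarrow> \<gamma> t \<in> U" "\<gamma> 0 = p"
    and "((\<lambda>t. \<kappa> (\<gamma> t)) has_vector_derivative w) (at 0)"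
  shows "velocity T A \<gamma> = tan w"
proof
  fix f
  show "velocity T A \<gamma> f = tan w f"
  proof (cases "smooth_near T A p f")
    case True
    have f': "((\<lambda>x. f (\<iota> x)) has_derivative (\<lambda>w. tan w f)) (at (\<kappa> (\<gamma> 0)))"
      using smooth_near_derivative[OF True] by (simp add: assms(3) \<kappa>_p)
    have "((\<lambda>t. f (\<iota> (\<kappa> (\<gamma> t)))) has_derivative (\<lambda>h. tan (h *\<^sub>R w) f)) (at 0)"
      by (rule has_derivative_compose[OF assms(4)[unfolded has_vector_derivative_def] f'])
    moreover have "(\<lambda>h. tan (h *\<^sub>R w) f) = (\<lambda>h. h *\<^sub>R tan w f)"
      using linear_scale[OF tan_linear] by (auto simp: scaleR_fun_def)
    ultimately have "((\<lambda>t. f (\<iota> (\<kappa> (\<gamma> t)))) has_vector_derivative tan w f) (at 0)"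
      by (simp add: has_vector_derivative_def)
    then have "((\<lambda>t. f (\<gamma> t)) has_vector_derivative tan w f) (at 0)"
      by (rule has_vector_derivative_transform_within_open[of _ _ _ "{-\<delta><..<\<delta>}"])
         (use assms(1,2) \<iota>_\<kappa> in \<open>auto simp: abs_less_iff\<close>)
    then have "deriv (\<lambda>t. f (\<gamma> t)) 0 = tan w f"
      by (intro DERIV_imp_deriv) (simp add: has_real_derivative_iff_has_vector_derivative)
    then show ?thesis by (simp add: velocity_def assms(3) True)
  qed (simp add: velocity_def assms(3) tan_not_smooth)
qed

lemma smooth_curve_velocity:
  assumes "\<epsilon> > 0" "smooth_into {-\<epsilon><..<\<epsilon>} T A \<gamma>" "\<gamma> 0 = p"
  obtains \<delta> w where "\<delta> > 0" "\<And>t. \<bar>t\<bar> < \<delta> \<Longrightarrow> \<gamma> t \<in> U" "((\<lambda>t. \<kappa> (\<gamma> t)) has_vector_derivative w) (at 0)"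
    "velocity T A \<gamma> = tan w"
proof -
  define S where "S = {t \<in> {-\<epsilon><..<\<epsilon>}. \<gamma> t \<in> U}"
  have S: "open S" unfolding S_def
    by (rule continuous_preimage_open[OF smooth_into_continuous[OF assms(2)] _ chart_open[OF U]]) simp
  have "0 \<in> S" using assms p by (auto simp: S_def)
  then obtain \<delta> where \<delta>: "\<delta> > 0" "ball 0 \<delta> \<subseteq> S" using openE[OF S] by blast
  have in_U: "\<gamma> t \<in> U" if "\<bar>t\<bar> < \<delta>" for t
  proof -
    have "t \<in> ball 0 \<delta>" using that by simp
    then show ?thesis using \<delta>(2) by (auto simp: S_def)
  qed
  have "smooth_into S T A \<gamma>" by (rule smooth_into_subset[OF assms(2) _ S]) (auto simp: S_def)
  then have "smooth_on S (\<lambda>t. \<kappa> (\<gamma> t))" by (rule \<kappa>_smooth_into[OF _ S]) (simp add: S_def)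
  from smooth_on_has_derivative[OF this S \<open>0 \<in> S\<close>]
  have d: "((\<lambda>t. \<kappa> (\<gamma> t)) has_derivative frechet_derivative (\<lambda>t. \<kappa> (\<gamma> t)) (at 0)) (at 0)" .
  have lin: "frechet_derivative (\<lambda>t. \<kappa> (\<gamma> t)) (at 0) h = h *\<^sub>R frechet_derivative (\<lambda>t. \<kappa> (\<gamma> t)) (at 0) 1" for h :: real
    using linear_scale[OF has_derivative_linear[OF d], of h 1] by simp
  have v: "((\<lambda>t. \<kappa> (\<gamma> t)) has_vector_derivative frechet_derivative (\<lambda>t. \<kappa> (\<gamma> t)) (at 0) 1) (at 0)"
    unfolding has_vector_derivative_def by (rule has_derivative_eq_rhs[OF d]) (rule ext, rule lin)
  show ?thesis using that[OF \<delta>(1) in_U v velocity_eq_tan[OF \<delta>(1) in_U assms(3) v]] by blast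
qed

lemma line_in_\<Omega>: "\<exists>\<epsilon>>0. \<forall>t. \<bar>t\<bar> < \<epsilon> \<longrightarrow> t *\<^sub>R w \<in> \<Omega>"
proof -
  have "open ((\<lambda>t. t *\<^sub>R w) -` \<Omega>)" by (intro open_vimage open_\<Omega> continuous_intros)
  then obtain \<epsilon> where "\<epsilon> > 0" "ball 0 \<epsilon> \<subseteq> (\<lambda>t. t *\<^sub>R w) -` \<Omega>"
    using openE[of "(\<lambda>t. t *\<^sub>R w) -` \<Omega>" 0] zero_\<Omega> by auto
  moreover have "t *\<^sub>R w \<in> \<Omega>" if "\<bar>t\<bar> < \<epsilon>" for t
  proof -
    have "t \<in> ball 0 \<epsilon>" using that by simp
    with \<open>ball 0 \<epsilon> \<subseteq> (\<lambda>t. t *\<^sub>R w) -` \<Omega>\<close> show ?thesis by blast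
  qed
  ultimately show ?thesis by blast
qed

text \<open>The straight lines in the chart realise all coordinate vectors as velocities.\<close>

lemma tangent_space_eq: "tangent_space T A p = range tan"
proof (intro equalityI subsetI)
  fix u assume "u \<in> tangent_space T A p"
  then obtain \<gamma> \<epsilon> where \<gamma>: "u = velocity T A \<gamma>" "\<epsilon> > 0" "smooth_into {-\<epsilon><..<\<epsilon>} T A \<gamma>" "\<gamma> 0 = p"
    by (auto simp: tangent_space_def smooth_curve_on_iff)
  show "u \<in> range tan"
    by (rule smooth_curve_velocity[OF \<gamma>(2-4)]) (simp add: \<gamma>(1))
next
  fix u assume "u \<in> range tan"
  then obtain w where u: "u = tan w" by blast
  obtain \<epsilon> where \<epsilon>: "\<epsilon> > 0" "\<And>t. \<bar>t\<bar> < \<epsilon> \<Longrightarrow> t *\<^sub>R w \<in> \<Omega>" using line_in_\<Omega> by blast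
  have "smooth_on {-\<epsilon><..<\<epsilon>} (\<lambda>t. t *\<^sub>R w)"
    by (intro smooth_on_bounded_linear bounded_linear_scaleR_left) simp
  then have c: "smooth_into {-\<epsilon><..<\<epsilon>} T A (\<lambda>t. \<iota> (t *\<^sub>R w))"
    by (rule smooth_into_compose[OF \<iota>_smooth _ open_\<Omega>]) (use \<epsilon>(2) in \<open>auto simp: abs_less_iff\<close>)
  have "((\<lambda>t. t *\<^sub>R w) has_vector_derivative w) (at 0)" by (auto intro!: derivative_eq_intros)
  then have "((\<lambda>t. \<kappa> (\<iota> (t *\<^sub>R w))) has_vector_derivative w) (at 0)"
    by (rule has_vector_derivative_transform_within_open[of _ _ _ "{-\<epsilon><..<\<epsilon>}"])
       (use \<epsilon> \<kappa>_\<iota> in \<open>auto simp: abs_less_iff\<close>)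
  then have "velocity T A (\<lambda>t. \<iota> (t *\<^sub>R w)) = tan w"
    using \<epsilon> \<iota>_in_U by (intro velocity_eq_tan[OF \<epsilon>(1)]) (auto simp: \<iota>_zero)
  then show "u \<in> tangent_space T A p"
    unfolding tangent_space_def smooth_curve_on_iff u mem_Collect_eq
    using c \<epsilon>(1) by (intro exI[of _ "\<lambda>t. \<iota> (t *\<^sub>R w)"] exI[of _ \<epsilon>]) (simp add: \<iota>_zero)
qed

end

section \<open>The Lie algebra of a Lie group\<close>

text \<open>A Lie group with a chart at the identity; the model space is the full Euclidean space.\<close>

locale lie_group_chart = pointed_manifold T A U \<phi> "\<one>\<^bsub>G\<^esub>"
  for G :: "('p, 'm) monoid_scheme" (structure) and T :: "'p topology"
    and A :: "('p, 'e::euclidean_space) chart set" and U :: "'p set" and \<phi> :: "'p \<Rightarrow> 'e" +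
  assumes lie: "lie_group G T A"
begin

sublocale group G
  using lie by (simp add: lie_group_def)

lemma topspace_eq: "topspace T = carrier G"
  using lie by (simp add: lie_group_def)

lemma \<iota>_carrier [simp]: "a \<in> \<Omega> \<Longrightarrow> \<iota> a \<in> carrier G"
  using \<iota>_topspace by (simp add: topspace_eq)

lemma charted: "charted_space T A"
  by unfold_locales

lemma smooth_into_mult:
  assumes "smooth_into S T A c" "smooth_into S T A d" "open S"
  shows "smooth_into S T A (\<lambda>x. c x \<otimes> d x)"
proof -
  have "smooth_map (prod_topology T T) (prod_atlas A A) T A (\<lambda>(x, y). x \<otimes> y)"
    using lie by (simp add: lie_group_def)
  from charted_space.smooth_into_map[OF charted_space_prod smooth_into_Pair[OF assms] assms(3) this charted]
  show ?thesis by simp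
qed

lemma smooth_into_carrier: "smooth_into S T A c \<Longrightarrow> x \<in> S \<Longrightarrow> c x \<in> carrier G"
  using smooth_into_topspace topspace_eq by blast

definition m :: "'e \<times> 'e \<Rightarrow> 'e" where "m p = \<kappa> (\<iota> (fst p) \<otimes> \<iota> (snd p))"
definition D :: "('e \<times> 'e) set" where "D = {p \<in> \<Omega> \<times> \<Omega>. \<iota> (fst p) \<otimes> \<iota> (snd p) \<in> U}"

lemma product_smooth_into: "smooth_into (\<Omega> \<times> \<Omega>) T A (\<lambda>p. \<iota> (fst p) \<otimes> \<iota> (snd p))"
proof (rule smooth_into_mult)
  show o: "open (\<Omega> \<times> \<Omega>)" by (intro open_Times open_\<Omega>)
  show "smooth_into (\<Omega> \<times> \<Omega>) T A (\<lambda>p. \<iota> (fst p))"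
    by (rule smooth_into_compose[OF \<iota>_smooth smooth_on_bounded_linear[OF o bounded_linear_fst] open_\<Omega> o]) auto
  show "smooth_into (\<Omega> \<times> \<Omega>) T A (\<lambda>p. \<iota> (snd p))"
    by (rule smooth_into_compose[OF \<iota>_smooth smooth_on_bounded_linear[OF o bounded_linear_snd] open_\<Omega> o]) auto
qed

lemma open_D: "open D"
  unfolding D_def
  by (rule continuous_preimage_open[OF smooth_into_continuous[OF product_smooth_into] open_Times[OF open_\<Omega> open_\<Omega>] chart_open[OF U]])

lemma m_smooth: "smooth_on D m"
  unfolding m_def
  by (rule \<kappa>_smooth_into[OF smooth_into_subset[OF product_smooth_into open_Times[OF open_\<Omega> open_\<Omega>] open_D] open_D])
     (auto simp: D_def)

lemma \<iota>_m: "(a, b) \<in> D \<Longrightarrow> \<iota> (m (a, b)) = \<iota> a \<otimes> \<iota> b"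
  unfolding D_def m_def using \<iota>_\<kappa> by simp

lemma D_\<Omega>: "(a, b) \<in> D \<Longrightarrow> a \<in> \<Omega>" "(a, b) \<in> D \<Longrightarrow> b \<in> \<Omega>"
  by (auto simp: D_def)

lemma right_D: "a \<in> \<Omega> \<Longrightarrow> (a, 0) \<in> D"
  using zero_\<Omega> \<iota>_in_U by (simp add: D_def \<iota>_zero)

sublocale local_lie_group m D
proof
  show "smooth_on D m" by (rule m_smooth)
  show "open D" by (rule open_D)
  show "0 \<in> D" using right_D[OF zero_\<Omega>] by (simp add: zero_prod_def)
  show "m (x, 0) = x" if "(x, 0) \<in> D" for x
    using D_\<Omega>(1)[OF that] by (simp add: m_def \<iota>_zero \<kappa>_\<iota>)
  show "m (0, x) = x" if "(0, x) \<in> D" for x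
    using D_\<Omega>(2)[OF that] by (simp add: m_def \<iota>_zero \<kappa>_\<iota>)
  show "m (m (a, b), c) = m (a, m (b, c))"
    if "(a, b) \<in> D" "(m (a, b), c) \<in> D" "(b, c) \<in> D" "(a, m (b, c)) \<in> D" for a b c
  proof -
    have "m (m (a, b), c) = \<kappa> (\<iota> (m (a, b)) \<otimes> \<iota> c)" by (simp add: m_def)
    also have "\<dots> = \<kappa> (\<iota> a \<otimes> \<iota> (m (b, c)))"
      using that D_\<Omega>[OF that(1)] D_\<Omega>[OF that(3)] by (simp add: \<iota>_m m_assoc)
    finally show ?thesis by (simp add: m_def)
  qed
qed

abbreviation field :: "'p tangent \<Rightarrow> ('p \<Rightarrow> real) \<Rightarrow> 'p \<Rightarrow> real" where
  "field \<equiv> left_invariant_field G"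

text \<open>In coordinates the left-invariant field of \<open>w\<close> is \<open>a \<mapsto> F a w\<close>: apply the chain rule to
  \<open>y \<mapsto> f(a y)\<close> at the identity.\<close>

lemma field_chart:
  assumes N: "open N" "N \<subseteq> \<Omega>" "smooth_on N (\<lambda>x. f (\<iota> x))" and a: "a \<in> N"
  shows "smooth_near T A \<one> (\<lambda>y. f (\<iota> a \<otimes> y))"
    and "field (tan w) f (\<iota> a) = frechet_derivative (\<lambda>x. f (\<iota> x)) (at a) (F a w)"
proof -
  have a\<Omega>: "a \<in> \<Omega>" using a N by blast
  define M where "M = {b. (a, b) \<in> D} \<inter> (\<lambda>b. m (a, b)) -` N"
  have D': "open {b. (a, b) \<in> D}"
    using open_vimage[OF open_D, of "Pair a"] by (simp add: vimage_def continuous_on_Pair continuous_on_const continuous_on_id)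
  have sm: "smooth_on {b. (a, b) \<in> D} (\<lambda>b. m (a, b))"
    by (rule smooth_on_compose[OF m_smooth _ D' open_D]) (auto intro!: smooth_on_Pair smooth_on_const smooth_on_id D')
  have M: "open M" unfolding M_def
    by (rule continuous_open_preimage[OF smooth_on_continuous_on[OF sm] D' N(1)])
  have ma: "m (a, 0) = a" by (rule right_unit[OF right_D[OF a\<Omega>]])
  have M0: "0 \<in> M" using right_D[OF a\<Omega>] a by (simp add: M_def ma)
  have M\<Omega>: "M \<subseteq> \<Omega>" using D_\<Omega> by (auto simp: M_def)
  have f: "f (\<iota> (m (a, b))) = f (\<iota> a \<otimes> \<iota> b)" if "b \<in> M" for b
    using that \<iota>_m by (simp add: M_def)
  have "smooth_on M (\<lambda>b. m (a, b))"
    by (rule smooth_on_mono[OF sm D' M]) (auto simp: M_def)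
  from smooth_on_compose[OF N(3) this M N(1)] have "smooth_on M (\<lambda>b. f (\<iota> (m (a, b))))" by (auto simp: M_def)
  then have "smooth_on M (\<lambda>b. f (\<iota> a \<otimes> \<iota> b))" by (rule smooth_on_cong_imp) (rule f)
  then show near: "smooth_near T A \<one> (\<lambda>y. f (\<iota> a \<otimes> y))"
    unfolding smooth_near_p_iff using M M0 M\<Omega> by blast
  have "((\<lambda>b. m (a, b)) has_derivative F a) (at 0)"
    using m_has_derivative_snd[OF right_D[OF a\<Omega>]] by (simp add: F_def[abs_def])
  from has_derivative_compose[OF this, unfolded ma, OF smooth_on_has_derivative[OF N(3,1) a]]
  have "((\<lambda>b. f (\<iota> (m (a, b)))) has_derivative (\<lambda>w. frechet_derivative (\<lambda>x. f (\<iota> x)) (at a) (F a w))) (at 0)" .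
  then have "((\<lambda>b. f (\<iota> a \<otimes> \<iota> b)) has_derivative (\<lambda>w. frechet_derivative (\<lambda>x. f (\<iota> x)) (at a) (F a w))) (at 0)"
    by (rule has_derivative_transform_within_open[OF _ M M0 f])
  from tan_eq[OF near this]
  show "field (tan w) f (\<iota> a) = frechet_derivative (\<lambda>x. f (\<iota> x)) (at a) (F a w)"
    by (simp add: left_invariant_field_def)
qed

lemma field_smooth:
  assumes N: "open N" "N \<subseteq> \<Omega>" "smooth_on N (\<lambda>x. f (\<iota> x))"
  shows "smooth_on N (\<lambda>a. field (tan w) f (\<iota> a))"
proof (rule smooth_on_cong_imp)
  show "smooth_on N (\<lambda>a. frechet_derivative (\<lambda>x. f (\<iota> x)) (at a) (F a w))"
    using N(2) by (intro smooth_on_directional_derivative[OF N(3,1,1)] smooth_on_id N(1) F_smooth right_D) auto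
qed (rule field_chart(2)[OF N, symmetric])

lemma field_smooth_near: "smooth_near T A \<one> f \<Longrightarrow> smooth_near T A \<one> (field (tan w) f)"
  unfolding smooth_near_p_iff using field_smooth by blast

lemma field_derivative:
  assumes f: "smooth_near T A \<one> f"
  shows "tan z (field (tan w) f)
    = frechet_derivative (\<lambda>a. frechet_derivative (\<lambda>x. f (\<iota> x)) (at a) w) (at 0) z + tan (\<beta> z w) f"
proof -
  obtain N where N: "open N" "0 \<in> N" "N \<subseteq> \<Omega>" "smooth_on N (\<lambda>x. f (\<iota> x))"
    using f smooth_near_p_iff by blast
  from smooth_on_directional_has_derivative[OF N(4,1,2) F_derivative[of w]]
  have "((\<lambda>a. frechet_derivative (\<lambda>x. f (\<iota> x)) (at a) (F a w)) has_derivative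
      (\<lambda>z. frechet_derivative (\<lambda>a. frechet_derivative (\<lambda>x. f (\<iota> x)) (at a) w) (at 0) z
         + frechet_derivative (\<lambda>x. f (\<iota> x)) (at 0) (\<beta> z w))) (at 0)"
    by (simp only: F_zero)
  then have "((\<lambda>a. field (tan w) f (\<iota> a)) has_derivative
      (\<lambda>z. frechet_derivative (\<lambda>a. frechet_derivative (\<lambda>x. f (\<iota> x)) (at a) w) (at 0) z
         + frechet_derivative (\<lambda>x. f (\<iota> x)) (at 0) (\<beta> z w))) (at 0)"
    by (rule has_derivative_transform_within_open[OF _ N(1,2)]) (rule field_chart(2)[OF N(1,3,4), symmetric])
  from tan_eq[OF field_smooth_near[OF f] this, of z] f show ?thesis by (simp add: tan_def)
qed

text \<open>In \<open>field_derivative\<close> the second derivative of \<open>f\<close> is symmetric in \<open>z\<close> and \<open>w\<close>, so it cancels in the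
  commutator, which leaves the antisymmetric part of \<open>\<beta>\<close>.\<close>

lemma lie_bracket_tan: "lie_bracket G T A (tan z) (tan w) = tan (\<beta> z w - \<beta> w z)"
proof
  fix f
  show "lie_bracket G T A (tan z) (tan w) f = tan (\<beta> z w - \<beta> w z) f"
  proof (cases "smooth_near T A \<one> f")
    case True
    obtain N where N: "open N" "0 \<in> N" "N \<subseteq> \<Omega>" "smooth_on N (\<lambda>x. f (\<iota> x))"
      using True smooth_near_p_iff by blast
    have "tan (\<beta> z w - \<beta> w z) f = tan (\<beta> z w) f - tan (\<beta> w z) f"
      by (simp add: linear_diff[OF tan_linear])
    then show ?thesis
      using True field_derivative[OF True, of z w] field_derivative[OF True, of w z]
        second_derivative_symmetric[OF N(4,1,2), of w z]
      by (simp add: lie_bracket_def)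
  qed (simp add: lie_bracket_def tan_not_smooth)
qed

lemma tan_diff_fun:
  assumes "smooth_near T A \<one> f" "smooth_near T A \<one> g"
  shows "tan w (\<lambda>q. f q - g q) = tan w f - tan w g"
proof -
  obtain N where N: "open N" "0 \<in> N" "N \<subseteq> \<Omega>" "smooth_on N (\<lambda>x. f (\<iota> x))"
    using assms(1) smooth_near_p_iff by blast
  obtain M where M: "open M" "0 \<in> M" "M \<subseteq> \<Omega>" "smooth_on M (\<lambda>x. g (\<iota> x))"
    using assms(2) smooth_near_p_iff by blast
  have o: "open (N \<inter> M)" using N M by blast
  have "smooth_on (N \<inter> M) (\<lambda>x. f (\<iota> x))" "smooth_on (N \<inter> M) (\<lambda>x. g (\<iota> x))"
    using smooth_on_mono[OF N(4,1) o] smooth_on_mono[OF M(4,1) o] by auto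
  then have "smooth_on (N \<inter> M) (\<lambda>x. f (\<iota> x) + - g (\<iota> x))"
    by (intro smooth_on_add o smooth_on_bounded_linear_comp[OF _ _ bounded_linear_minus[OF bounded_linear_ident]])
  then have near: "smooth_near T A \<one> (\<lambda>q. f q - g q)"
    unfolding smooth_near_p_iff using N M o by (intro exI[of _ "N \<inter> M"]) auto
  show ?thesis
    by (rule tan_eq[OF near has_derivative_diff[OF smooth_near_derivative[OF assms(1)] smooth_near_derivative[OF assms(2)]]])
qed

text \<open>The bracket is defined as the commutator of left-invariant fields at the identity. Associativity
  lets a field commute with left translations, which carries the formula to the other points. It makes
  iterated brackets into iterated commutators.\<close>

lemma field_bracket:
  assumes N: "open N" "N \<subseteq> \<Omega>" "smooth_on N (\<lambda>x. f (\<iota> x))" and a: "a \<in> N"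
  shows "field (lie_bracket G T A (tan z) (tan w)) f (\<iota> a)
    = field (tan z) (field (tan w) f) (\<iota> a) - field (tan w) (field (tan z) f) (\<iota> a)"
proof -
  have a\<Omega>: "a \<in> \<Omega>" using a N by blast
  have comm: "tan z (field (tan w) (\<lambda>y. f (\<iota> a \<otimes> y))) = field (tan z) (field (tan w) f) (\<iota> a)" for z w
    unfolding left_invariant_field_def
  proof (rule tan_cong[OF open_\<Omega> zero_\<Omega> subset_refl])
    fix b assume b: "b \<in> \<Omega>"
    show "tan w (\<lambda>y. f (\<iota> a \<otimes> (\<iota> b \<otimes> y))) = tan w (\<lambda>y. f (\<iota> a \<otimes> \<iota> b \<otimes> y))"
      by (rule tan_cong[OF open_\<Omega> zero_\<Omega> subset_refl]) (simp add: a\<Omega> b m_assoc)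
  qed
  have "field (lie_bracket G T A (tan z) (tan w)) f (\<iota> a) = lie_bracket G T A (tan z) (tan w) (\<lambda>y. f (\<iota> a \<otimes> y))"
    by (simp add: left_invariant_field_def)
  then show ?thesis
    using field_chart(1)[OF N a] comm by (simp add: lie_bracket_def)
qed

lemma lie_bracket_nested:
  assumes f: "smooth_near T A \<one> f"
  shows "lie_bracket G T A (tan u) (lie_bracket G T A (tan v) (tan w)) f
    = tan u (field (tan v) (field (tan w) f)) - tan u (field (tan w) (field (tan v) f))
      - (tan v (field (tan w) (field (tan u) f)) - tan w (field (tan v) (field (tan u) f)))"
proof -
  obtain N where N: "open N" "0 \<in> N" "N \<subseteq> \<Omega>" "smooth_on N (\<lambda>x. f (\<iota> x))"
    using f smooth_near_p_iff by blast
  have "tan u (field (lie_bracket G T A (tan v) (tan w)) f)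
      = tan u (\<lambda>q. field (tan v) (field (tan w) f) q - field (tan w) (field (tan v) f) q)"
    by (rule tan_cong[OF N(1-3)]) (rule field_bracket[OF N(1,3,4)])
  also have "\<dots> = tan u (field (tan v) (field (tan w) f)) - tan u (field (tan w) (field (tan v) f))"
    by (intro tan_diff_fun field_smooth_near f)
  finally show ?thesis
    using f field_smooth_near[OF f, of u] by (simp add: lie_bracket_def)
qed

text \<open>The Jacobi identity is the formal identity of commutators, by \<open>lie_bracket_nested\<close>; the other laws
  follow from the bilinearity of \<open>\<beta>\<close>.\<close>

lemma lie_algebra: "lie_algebra_on (range tan) (lie_bracket G T A)"
proof -
  interpret \<beta>: bounded_bilinear \<beta> by (rule \<beta>_bilinear)
  note tan_simps = linear_add[OF tan_linear, symmetric] linear_scale[OF tan_linear, symmetric]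
  have jacobi: "lie_bracket G T A (tan u) (lie_bracket G T A (tan v) (tan w))
      + lie_bracket G T A (tan v) (lie_bracket G T A (tan w) (tan u))
      + lie_bracket G T A (tan w) (lie_bracket G T A (tan u) (tan v)) = 0" for u v w
  proof
    fix f
    show "(lie_bracket G T A (tan u) (lie_bracket G T A (tan v) (tan w))
      + lie_bracket G T A (tan v) (lie_bracket G T A (tan w) (tan u))
      + lie_bracket G T A (tan w) (lie_bracket G T A (tan u) (tan v))) f = 0 f"
    proof (cases "smooth_near T A \<one> f")
      case True
      then show ?thesis by (simp add: lie_bracket_nested)
    next
      case False
      then show ?thesis by (simp add: lie_bracket_def)
    qed
  qed
  have "subspace (range tan)"
    by (rule linear_subspace_image[OF tan_linear subspace_UNIV])
  moreover have "lie_bracket G T A (tan u) (tan u) = 0" for u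
    using linear_0[OF tan_linear] by (simp add: lie_bracket_tan)
  ultimately show ?thesis
    unfolding lie_algebra_on_def using jacobi
    by (auto simp: tan_simps lie_bracket_tan tan_inject \<beta>.add_left \<beta>.add_right \<beta>.scaleR_left \<beta>.scaleR_right algebra_simps)
qed

end

section \<open>The exponential map of a Lie group\<close>

text \<open>The constants \<open>R\<close> and \<open>L\<close> are parameters, which \<open>exists_radius\<close> provides for every Lie group.\<close>

locale lie_group_exp = lie_group_chart G T A U \<phi>
  for G :: "('p, 'm) monoid_scheme" (structure) and T :: "'p topology"
    and A :: "('p, 'e::euclidean_space) chart set" and U :: "'p set" and \<phi> :: "'p \<Rightarrow> 'e" +
  fixes R L :: real
  assumes bounded: "bounded_local_lie_group m D R L"
begin

sublocale bounded_local_lie_group m D R L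
  by (rule bounded)

lemma e_\<Omega>: "norm w < \<rho> \<Longrightarrow> e w \<in> \<Omega>"
  using in_D[OF e_in_ball, of w 0] R_pos by (auto intro: D_\<Omega>(1))

lemma \<iota>_e_add:
  assumes "norm (s *\<^sub>R w) < \<rho>" "norm (t *\<^sub>R w) < \<rho>" "norm ((s + t) *\<^sub>R w) < \<rho>"
  shows "\<iota> (e (s *\<^sub>R w)) \<otimes> \<iota> (e (t *\<^sub>R w)) = \<iota> (e ((s + t) *\<^sub>R w))"
  using \<iota>_m[OF in_D[OF e_in_ball[OF assms(1)] e_in_ball[OF assms(2)]]] e_add[OF assms] by simp

lemma \<iota>_e_power:
  assumes w: "norm w < \<rho>" and k: "k \<ge> 1"
  shows "\<iota> (e w) = \<iota> (e ((1 / real k) *\<^sub>R w)) [^] k"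
proof -
  have small: "norm ((real j / real k) *\<^sub>R w) < \<rho>" if "j \<le> k" for j
  proof -
    have "(real j / real k) * norm w \<le> 1 * norm w" using that k by (intro mult_right_mono) auto
    then show ?thesis using w by simp
  qed
  have "\<iota> (e ((real j / real k) *\<^sub>R w)) = \<iota> (e ((1 / real k) *\<^sub>R w)) [^] j" if "j \<le> k" for j
    using that
  proof (induction j)
    case 0
    then show ?case by (simp add: e_zero \<iota>_zero)
  next
    case (Suc j)
    have "\<iota> (e ((real j / real k) *\<^sub>R w)) \<otimes> \<iota> (e ((1 / real k) *\<^sub>R w))
        = \<iota> (e ((real j / real k + 1 / real k) *\<^sub>R w))"
      using small[of j] small[of 1] small[of "Suc j"] Suc.prems k
      by (intro \<iota>_e_add) (auto simp: add_divide_distrib add.commute)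
    moreover have "real j / real k + 1 / real k = real (Suc j) / real k" by (simp add: add_divide_distrib)
    ultimately show ?case using Suc by simp
  qed
  from this[of k] k show ?thesis by simp
qed

text \<open>The exponential map, globalised by \<open>exp(w) = exp(w/k)^k\<close>; by \<open>E_eq\<close> the value is the same
  for all \<open>k\<close> that bring \<open>w/k\<close> into the domain of the local exponential map.\<close>

definition E :: "'e \<Rightarrow> 'p" where
  "E w = (let k = SOME k. k \<ge> 1 \<and> norm ((1 / real k) *\<^sub>R w) < \<rho> in \<iota> (e ((1 / real k) *\<^sub>R w)) [^] k)"

lemma exists_scale: "\<exists>k::nat\<ge>1. x / real k < \<rho>"
proof -
  obtain n :: nat where n: "x / \<rho> < real n" using reals_Archimedean2 by blast
  have "x < real n * \<rho>" using n \<rho>(1) by (simp add: pos_divide_less_eq)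
  also have "\<dots> \<le> real (Suc n) * \<rho>" using \<rho>(1) by (intro mult_right_mono) auto
  finally have "x / real (Suc n) < \<rho>" by (simp add: pos_divide_less_eq mult.commute)
  then show ?thesis by (intro exI[of _ "Suc n"]) simp
qed

text \<open>Two admissible exponents are compared through their product, by \<open>\<iota>_e_power\<close>.\<close>

lemma E_eq:
  assumes k: "k \<ge> 1" and w: "norm ((1 / real k) *\<^sub>R w) < \<rho>"
  shows "E w = \<iota> (e ((1 / real k) *\<^sub>R w)) [^] k"
proof -
  define n where "n = (SOME k. k \<ge> 1 \<and> norm ((1 / real k) *\<^sub>R w) < \<rho>)"
  have n: "n \<ge> 1" "norm ((1 / real n) *\<^sub>R w) < \<rho>"
    using someI[of "\<lambda>k. k \<ge> 1 \<and> norm ((1 / real k) *\<^sub>R w) < \<rho>" k] k w by (auto simp: n_def)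
  have c: "\<iota> (e ((1 / real n) *\<^sub>R (1 / real k) *\<^sub>R w)) \<in> carrier G"
  proof (rule \<iota>_carrier, rule e_\<Omega>)
    have "norm ((1 / real k) *\<^sub>R w) / real n \<le> norm ((1 / real k) *\<^sub>R w) / 1"
      using n(1) by (intro divide_left_mono) auto
    then show "norm ((1 / real n) *\<^sub>R (1 / real k) *\<^sub>R w) < \<rho>"
      using w by (simp add: mult.commute[of "real n"])
  qed
  have "E w = \<iota> (e ((1 / real n) *\<^sub>R w)) [^] n" unfolding E_def n_def Let_def ..
  also have "\<dots> = (\<iota> (e ((1 / real k) *\<^sub>R (1 / real n) *\<^sub>R w)) [^] k) [^] n"
    using \<iota>_e_power[OF n(2) k] by simp
  also have "\<dots> = (\<iota> (e ((1 / real n) *\<^sub>R (1 / real k) *\<^sub>R w)) [^] n) [^] k"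
    using c by (simp add: nat_pow_pow mult.commute)
  also have "\<dots> = \<iota> (e ((1 / real k) *\<^sub>R w)) [^] k"
    using \<iota>_e_power[OF w n(1)] by simp
  finally show ?thesis .
qed

lemma E_small: "norm w < \<rho> \<Longrightarrow> E w = \<iota> (e w)"
  using E_eq[of 1 w] e_\<Omega> by simp

lemma E_carrier [simp]: "E w \<in> carrier G"
proof -
  obtain k :: nat where k: "k \<ge> 1" "norm w / real k < \<rho>" using exists_scale by blast
  then have "norm ((1 / real k) *\<^sub>R w) < \<rho>" by simp
  from E_eq[OF k(1) this] e_\<Omega>[OF this] show ?thesis by simp
qed

lemma E_zero: "E 0 = \<one>"
  using E_small[of 0] \<rho>(1) by (simp add: e_zero \<iota>_zero)

lemma E_add: "E (s *\<^sub>R w) \<otimes> E (t *\<^sub>R w) = E ((s + t) *\<^sub>R w)"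
proof -
  obtain k :: nat where k: "k \<ge> 1" "(\<bar>s\<bar> + \<bar>t\<bar>) * norm w / real k < \<rho>" using exists_scale by blast
  have small: "norm ((1 / real k) *\<^sub>R r *\<^sub>R w) < \<rho>" if "\<bar>r\<bar> \<le> \<bar>s\<bar> + \<bar>t\<bar>" for r
  proof -
    have "\<bar>r\<bar> * norm w / real k \<le> (\<bar>s\<bar> + \<bar>t\<bar>) * norm w / real k"
      using that by (intro divide_right_mono mult_right_mono) auto
    with k(2) show ?thesis by simp
  qed
  define v where "v = (1 / real k) *\<^sub>R w"
  have v: "(1 / real k) *\<^sub>R r *\<^sub>R w = r *\<^sub>R v" for r by (simp add: v_def)
  have s: "norm (s *\<^sub>R v) < \<rho>" and t: "norm (t *\<^sub>R v) < \<rho>" and st: "norm ((s + t) *\<^sub>R v) < \<rho>"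
    using small[of s] small[of t] small[of "s + t"] unfolding v by auto
  have ts: "norm ((t + s) *\<^sub>R v) < \<rho>" using st by (simp add: add.commute)
  have E: "E (r *\<^sub>R w) = \<iota> (e (r *\<^sub>R v)) [^] k" if "norm (r *\<^sub>R v) < \<rho>" for r
    using E_eq[OF k(1), of "r *\<^sub>R w"] that unfolding v .
  have "\<iota> (e (s *\<^sub>R v)) \<otimes> \<iota> (e (t *\<^sub>R v)) = \<iota> (e (t *\<^sub>R v)) \<otimes> \<iota> (e (s *\<^sub>R v))"
    using \<iota>_e_add[OF s t st] \<iota>_e_add[OF t s ts] by (simp add: add.commute)
  from pow_mult_distrib[OF this, of k] show ?thesis
    using E[OF s] E[OF t] E[OF st] \<iota>_e_add[OF s t st] e_\<Omega>[OF s] e_\<Omega>[OF t] by simp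
qed

lemma E_power: "E w [^] (n::nat) = E (real n *\<^sub>R w)"
proof (induction n)
  case 0
  then show ?case by (simp add: E_zero)
next
  case (Suc n)
  then show ?case using E_add[of "real n" w 1] by (simp add: add.commute)
qed

text \<open>Near \<open>t0\<close> the curve is the left translate by \<open>E(t0 w)\<close> of the smooth local flow near 0.\<close>

lemma E_smooth: "smooth_into UNIV T A (\<lambda>t. E (t *\<^sub>R w))"
proof (rule smooth_into_local[OF open_UNIV])
  fix t0 :: real
  define W where "W = {t. norm ((t - t0) *\<^sub>R w) < \<rho>}"
  have W: "open W" unfolding W_def by (intro open_Collect_less continuous_intros)
  have o: "open {t. norm (t *\<^sub>R w) < \<rho>}" by (intro open_Collect_less continuous_intros)
  have "smooth_on W (\<lambda>t. t + - t0)" by (intro smooth_on_add W smooth_on_id smooth_on_const)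
  from smooth_on_compose[OF e_smooth[of w] this W o]
  have "smooth_on W (\<lambda>t. e ((t - t0) *\<^sub>R w))" by (auto simp: W_def)
  then have "smooth_into W T A (\<lambda>t. \<iota> (e ((t - t0) *\<^sub>R w)))"
    by (rule smooth_into_compose[OF \<iota>_smooth _ open_\<Omega> W]) (simp add: W_def e_\<Omega>)
  moreover have "smooth_into W T A (\<lambda>t. E (t0 *\<^sub>R w))"
    by (rule smooth_into_const[OF _ W]) (simp add: topspace_eq)
  ultimately have "smooth_into W T A (\<lambda>t. E (t0 *\<^sub>R w) \<otimes> \<iota> (e ((t - t0) *\<^sub>R w)))"
    by (intro smooth_into_mult W)
  then have "smooth_into W T A (\<lambda>t. E (t *\<^sub>R w))"
  proof (rule smooth_into_cong)
    fix t assume "t \<in> W"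
    then have "E ((t - t0) *\<^sub>R w) = \<iota> (e ((t - t0) *\<^sub>R w))" by (intro E_small) (simp add: W_def)
    then show "E (t0 *\<^sub>R w) \<otimes> \<iota> (e ((t - t0) *\<^sub>R w)) = E (t *\<^sub>R w)"
      using E_add[of t0 w "t - t0"] by simp
  qed
  moreover have "t0 \<in> W" using \<rho>(1) by (simp add: W_def)
  ultimately show "\<exists>W. open W \<and> t0 \<in> W \<and> W \<subseteq> UNIV \<and> smooth_into W T A (\<lambda>t. E (t *\<^sub>R w))"
    using W by blast
qed

lemma E_one_parameter: "one_parameter_subgroup G T A (\<lambda>t. E (t *\<^sub>R w))"
  unfolding one_parameter_subgroup_def smooth_curve_on_iff using E_smooth E_add by simp

lemma small_multiples: "\<exists>\<delta>>0. \<forall>t. \<bar>t\<bar> < \<delta> \<longrightarrow> norm (t *\<^sub>R w) < \<rho>"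
proof -
  have "\<bar>t\<bar> * norm w < \<rho>" if "\<bar>t\<bar> < \<rho> / (norm w + 1)" for t
  proof -
    have "\<bar>t\<bar> * norm w \<le> \<bar>t\<bar> * (norm w + 1)" by (intro mult_left_mono) auto
    also have "\<dots> < \<rho>" using that by (simp add: pos_less_divide_eq add_nonneg_pos)
    finally show ?thesis .
  qed
  then show ?thesis using \<rho>(1) by (intro exI[of _ "\<rho> / (norm w + 1)"]) (auto simp: add_nonneg_pos)
qed

lemma e_has_vector_derivative: "((\<lambda>t. e (t *\<^sub>R w)) has_vector_derivative w) (at 0)"
  using e_derivative[of 0 w] \<rho>(1) by (simp add: e_zero F_zero)

lemma E_velocity: "velocity T A (\<lambda>t. E (t *\<^sub>R w)) = tan w"
proof -
  obtain \<delta> where \<delta>: "\<delta> > 0" "\<And>t. \<bar>t\<bar> < \<delta> \<Longrightarrow> norm (t *\<^sub>R w) < \<rho>" using small_multiples by blast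
  have Et: "E (t *\<^sub>R w) = \<iota> (e (t *\<^sub>R w))" "e (t *\<^sub>R w) \<in> \<Omega>" if "\<bar>t\<bar> < \<delta>" for t
    using E_small[OF \<delta>(2)[OF that]] e_\<Omega>[OF \<delta>(2)[OF that]] by auto
  have "((\<lambda>t. \<kappa> (E (t *\<^sub>R w))) has_vector_derivative w) (at 0)"
    by (rule has_vector_derivative_transform_within_open[OF e_has_vector_derivative, of "{-\<delta><..<\<delta>}"])
       (use \<delta>(1) Et \<kappa>_\<iota> in \<open>auto simp: abs_less_iff\<close>)
  then show ?thesis
    by (intro velocity_eq_tan[OF \<delta>(1)]) (simp_all add: Et \<iota>_in_U E_zero)
qed

lemma one_parameter_power:
  assumes "one_parameter_subgroup G T A \<gamma>"
  shows "\<gamma> t \<in> carrier G" "\<gamma> 0 = \<one>" "\<gamma> (real n * t) = \<gamma> t [^] n"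
proof -
  have hom: "\<gamma> (s + t) = \<gamma> s \<otimes> \<gamma> t" for s t
    using assms by (simp add: one_parameter_subgroup_def)
  show c: "\<gamma> t \<in> carrier G" for t
    using assms smooth_into_carrier[of UNIV \<gamma>] by (simp add: one_parameter_subgroup_def smooth_curve_on_iff)
  have "\<gamma> 0 \<otimes> \<gamma> 0 = \<gamma> 0" using hom[of 0 0] by simp
  then show 0: "\<gamma> 0 = \<one>" using c[of 0] l_cancel_one by blast
  show "\<gamma> (real n * t) = \<gamma> t [^] n"
  proof (induction n)
    case (Suc n)
    then show ?case using hom[of "real n * t" t] by (simp add: algebra_simps)
  qed (simp add: 0)
qed

text \<open>Near 0, the curve is the local flow with its own initial velocity, by \<open>local_one_parameter_unique\<close>.
  Powers extend the equality to all times.\<close>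

lemma one_parameter_velocity:
  assumes \<gamma>: "one_parameter_subgroup G T A \<gamma>"
  obtains w where "velocity T A \<gamma> = tan w" "\<gamma> = (\<lambda>t. E (t *\<^sub>R w))"
proof -
  have hom: "\<gamma> (s + t) = \<gamma> s \<otimes> \<gamma> t" for s t
    using \<gamma> by (simp add: one_parameter_subgroup_def)
  have sm: "smooth_into {-(1::real)<..<1} T A \<gamma>"
    using \<gamma> smooth_into_subset[of UNIV \<gamma> "{-1<..<1}"] by (simp add: one_parameter_subgroup_def smooth_curve_on_iff)
  show ?thesis
  proof (rule smooth_curve_velocity[OF zero_less_one sm one_parameter_power(2)[OF \<gamma>]])
    fix \<delta> w
    assume \<delta>: "\<delta> > 0" "\<And>t. \<bar>t\<bar> < \<delta> \<Longrightarrow> \<gamma> t \<in> U"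
      and w: "((\<lambda>t. \<kappa> (\<gamma> t)) has_vector_derivative w) (at 0)" "velocity T A \<gamma> = tan w"
    define y where "y = (\<lambda>t. \<kappa> (\<gamma> t))"
    have y0: "y 0 = 0" using \<kappa>_p by (simp add: y_def one_parameter_power(2)[OF \<gamma>])
    have "isCont y 0" using has_vector_derivative_continuous[OF w(1)] by (simp add: y_def)
    then obtain \<delta>2 where \<delta>2: "\<delta>2 > 0" "\<And>t. \<bar>t\<bar> < \<delta>2 \<Longrightarrow> norm (y t) < R"
      using R_pos y0 by (auto simp: continuous_at dist_norm LIM_def) (metis abs_zero norm_zero)
    obtain \<delta>3 where \<delta>3: "\<delta>3 > 0" "\<And>t. \<bar>t\<bar> < \<delta>3 \<Longrightarrow> norm (t *\<^sub>R w) < \<rho>" using small_multiples by blast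
    have m_y: "y (s + t) = m (y s, y t)" if "\<bar>s\<bar> < min \<delta> \<delta>2" "\<bar>t\<bar> < min \<delta> \<delta>2" for s t
      using that \<delta>(2) by (simp add: y_def m_def \<iota>_\<kappa> hom)
    obtain \<eta> where \<eta>: "\<eta> > 0" "\<And>t. \<bar>t\<bar> < \<eta> \<Longrightarrow> y t = e (t *\<^sub>R w)"
      using local_one_parameter_unique[of "min \<delta> \<delta>2" y w] \<delta>(1) \<delta>2 m_y y0 w(1) unfolding y_def[symmetric] by auto
    define r where "r = min \<eta> (min \<delta> \<delta>3)"
    have near: "\<gamma> t = E (t *\<^sub>R w)" if "\<bar>t\<bar> < r" for t
    proof -
      have "\<gamma> t = \<iota> (y t)" using that \<delta>(2) by (simp add: y_def \<iota>_\<kappa> r_def)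
      also have "\<dots> = E (t *\<^sub>R w)" using that \<eta>(2)[of t] E_small[OF \<delta>3(2)[of t]] by (simp add: r_def)
      finally show ?thesis .
    qed
    have "\<gamma> t = E (t *\<^sub>R w)" for t
    proof -
      obtain n :: nat where n: "\<bar>t\<bar> / r < real n" using reals_Archimedean2 by blast
      have r: "r > 0" using \<eta>(1) \<delta>(1) \<delta>3(1) by (simp add: r_def)
      have n0: "0 < real n" using n r by (meson abs_ge_zero divide_nonneg_pos le_less_trans)
      have "\<bar>t / real n\<bar> < r" using n n0 r by (simp add: field_simps)
      from near[OF this] have "\<gamma> (real n * (t / real n)) = E ((t / real n) *\<^sub>R w) [^] n"
        unfolding one_parameter_power(3)[OF \<gamma>] by simp
      then show ?thesis using n0 by (simp add: E_power)
    qed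
    then show ?thesis using that[OF w(2)] by blast
  qed
qed

lemma one_parameter_unique:
  assumes "one_parameter_subgroup G T A \<gamma>" "velocity T A \<gamma> = tan w"
  shows "\<gamma> = (\<lambda>t. E (t *\<^sub>R w))"
  using one_parameter_velocity[OF assms(1)] assms(2) tan_inject by metis

lemma lie_exp_tan: "lie_exp G T A (tan w) = E w"
proof -
  have "(THE \<gamma>. one_parameter_subgroup G T A \<gamma> \<and> velocity T A \<gamma> = tan w) = (\<lambda>t. E (t *\<^sub>R w))"
    using E_one_parameter E_velocity one_parameter_unique by (intro the_equality) blast+
  then show ?thesis by (simp add: lie_exp_def)
qed

text \<open>Conjugation maps one-parameter subgroups to one-parameter subgroups; the initial velocity of the
  image is the vector in question.\<close>

lemma exists_Ad:
  assumes g: "g \<in> carrier G"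
  shows "\<exists>w. \<forall>t. g \<otimes> E (t *\<^sub>R v) \<otimes> inv g = E (t *\<^sub>R w)"
proof -
  let ?\<gamma> = "\<lambda>t. g \<otimes> E (t *\<^sub>R v) \<otimes> inv g"
  have "smooth_into UNIV T A ?\<gamma>"
    by (intro smooth_into_mult smooth_into_const E_smooth open_UNIV) (use g in \<open>auto simp: topspace_eq\<close>)
  moreover have "?\<gamma> (s + t) = ?\<gamma> s \<otimes> ?\<gamma> t" for s t
  proof -
    have "?\<gamma> s \<otimes> ?\<gamma> t = g \<otimes> E (s *\<^sub>R v) \<otimes> (inv g \<otimes> g) \<otimes> E (t *\<^sub>R v) \<otimes> inv g"
      using g by (simp only: m_assoc m_closed inv_closed E_carrier)
    also have "\<dots> = g \<otimes> (E (s *\<^sub>R v) \<otimes> E (t *\<^sub>R v)) \<otimes> inv g"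
      using g by (simp add: m_assoc)
    finally show ?thesis by (simp add: E_add)
  qed
  ultimately have "one_parameter_subgroup G T A ?\<gamma>"
    by (simp add: one_parameter_subgroup_def smooth_curve_on_iff)
  then obtain w where "?\<gamma> = (\<lambda>t. E (t *\<^sub>R w))" by (rule one_parameter_velocity)
  then show ?thesis by (metis (no_types, lifting))
qed

definition Ad :: "'p \<Rightarrow> 'e \<Rightarrow> 'e" where
  "Ad g v = (SOME w. \<forall>t. g \<otimes> E (t *\<^sub>R v) \<otimes> inv g = E (t *\<^sub>R w))"

lemma Ad: "g \<in> carrier G \<Longrightarrow> g \<otimes> E (t *\<^sub>R v) \<otimes> inv g = E (t *\<^sub>R Ad g v)"
  using someI_ex[OF exists_Ad, of g v] unfolding Ad_def[symmetric] by blast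

lemma mult_continuous: "continuous_map (prod_topology T T) T (\<lambda>(x, y). x \<otimes> y)"
  using lie by (simp add: lie_group_def smooth_map_def)

lemma continuous_map_mult:
  assumes "continuous_map X T f" "continuous_map X T g"
  shows "continuous_map X T (\<lambda>x. f x \<otimes> g x)"
proof -
  have "continuous_map X (prod_topology T T) (\<lambda>x. (f x, g x))"
    using assms by (simp add: continuous_map_paired)
  from continuous_map_compose[OF this mult_continuous] show ?thesis by (simp add: o_def)
qed

lemma continuous_map_power:
  assumes "continuous_map X T f"
  shows "continuous_map X T (\<lambda>x. f x [^] (k::nat))"
proof (induction k)
  case 0
  then show ?case by (simp add: topspace_eq)
next
  case (Suc k)
  then show ?case using continuous_map_mult[OF Suc assms] by simp
qed

lemma e_continuous: "continuous_on (ball 0 \<rho>) e"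
proof (rule lipschitz_on_continuous_on)
  show "(4 * L * \<rho> + 1)-lipschitz_on (ball 0 \<rho>) e"
  proof (rule lipschitz_onI)
    fix u v :: 'e assume "u \<in> ball 0 \<rho>" "v \<in> ball 0 \<rho>"
    then have "norm (e u - e v - (u - v)) \<le> 4 * L * \<rho> * norm (u - v)" by (intro e_strict) auto
    then show "dist (e u) (e v) \<le> (4 * L * \<rho> + 1) * dist u v"
      using norm_triangle_ineq[of "e u - e v - (u - v)" "u - v"] by (simp add: dist_norm algebra_simps)
  qed (use L_pos \<rho>(1) in simp)
qed

lemma E_continuous: "continuous_map euclidean T E"
proof -
  have "open {w. E w \<in> V}" if V: "openin T V" for V
  proof (subst open_subopen, clarify)
    fix w assume w: "E w \<in> V"
    obtain k :: nat where k: "k \<ge> 1" "norm w / real k < \<rho>" using exists_scale by blast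
    define N where "N = {v::'e. norm ((1 / real k) *\<^sub>R v) < \<rho>}"
    have N: "open N" unfolding N_def by (intro open_Collect_less continuous_intros)
    have "continuous_on N (\<lambda>v. e ((1 / real k) *\<^sub>R v))"
      by (rule continuous_on_compose2[OF e_continuous]) (auto intro!: continuous_intros simp: N_def)
    moreover have "e ((1 / real k) *\<^sub>R v) \<in> \<Omega>" if "v \<in> N" for v using that e_\<Omega> by (simp add: N_def)
    ultimately have "continuous_map (top_of_set N) (top_of_set \<Omega>) (\<lambda>v. e ((1 / real k) *\<^sub>R v))" by auto
    from continuous_map_power[OF continuous_map_compose[OF this smooth_into_continuous[OF \<iota>_smooth]]]
    have "continuous_map (top_of_set N) T (\<lambda>v. \<iota> (e ((1 / real k) *\<^sub>R v)) [^] k)" by simp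
    then have "continuous_map (top_of_set N) T E"
      by (rule continuous_map_eq) (simp add: E_eq[OF k(1)] N_def)
    from continuous_preimage_open[OF this N V] have "open {v \<in> N. E v \<in> V}" .
    moreover have "w \<in> {v \<in> N. E v \<in> V}" using w k by (simp add: N_def)
    ultimately show "\<exists>X. open X \<and> w \<in> X \<and> X \<subseteq> {w. E w \<in> V}" by blast
  qed
  then show ?thesis by (simp add: continuous_map_def topspace_eq)
qed

text \<open>Let \<open>w = Ad(x) v\<close>. In the chart \<open>x E(tv) = E(tw) x\<close> reads \<open>m(x, e(tv)) = m(e(tw), x)\<close>. Dividing the
  second-order expansions by \<open>t\<close> gives \<open>v + \<beta>(x, v) = w + \<beta>(w, x) + o(x)\<close>. This bounds \<open>w\<close> first,
  then shows that \<open>w - v\<close> is small, and finally allows to replace \<open>\<beta>(w, x)\<close> by \<open>\<beta>(v, x)\<close>.\<close>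

lemma Ad_derivative:
  assumes "\<epsilon> > 0"
  shows "\<exists>\<delta>>0. \<forall>x. norm x < \<delta> \<longrightarrow> x \<in> \<Omega> \<and> norm (Ad (\<iota> x) v - v - (\<beta> x v - \<beta> v x)) \<le> \<epsilon> * norm x"
proof -
  interpret \<beta>: bounded_bilinear \<beta> by (rule \<beta>_bilinear)
  obtain K where K: "K > 0" "\<And>x y. norm (\<beta> x y) \<le> norm x * norm y * K" using \<beta>.pos_bounded by blast
  have est: "\<exists>d>0. \<forall>x. norm x < d \<longrightarrow> x \<in> \<Omega> \<and> (\<forall>w. w = Ad (\<iota> x) v \<longrightarrow>
      norm ((v + \<beta> x v) - (w + \<beta> w x)) \<le> \<mu> * norm x * (norm v + norm w))" if \<mu>: "\<mu> > 0" for \<mu>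
  proof -
    obtain d where d: "d > 0" "\<And>x y. x \<in> ball 0 d \<Longrightarrow> y \<in> ball 0 d \<Longrightarrow> norm (m (x, y) - x - y - \<beta> x y) \<le> \<mu> * norm x * norm y"
      using m_second_order[OF \<mu>] by blast
    have "x \<in> \<Omega> \<and> norm ((v + \<beta> x v) - (w + \<beta> w x)) \<le> \<mu> * norm x * (norm v + norm w)"
      if x: "norm x < min d R" and w: "w = Ad (\<iota> x) v" for x w
    proof
      show x\<Omega>: "x \<in> \<Omega>" using in_D[of x 0] x R_pos D_\<Omega>(1) by auto
      obtain \<delta>1 where \<delta>1: "\<delta>1 > 0" "\<And>t. \<bar>t\<bar> < \<delta>1 \<Longrightarrow> norm (t *\<^sub>R v) < \<rho>" using small_multiples by blast
      obtain \<delta>2 where \<delta>2: "\<delta>2 > 0" "\<And>t. \<bar>t\<bar> < \<delta>2 \<Longrightarrow> norm (t *\<^sub>R w) < \<rho>" using small_multiples by blast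
      have quot: "((\<lambda>t. (1 / t) *\<^sub>R e (t *\<^sub>R u)) \<longlongrightarrow> u) (at_right 0)" for u
      proof -
        have "((\<lambda>t. (1 / t) *\<^sub>R e (t *\<^sub>R u)) \<longlongrightarrow> u) (at 0)"
          using has_vector_derivative_quotient[OF e_has_vector_derivative[of u]] by (simp add: e_zero)
        then show ?thesis by (rule tendsto_within_subset) simp
      qed
      have e_lim: "((\<lambda>t. e (t *\<^sub>R u)) \<longlongrightarrow> 0) (at_right 0)" for u
      proof -
        have "((\<lambda>t. e (t *\<^sub>R u)) \<longlongrightarrow> 0) (at 0)"
          using has_vector_derivative_continuous[OF e_has_vector_derivative[of u]] by (simp add: continuous_at e_zero)
        then show ?thesis by (rule tendsto_within_subset) simp
      qed
      have small: "\<forall>\<^sub>F t in at_right 0. norm (e (t *\<^sub>R u)) < d" for u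
        using order_tendstoD(2)[OF tendsto_norm[OF e_lim[of u]], of d] d(1) by simp
      have "((\<lambda>t. ((1 / t) *\<^sub>R e (t *\<^sub>R v) + \<beta> x ((1 / t) *\<^sub>R e (t *\<^sub>R v))) - ((1 / t) *\<^sub>R e (t *\<^sub>R w) + \<beta> ((1 / t) *\<^sub>R e (t *\<^sub>R w)) x))
          \<longlongrightarrow> (v + \<beta> x v) - (w + \<beta> w x)) (at_right 0)"
        by (intro tendsto_intros quot \<beta>.tendsto)
      moreover have "((\<lambda>t. \<mu> * norm x * (norm ((1 / t) *\<^sub>R e (t *\<^sub>R v)) + norm ((1 / t) *\<^sub>R e (t *\<^sub>R w))))
          \<longlongrightarrow> \<mu> * norm x * (norm v + norm w)) (at_right 0)"
        by (intro tendsto_intros quot)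
      moreover have "\<forall>\<^sub>F t in at_right 0.
          norm (((1 / t) *\<^sub>R e (t *\<^sub>R v) + \<beta> x ((1 / t) *\<^sub>R e (t *\<^sub>R v))) - ((1 / t) *\<^sub>R e (t *\<^sub>R w) + \<beta> ((1 / t) *\<^sub>R e (t *\<^sub>R w)) x))
          \<le> \<mu> * norm x * (norm ((1 / t) *\<^sub>R e (t *\<^sub>R v)) + norm ((1 / t) *\<^sub>R e (t *\<^sub>R w)))"
      proof -
        have "\<forall>\<^sub>F t in at_right 0. 0 < t \<and> t < min \<delta>1 \<delta>2"
          using \<delta>1(1) \<delta>2(1) by (auto simp: eventually_at_right_field intro!: exI[of _ "min \<delta>1 \<delta>2"])
        then show ?thesis using small[of v] small[of w]
        proof eventually_elim
          case (elim t)
          let ?a = "e (t *\<^sub>R v)" and ?b = "e (t *\<^sub>R w)"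
          have tv: "norm (t *\<^sub>R v) < \<rho>" and tw: "norm (t *\<^sub>R w) < \<rho>" using elim \<delta>1(2)[of t] \<delta>2(2)[of t] by auto
          have D1: "(x, ?a) \<in> D" and D2: "(?b, x) \<in> D"
            using in_D e_in_ball[OF tv] e_in_ball[OF tw] x by auto
          have "\<iota> x \<otimes> E (t *\<^sub>R v) = E (t *\<^sub>R w) \<otimes> \<iota> x"
            using Ad[of "\<iota> x" t v] x\<Omega> w by (metis E_carrier \<iota>_carrier inv_solve_right' m_closed)
          then have "m (x, ?a) = m (?b, x)"
            by (simp add: m_def E_small[OF tv] E_small[OF tw])
          then have "(?a + \<beta> x ?a) - (?b + \<beta> ?b x) = (m (?b, x) - ?b - x - \<beta> ?b x) - (m (x, ?a) - x - ?a - \<beta> x ?a)"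
            by simp
          also have "norm \<dots> \<le> \<mu> * norm ?b * norm x + \<mu> * norm x * norm ?a"
            using elim x by (intro norm_triangle_le_diff add_mono d(2)) auto
          finally have "norm ((?a + \<beta> x ?a) - (?b + \<beta> ?b x)) \<le> \<mu> * norm x * (norm ?a + norm ?b)" by (simp add: algebra_simps)
          then have "(1 / t) * norm ((?a + \<beta> x ?a) - (?b + \<beta> ?b x)) \<le> (1 / t) * (\<mu> * norm x * (norm ?a + norm ?b))"
            using elim by (intro mult_left_mono) auto
          moreover have eq: "((1 / t) *\<^sub>R ?a + \<beta> x ((1 / t) *\<^sub>R ?a)) - ((1 / t) *\<^sub>R ?b + \<beta> ((1 / t) *\<^sub>R ?b) x)
              = (1 / t) *\<^sub>R ((?a + \<beta> x ?a) - (?b + \<beta> ?b x))"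
            by (simp add: \<beta>.scaleR_left \<beta>.scaleR_right scaleR_diff_right scaleR_add_right)
          ultimately show ?case unfolding eq norm_scaleR using elim by (simp add: algebra_simps)
        qed
      qed
      ultimately show "norm ((v + \<beta> x v) - (w + \<beta> w x)) \<le> \<mu> * norm x * (norm v + norm w)"
        by (intro tendsto_le[OF trivial_limit_at_right_real _ tendsto_norm])
    qed
    then show ?thesis using d(1) R_pos by (intro exI[of _ "min d R"]) auto
  qed
  define C where "C = 3 * norm v + 1"
  have C: "C > 0" by (simp add: C_def add_nonneg_pos)
  \<comment> \<open>\<open>C\<close> is chosen such that \<open>\<bar>w\<bar> \<le> 3 \<bar>v\<bar>\<close> gives \<open>\<bar>v\<bar> + \<bar>w\<bar> \<le> 2 C\<close>, and \<open>\<mu>\<close> and \<open>\<delta>\<close> such that two error terms are at most \<open>\<epsilon> \<bar>x\<bar> / 2\<close> each\<close>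
  define \<mu> where "\<mu> = \<epsilon> / (4 * C)"
  have \<mu>: "\<mu> > 0" using assms C by (simp add: \<mu>_def)
  obtain d where d: "d > 0" "\<And>x. norm x < d \<Longrightarrow> x \<in> \<Omega>"
    "\<And>x. norm x < d \<Longrightarrow> norm ((v + \<beta> x v) - (Ad (\<iota> x) v + \<beta> (Ad (\<iota> x) v) x)) \<le> \<mu> * norm x * (norm v + norm (Ad (\<iota> x) v))"
    using est[OF \<mu>] by blast
  define \<delta> where "\<delta> = min d (min (1 / (2 * (\<mu> + K))) (\<epsilon> / (4 * K * (\<mu> + K) * C)))"
  have "x \<in> \<Omega> \<and> norm (Ad (\<iota> x) v - v - (\<beta> x v - \<beta> v x)) \<le> \<epsilon> * norm x" if x: "norm x < \<delta>" for x
  proof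
    show "x \<in> \<Omega>" using x d(2) by (simp add: \<delta>_def)
    define w where "w = Ad (\<iota> x) v"
    define n where "n = norm x"
    have pos: "0 < 2 * (\<mu> + K)" "0 < 4 * K * (\<mu> + K) * C" using \<mu> K(1) C by simp_all
    have "n < d" "n < 1 / (2 * (\<mu> + K))" "n < \<epsilon> / (4 * K * (\<mu> + K) * C)"
      using x by (simp_all add: \<delta>_def n_def)
    then have n: "0 \<le> n" "n < d" "n * (\<mu> + K) \<le> 1 / 2" "n * (4 * K * (\<mu> + K) * C) \<le> \<epsilon>"
      unfolding pos_less_divide_eq[OF pos(1)] pos_less_divide_eq[OF pos(2)]
      by (simp_all add: n_def algebra_simps)
    have 1: "norm ((v + \<beta> x v) - (w + \<beta> w x)) \<le> \<mu> * n * (norm v + norm w)"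
      using d(3)[of x] n by (simp add: w_def n_def)
    have 2: "norm (w - v) \<le> (\<mu> + K) * n * (norm v + norm w)"
    proof -
      have "w - v = (\<beta> x v - \<beta> w x) - ((v + \<beta> x v) - (w + \<beta> w x))" by simp
      also have "norm \<dots> \<le> (n * norm v * K + norm w * n * K) + \<mu> * n * (norm v + norm w)"
        unfolding n_def by (intro norm_triangle_le_diff add_mono K(2) 1[unfolded n_def])
      finally show ?thesis by (simp add: algebra_simps)
    qed
    also have "\<dots> \<le> (1 / 2) * (norm v + norm w)"
      using n(3) by (intro mult_right_mono) (auto simp: mult_ac)
    finally have half: "norm (w - v) \<le> (1 / 2) * (norm v + norm w)" .
    have w: "norm w \<le> 3 * norm v" using norm_triangle_sub[of w v] half by argo
    then have vw: "norm v + norm w \<le> 2 * C" using norm_ge_zero[of v] unfolding C_def by argo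
    have wv: "norm (w - v) \<le> (\<mu> + K) * n * (2 * C)"
      by (rule order_trans[OF 2]) (use vw \<mu> K(1) n(1) in \<open>intro mult_left_mono; simp\<close>)
    have "w - v - (\<beta> x v - \<beta> v x) = - ((v + \<beta> x v) - (w + \<beta> w x)) - \<beta> (w - v) x"
      by (simp add: \<beta>.diff_left)
    also have "norm \<dots> \<le> \<mu> * n * (norm v + norm w) + norm (w - v) * n * K"
    proof (intro norm_triangle_le_diff add_mono)
      show "norm (- ((v + \<beta> x v) - (w + \<beta> w x))) \<le> \<mu> * n * (norm v + norm w)"
        unfolding norm_minus_cancel by (rule 1)
      show "norm (\<beta> (w - v) x) \<le> norm (w - v) * n * K" unfolding n_def by (rule K(2))
    qed
    also have "\<dots> \<le> \<mu> * n * (2 * C) + ((\<mu> + K) * n * (2 * C)) * n * K"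
      using vw wv \<mu> K(1) n(1) by (intro add_mono mult_left_mono mult_right_mono) auto
    also have "\<mu> * n * (2 * C) = (\<epsilon> / 2) * n" using C by (simp add: \<mu>_def)
    also have "((\<mu> + K) * n * (2 * C)) * n * K = (n * (4 * K * (\<mu> + K) * C)) / 2 * n" by simp
    also have "(\<epsilon> / 2) * n + (n * (4 * K * (\<mu> + K) * C)) / 2 * n \<le> (\<epsilon> / 2) * n + (\<epsilon> / 2) * n"
      using n(1,4) by (intro add_left_mono mult_right_mono divide_right_mono) auto
    finally show "norm (Ad (\<iota> x) v - v - (\<beta> x v - \<beta> v x)) \<le> \<epsilon> * norm x"
      by (simp add: w_def n_def)
  qed
  moreover have "\<delta> > 0" using d(1) \<mu> K(1) C assms by (simp add: \<delta>_def)
  ultimately show ?thesis by blast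
qed

end

section \<open>Lie groups that are \<open>\<rat>\<close>-groups\<close>

locale lie_Q_group = lie_group_exp G T A U \<phi> R L
  for G :: "('p, 'm) monoid_scheme" (structure) and T :: "'p topology"
    and A :: "('p, 'e::euclidean_space) chart set" and U :: "'p set" and \<phi> :: "'p \<Rightarrow> 'e"
    and R L :: real +
  assumes Q: "Q_group G T"
begin

lemma power_bij: "n \<ge> 1 \<Longrightarrow> bij_betw (\<lambda>x. x [^] (int n)) (carrier G) (carrier G)"
  using Q by (simp add: Q_group_def)

lemma power_inject:
  assumes "(n::nat) \<ge> 1" "x \<in> carrier G" "y \<in> carrier G" "x [^] n = y [^] n"
  shows "x = y"
  using power_bij[OF assms(1)] assms(2-4) by (auto simp: bij_betw_def inj_on_def int_pow_int)

text \<open>\<open>E(w/n)\<close> is an \<open>n\<close>-th root of \<open>E(w)\<close>, and roots are unique.\<close>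

lemma root_E:
  assumes "n \<ge> 1"
  shows "group_root G (int n) (E w) = E ((1 / real n) *\<^sub>R w)"
proof -
  have "E w = E ((1 / real n) *\<^sub>R w) [^] (int n)"
    using assms by (simp add: int_pow_int E_power)
  then show ?thesis
    unfolding group_root_def
    using inv_into_f_f[OF bij_betw_imp_inj_on[OF power_bij[OF assms]], of "E ((1 / real n) *\<^sub>R w)"] by simp
qed

lemma e_expand:
  assumes u: "norm u < \<rho>" and v: "norm v < \<rho>"
  shows "norm (e u - e v - (u - v)) \<le> (1 / 4) * norm (u - v)"
proof -
  have "norm (e u - e v - (u - v)) \<le> 4 * L * \<rho> * norm (u - v)"
    using u v by (intro e_strict) auto
  also have "\<dots> \<le> (1 / 4) * norm (u - v)" using \<rho>(3) by (intro mult_right_mono) auto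
  finally show ?thesis .
qed

lemma e_inj: "inj_on e (ball 0 \<rho>)"
proof (rule inj_onI)
  fix u v assume uv: "u \<in> ball 0 \<rho>" "v \<in> ball 0 \<rho>" "e u = e v"
  then have "norm (u - v) \<le> (1 / 4) * norm (u - v)"
    using e_expand[of u v] by (simp add: norm_minus_commute)
  then have "norm (u - v) \<le> 0" by argo
  then show "u = v" by simp
qed

lemma open_e_image: "open (e ` ball 0 \<rho>)"
  by (rule invariance_of_domain[OF e_continuous open_ball e_inj])

text \<open>Equal values have equal \<open>k\<close>-th roots \<open>E(u/k)\<close> and \<open>E(v/k)\<close>. For large \<open>k\<close> these lie in the
  neighbourhood of the identity where the exponential map is injective.\<close>

lemma E_inject: "E u = E v \<longleftrightarrow> u = v"
proof
  assume eq: "E u = E v"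
  obtain k :: nat where k: "k \<ge> 1" "(norm u + norm v) / real k < \<rho>" using exists_scale by blast
  have "norm u / real k \<le> (norm u + norm v) / real k" "norm v / real k \<le> (norm u + norm v) / real k"
    by (intro divide_right_mono; simp)+
  then have small: "norm ((1 / real k) *\<^sub>R u) < \<rho>" "norm ((1 / real k) *\<^sub>R v) < \<rho>"
    using k(2) by simp_all
  have "E ((1 / real k) *\<^sub>R u) [^] k = E ((1 / real k) *\<^sub>R v) [^] k"
    using k(1) eq by (simp add: E_power)
  then have "E ((1 / real k) *\<^sub>R u) = E ((1 / real k) *\<^sub>R v)" by (rule power_inject[OF k(1) E_carrier E_carrier])
  then have "\<kappa> (\<iota> (e ((1 / real k) *\<^sub>R u))) = \<kappa> (\<iota> (e ((1 / real k) *\<^sub>R v)))"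
    unfolding E_small[OF small(1)] E_small[OF small(2)] by (rule arg_cong)
  then have "e ((1 / real k) *\<^sub>R u) = e ((1 / real k) *\<^sub>R v)"
    unfolding \<kappa>_\<iota>[OF e_\<Omega>[OF small(1)]] \<kappa>_\<iota>[OF e_\<Omega>[OF small(2)]] .
  then have "(1 / real k) *\<^sub>R u = (1 / real k) *\<^sub>R v"
    by (rule inj_onD[OF e_inj]) (use small in auto)
  then show "u = v" using k(1) by simp
qed simp

text \<open>Invariance of domain for the injective map \<open>\<psi> \<circ> E\<close>, where \<open>\<psi>\<close> is a chart at the point in question.
  It applies because \<open>E\<close> is continuous everywhere, while differentiability has only been shown at 0.\<close>

lemma E_open:
  assumes S: "open S"
  shows "openin T (E ` S)"
proof (subst openin_subopen, clarify)
  fix u assume u: "u \<in> S"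
  obtain V \<psi> where V: "(V, \<psi>) \<in> A" "E u \<in> V" using cover[of "E u"] topspace_eq by auto
  have E_S: "continuous_map (top_of_set S) T E"
    by (rule continuous_map_from_subtopology[OF E_continuous])
  define N where "N = {v \<in> S. E v \<in> V}"
  have N: "open N" unfolding N_def by (rule continuous_preimage_open[OF E_S S chart_open[OF V(1)]])
  have "continuous_map (top_of_set N) (subtopology T V) E"
    using continuous_map_from_subtopology[OF E_continuous] by (auto simp: continuous_map_in_subtopology N_def)
  from continuous_map_compose[OF this homeomorphic_imp_continuous_map[OF chart_homeo[OF V(1)]]]
  have "continuous_on N (\<psi> \<circ> E)" by simp
  moreover have "inj_on (\<psi> \<circ> E) N"
    using chart_inj[OF V(1)] E_inject by (auto simp: inj_on_def N_def)
  ultimately have "open ((\<psi> \<circ> E) ` N)" using N by (intro invariance_of_domain)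
  from chart_preimage_open[OF V(1) this] have o: "openin T {q \<in> V. \<psi> q \<in> (\<psi> \<circ> E) ` N}" .
  have "{q \<in> V. \<psi> q \<in> (\<psi> \<circ> E) ` N} \<subseteq> E ` S"
    using chart_inj[OF V(1)] by (auto simp: N_def inj_on_def)
  moreover have "E u \<in> {q \<in> V. \<psi> q \<in> (\<psi> \<circ> E) ` N}" using u V by (auto simp: N_def)
  ultimately show "\<exists>W. openin T W \<and> E u \<in> W \<and> W \<subseteq> E ` S" using o by blast
qed

lemma limitin_E_iff: "limitin T (\<lambda>n. E (x n)) (E w) fil \<longleftrightarrow> (x \<longlongrightarrow> w) fil"
proof
  assume l: "limitin T (\<lambda>n. E (x n)) (E w) fil"
  show "(x \<longlongrightarrow> w) fil"
  proof (rule topological_tendstoI)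
    fix S assume "open S" "w \<in> S"
    then have "\<forall>\<^sub>F n in fil. E (x n) \<in> E ` S" using l E_open[of S] by (auto simp: limitin_def)
    then show "\<forall>\<^sub>F n in fil. x n \<in> S" by eventually_elim (auto simp: E_inject)
  qed
next
  assume "(x \<longlongrightarrow> w) fil"
  then show "limitin T (\<lambda>n. E (x n)) (E w) fil"
    using continuous_map_limit[OF E_continuous, of x w fil] by (simp add: o_def)
qed

subsection \<open>The topology on the Lie algebra\<close>

abbreviation X :: "'p tangent topology" where "X \<equiv> exp_topology G T A"

lemma topspace_X: "topspace X = range tan"
  unfolding exp_topology_def topspace_pullback_topology tangent_space_eq
  by (auto simp: lie_exp_tan topspace_eq)

text \<open>The exponential map is injective, continuous and open.\<close>

lemma limitin_X_iff: "limitin X (\<lambda>n. tan (x n)) (tan w) fil \<longleftrightarrow> (x \<longlongrightarrow> w) fil"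
proof -
  have openX: "openin X S \<longleftrightarrow> (\<exists>V. openin T V \<and> S = lie_exp G T A -` V \<inter> range tan)" for S
    unfolding exp_topology_def openin_pullback_topology tangent_space_eq ..
  have "limitin X (\<lambda>n. tan (x n)) (tan w) fil \<longleftrightarrow> limitin T (\<lambda>n. E (x n)) (E w) fil"
  proof
    assume l: "limitin X (\<lambda>n. tan (x n)) (tan w) fil"
    show "limitin T (\<lambda>n. E (x n)) (E w) fil"
      unfolding limitin_def
    proof (intro conjI allI impI)
      fix V assume V: "openin T V \<and> E w \<in> V"
      then have "openin X (lie_exp G T A -` V \<inter> range tan)" "tan w \<in> lie_exp G T A -` V \<inter> range tan"
        using openX by (auto simp: lie_exp_tan)
      then have "\<forall>\<^sub>F n in fil. tan (x n) \<in> lie_exp G T A -` V \<inter> range tan"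
        using l by (auto simp: limitin_def)
      then show "\<forall>\<^sub>F n in fil. E (x n) \<in> V" by eventually_elim (simp add: lie_exp_tan)
    qed (simp add: topspace_eq)
  next
    assume l: "limitin T (\<lambda>n. E (x n)) (E w) fil"
    show "limitin X (\<lambda>n. tan (x n)) (tan w) fil"
      unfolding limitin_def
    proof (intro conjI allI impI)
      fix S assume S: "openin X S \<and> tan w \<in> S"
      then obtain V where V: "openin T V" "S = lie_exp G T A -` V \<inter> range tan" using openX by blast
      then have "E w \<in> V" using S by (auto simp: lie_exp_tan)
      then have "\<forall>\<^sub>F n in fil. E (x n) \<in> V" using l V(1) by (auto simp: limitin_def)
      then show "\<forall>\<^sub>F n in fil. tan (x n) \<in> S" by eventually_elim (simp add: V(2) lie_exp_tan)
    qed (simp add: topspace_X)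
  qed
  then show ?thesis by (simp add: limitin_E_iff)
qed

lemma unique_limit_X:
  assumes x: "x \<longlonglongrightarrow> w" and f: "\<And>n. n \<ge> 1 \<Longrightarrow> f n = tan (x n)"
  shows "unique_limit X f (tan w)"
proof -
  have "\<forall>\<^sub>F n in sequentially. f n = tan (x n)"
    using f by (auto simp: eventually_sequentially)
  then have eq: "limitin X f l sequentially \<longleftrightarrow> limitin X (\<lambda>n. tan (x n)) l sequentially" for l
    using limitin_transform_eventually[of f "\<lambda>n. tan (x n)" sequentially X l]
      limitin_transform_eventually[of "\<lambda>n. tan (x n)" f sequentially X l]
    by (auto simp: eq_commute)
  have "l = tan w" if l: "limitin X (\<lambda>n. tan (x n)) l sequentially" for l
  proof -
    obtain w' where w': "l = tan w'" using limitin_topspace[OF l] by (auto simp: topspace_X)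
    then have "x \<longlonglongrightarrow> w'" using l by (simp add: limitin_X_iff)
    then show ?thesis using LIMSEQ_unique[OF x] by (simp add: w')
  qed
  then show ?thesis using x unfolding unique_limit_def eq by (simp add: limitin_X_iff)
qed

lemma X_sequence:
  assumes "range \<alpha> \<subseteq> topspace X" "limitin X \<alpha> (tan w) sequentially"
  obtains x where "\<And>n. \<alpha> n = tan (x n)" "x \<longlonglongrightarrow> w"
proof -
  have "\<forall>n. \<exists>x. \<alpha> n = tan x" using assms(1) by (auto simp: topspace_X)
  then obtain x where x: "\<And>n. \<alpha> n = tan (x n)" by metis
  then have "\<alpha> = (\<lambda>n. tan (x n))" by auto
  with assms(2) have "x \<longlonglongrightarrow> w" by (simp add: limitin_X_iff)
  with x show ?thesis by (rule that)
qed

subsection \<open>The product formula\<close>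

text \<open>A logarithm near the identity, equal to the identity map up to second order.\<close>

lemma e_log:
  assumes "p \<in> e ` ball 0 \<rho>"
  shows "\<exists>z. norm z < \<rho> \<and> e z = p \<and> norm (p - z) \<le> 8 * L * norm p * norm p"
proof -
  obtain z where z: "norm z < \<rho>" "e z = p" using assms by auto
  have 1: "norm (p - z) \<le> 4 * L * norm z * norm z"
    using e_strict[of z "norm z" 0] z \<rho>(1) by (simp add: e_zero)
  have "norm (p - z) \<le> (1 / 4) * norm z" using e_expand[of z 0] z \<rho>(1) by (simp add: e_zero)
  then have "norm z \<le> (4 / 3) * norm p" using norm_triangle_sub[of z p] by (simp add: norm_minus_commute)
  then have "norm z * norm z \<le> ((4 / 3) * norm p) * ((4 / 3) * norm p)" by (intro mult_mono) auto
  also have "\<dots> \<le> 2 * (norm p * norm p)" by simp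
  finally have "4 * L * (norm z * norm z) \<le> 4 * L * (2 * (norm p * norm p))" using L_pos by (intro mult_left_mono) auto
  then have "norm (p - z) \<le> 8 * L * norm p * norm p" using 1 by (simp add: mult.assoc)
  then show ?thesis using z by blast
qed

text \<open>In the chart, \<open>E(u/n) E(v/n)\<close> has coordinates \<open>p n = (u + v)/n + o(1/n)\<close>, and so has its
  logarithm \<open>z n\<close>. The \<open>n\<close>-th power is \<open>E(n z n)\<close>, where \<open>n z n\<close> tends to \<open>u + v\<close>.\<close>

lemma trotter: "limitin T (\<lambda>n. (E ((1 / real n) *\<^sub>R u) \<otimes> E ((1 / real n) *\<^sub>R v)) [^] n) (E (u + v)) sequentially"
proof -
  define a where "a = (\<lambda>n. e ((1 / real n) *\<^sub>R u))"
  define b where "b = (\<lambda>n. e ((1 / real n) *\<^sub>R v))"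
  define p where "p = (\<lambda>n. m (a n, b n))"
  have inv_n: "(\<lambda>n. 1 / real n) \<longlonglongrightarrow> 0" by (rule lim_1_over_n)
  have at0: "filterlim (\<lambda>n. 1 / real n) (at 0) sequentially"
    using inv_n by (auto simp: filterlim_at eventually_sequentially intro!: exI[of _ 1])
  have quot: "(\<lambda>n. real n *\<^sub>R e ((1 / real n) *\<^sub>R w)) \<longlonglongrightarrow> w" for w
    using filterlim_compose[OF has_vector_derivative_quotient[OF e_has_vector_derivative[of w]] at0] by (simp add: e_zero)
  have small: "\<forall>\<^sub>F n in sequentially. norm ((1 / real n) *\<^sub>R w) < \<rho>" for w :: 'e
  proof -
    have "(\<lambda>n. norm ((1 / real n) *\<^sub>R w)) \<longlonglongrightarrow> norm (0 *\<^sub>R w)" by (intro tendsto_intros inv_n)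
    then show ?thesis using order_tendstoD(2)[of _ "norm (0 *\<^sub>R w)" sequentially \<rho>] \<rho>(1) by simp
  qed
  have e0: "(\<lambda>n. e ((1 / real n) *\<^sub>R w)) \<longlonglongrightarrow> 0" for w
  proof -
    have "(\<lambda>n. (1 / real n) *\<^sub>R (real n *\<^sub>R e ((1 / real n) *\<^sub>R w))) \<longlonglongrightarrow> 0 *\<^sub>R w"
      by (intro tendsto_scaleR inv_n quot)
    then have "(\<lambda>n. (1 / real n) *\<^sub>R (real n *\<^sub>R e ((1 / real n) *\<^sub>R w))) \<longlonglongrightarrow> 0" by simp
    then show ?thesis
      by (rule Lim_transform_eventually) (auto simp: eventually_sequentially intro!: exI[of _ 1])
  qed
  have np: "(\<lambda>n. real n *\<^sub>R p n) \<longlonglongrightarrow> u + v"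
  proof -
    have "(\<lambda>n. real n *\<^sub>R (p n - a n - b n)) \<longlonglongrightarrow> 0"
    proof (rule Lim_null_comparison)
      show "\<forall>\<^sub>F n in sequentially. norm (real n *\<^sub>R (p n - a n - b n)) \<le> L * norm (real n *\<^sub>R a n) * norm (b n)"
        using small[of u] small[of v]
      proof eventually_elim
        case (elim n)
        have "norm (p n - a n - b n) \<le> L * norm (a n) * norm (b n)"
          unfolding p_def a_def b_def by (rule m_bound[OF e_in_ball[OF elim(1)] e_in_ball[OF elim(2)]])
        then have "real n * norm (p n - a n - b n) \<le> real n * (L * norm (a n) * norm (b n))"
          by (rule mult_left_mono) simp
        then show ?case by (simp add: mult_ac)
      qed
      have "(\<lambda>n. L * norm (real n *\<^sub>R a n) * norm (b n)) \<longlonglongrightarrow> L * norm u * norm (0::'e)"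
        unfolding a_def b_def by (intro tendsto_intros quot e0)
      then show "(\<lambda>n. L * norm (real n *\<^sub>R a n) * norm (b n)) \<longlonglongrightarrow> 0" by simp
    qed
    from tendsto_add[OF this tendsto_add[OF quot[of u] quot[of v]]]
    show ?thesis by (simp add: a_def b_def algebra_simps)
  qed
  have p0: "p \<longlonglongrightarrow> 0"
  proof -
    have "(\<lambda>n. (1 / real n) *\<^sub>R (real n *\<^sub>R p n)) \<longlonglongrightarrow> 0 *\<^sub>R (u + v)"
      by (intro tendsto_scaleR inv_n np)
    then have "(\<lambda>n. (1 / real n) *\<^sub>R (real n *\<^sub>R p n)) \<longlonglongrightarrow> 0" by simp
    then show ?thesis
      by (rule Lim_transform_eventually) (auto simp: eventually_sequentially intro!: exI[of _ 1])
  qed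
  have p_in: "\<forall>\<^sub>F n in sequentially. p n \<in> e ` ball 0 \<rho>"
    using topological_tendstoD[OF p0 open_e_image] imageI[of 0 "ball 0 \<rho>" e] e_zero \<rho>(1) by simp
  define z where "z = (\<lambda>n. SOME z. norm z < \<rho> \<and> e z = p n \<and> norm (p n - z) \<le> 8 * L * norm (p n) * norm (p n))"
  have z: "norm (z n) < \<rho> \<and> e (z n) = p n \<and> norm (p n - z n) \<le> 8 * L * norm (p n) * norm (p n)"
    if "p n \<in> e ` ball 0 \<rho>" for n
    unfolding z_def by (rule someI_ex[OF e_log[OF that]])
  have nz: "(\<lambda>n. real n *\<^sub>R z n) \<longlonglongrightarrow> u + v"
  proof -
    have "(\<lambda>n. real n *\<^sub>R (p n - z n)) \<longlonglongrightarrow> 0"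
    proof (rule Lim_null_comparison)
      show "\<forall>\<^sub>F n in sequentially. norm (real n *\<^sub>R (p n - z n)) \<le> 8 * L * norm (real n *\<^sub>R p n) * norm (p n)"
        using p_in
      proof eventually_elim
        case (elim n)
        have "real n * norm (p n - z n) \<le> real n * (8 * L * norm (p n) * norm (p n))"
          using z[OF elim] by (intro mult_left_mono) auto
        then show ?case by (simp add: mult_ac)
      qed
      have "(\<lambda>n. 8 * L * norm (real n *\<^sub>R p n) * norm (p n)) \<longlonglongrightarrow> 8 * L * norm (u + v) * norm (0::'e)"
        by (intro tendsto_intros np p0)
      then show "(\<lambda>n. 8 * L * norm (real n *\<^sub>R p n) * norm (p n)) \<longlonglongrightarrow> 0" by simp
    qed
    from tendsto_diff[OF np this] show ?thesis by (simp add: algebra_simps)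
  qed
  have "\<forall>\<^sub>F n in sequentially. E (real n *\<^sub>R z n) = (E ((1 / real n) *\<^sub>R u) \<otimes> E ((1 / real n) *\<^sub>R v)) [^] n"
    using p_in small[of u] small[of v]
  proof eventually_elim
    case (elim n)
    have "E (z n) = \<iota> (p n)" using z[OF elim(1)] E_small by auto
    also have "\<dots> = E ((1 / real n) *\<^sub>R u) \<otimes> E ((1 / real n) *\<^sub>R v)"
      unfolding p_def a_def b_def E_small[OF elim(2)] E_small[OF elim(3)]
      by (rule \<iota>_m[OF in_D[OF e_in_ball[OF elim(2)] e_in_ball[OF elim(3)]]])
    finally show ?case using E_power[of "z n" n] by simp
  qed
  moreover have "limitin T (\<lambda>n. E (real n *\<^sub>R z n)) (E (u + v)) sequentially"
    using nz by (simp only: limitin_E_iff)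
  ultimately show ?thesis by (rule limitin_transform_eventually)
qed

lemma Ad_scale: "g \<in> carrier G \<Longrightarrow> Ad g (s *\<^sub>R v) = s *\<^sub>R Ad g v"
  using Ad[of g 1 "s *\<^sub>R v"] Ad[of g s v] by (simp add: E_inject)

end

section \<open>Rota-Baxter operators\<close>

locale rota_baxter_lie_Q_group = lie_Q_group G T A U \<phi> R L
  for G :: "('p, 'm) monoid_scheme" (structure) and T :: "'p topology"
    and A :: "('p, 'e::euclidean_space) chart set" and U :: "'p set" and \<phi> :: "'p \<Rightarrow> 'e"
    and R L :: real +
  fixes \<BB> :: "'p \<Rightarrow> 'p"
  assumes RB: "rota_baxter_operator_limit_weight_zero G T \<BB>" and \<BB>_smooth: "smooth_map T A T A \<BB>"
begin

lemma \<BB>_carrier [simp]: "a \<in> carrier G \<Longrightarrow> \<BB> a \<in> carrier G"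
  using RB by (auto simp: rota_baxter_operator_limit_weight_zero_def)

text \<open>The sequence in the Rota-Baxter condition is that of the product formula for \<open>u\<close> and \<open>Ad(g) v\<close>,
  because conjugation by \<open>g\<close> maps \<open>E(v/n)\<close> to \<open>E(Ad(g) v/n)\<close>.\<close>

lemma rota_baxter_identity: "\<BB> (E u) \<otimes> \<BB> (E v) = \<BB> (E (u + Ad (\<BB> (E u)) v))"
proof -
  define g where "g = \<BB> (E u)"
  have g: "g \<in> carrier G" by (simp add: g_def)
  obtain l where l: "unique_limit T (\<lambda>n. (group_root G (int n) (E u) \<otimes> g \<otimes> group_root G (int n) (E v) \<otimes> inv g) [^] n) l"
    "\<BB> (E u) \<otimes> \<BB> (E v) = \<BB> l"
    using RB E_carrier[of u] E_carrier[of v] unfolding rota_baxter_operator_limit_weight_zero_def g_def by blast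
  have "\<forall>\<^sub>F n in sequentially. (E ((1 / real n) *\<^sub>R u) \<otimes> E ((1 / real n) *\<^sub>R Ad g v)) [^] n
     = (group_root G (int n) (E u) \<otimes> g \<otimes> group_root G (int n) (E v) \<otimes> inv g) [^] n"
    using eventually_ge_at_top[of 1]
  proof eventually_elim
    case (elim n)
    have "E ((1 / real n) *\<^sub>R u) \<otimes> E ((1 / real n) *\<^sub>R Ad g v)
        = E ((1 / real n) *\<^sub>R u) \<otimes> (g \<otimes> E ((1 / real n) *\<^sub>R v) \<otimes> inv g)"
      by (simp only: Ad[OF g])
    also have "\<dots> = E ((1 / real n) *\<^sub>R u) \<otimes> g \<otimes> E ((1 / real n) *\<^sub>R v) \<otimes> inv g"
      using g by (simp only: m_assoc m_closed inv_closed E_carrier)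
    finally show ?case by (simp only: root_E[OF elim])
  qed
  from limitin_transform_eventually[OF this trotter]
  have "E (u + Ad g v) = l" using l(1) by (auto simp: unique_limit_def)
  then show ?thesis using l(2) by (simp add: g_def)
qed

text \<open>At \<open>u = v = 0\<close> the Rota-Baxter identity says that \<open>\<BB>(1)\<close> is idempotent.\<close>

lemma \<BB>_one: "\<BB> \<one> = \<one>"
proof -
  have "E (Ad (\<BB> \<one>) 0) = E 0"
    using Ad[of "\<BB> \<one>" 1 0] by (simp add: E_zero)
  then have "Ad (\<BB> \<one>) 0 = 0" by (simp only: E_inject)
  then have "\<BB> \<one> \<otimes> \<BB> \<one> = \<BB> \<one>" using rota_baxter_identity[of 0 0] by (simp add: E_zero)
  then show ?thesis using l_cancel_one[of "\<BB> \<one>" "\<BB> \<one>"] by simp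
qed

definition b :: "'e \<Rightarrow> 'e" where "b x = \<kappa> (\<BB> (\<iota> x))"

definition dom_b :: "'e set" where "dom_b = {x \<in> \<Omega>. \<BB> (\<iota> x) \<in> U}"

definition B' :: "'e \<Rightarrow> 'e" where "B' = frechet_derivative b (at 0)"

lemma \<BB>\<iota>_smooth: "smooth_into \<Omega> T A (\<lambda>x. \<BB> (\<iota> x))"
  by (rule smooth_into_map[OF \<iota>_smooth open_\<Omega> \<BB>_smooth charted])

lemma open_dom_b: "open dom_b"
  unfolding dom_b_def by (rule continuous_preimage_open[OF smooth_into_continuous[OF \<BB>\<iota>_smooth] open_\<Omega> chart_open[OF U]])

lemma zero_dom_b: "0 \<in> dom_b"
  using zero_\<Omega> p by (simp add: dom_b_def \<iota>_zero \<BB>_one)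

lemma b_zero: "b 0 = 0"
  by (simp add: b_def \<iota>_zero \<BB>_one \<kappa>_p)

lemma b_smooth: "smooth_on dom_b b"
  unfolding b_def
  by (rule \<kappa>_smooth_into[OF smooth_into_subset[OF \<BB>\<iota>_smooth open_\<Omega> open_dom_b] open_dom_b]) (auto simp: dom_b_def)

lemma b_derivative: "(b has_derivative B') (at 0)"
  unfolding B'_def by (rule smooth_on_has_derivative[OF b_smooth open_dom_b zero_dom_b])

lemma B'_linear: "linear B'"
  by (rule has_derivative_linear[OF b_derivative])

lemma \<iota>_b: "x \<in> dom_b \<Longrightarrow> \<iota> (b x) = \<BB> (\<iota> x)"
  by (simp add: b_def dom_b_def \<iota>_\<kappa>)

lemma b_\<Omega>: "x \<in> dom_b \<Longrightarrow> b x \<in> \<Omega>"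
  by (simp add: b_def dom_b_def \<kappa>_in_\<Omega>)

lemma tangent_map_tan: "tangent_map T A T A \<BB> \<one> (tan w) = tan (B' w)"
proof
  fix f
  show "tangent_map T A T A \<BB> \<one> (tan w) f = tan (B' w) f"
  proof (cases "smooth_near T A \<one> f")
    case True
    obtain N where N: "open N" "0 \<in> N" "N \<subseteq> \<Omega>" "smooth_on N (\<lambda>x. f (\<iota> x))"
      using True smooth_near_p_iff by blast
    define M where "M = dom_b \<inter> b -` N"
    have M: "open M" unfolding M_def
      by (rule continuous_open_preimage[OF smooth_on_continuous_on[OF b_smooth] open_dom_b N(1)])
    have M0: "0 \<in> M" using zero_dom_b N(2) by (simp add: M_def b_zero)
    have fb: "f (\<iota> (b x)) = (f \<circ> \<BB>) (\<iota> x)" if "x \<in> M" for x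
      using that \<iota>_b by (simp add: M_def)
    have "smooth_on M b" by (rule smooth_on_mono[OF b_smooth open_dom_b M]) (simp add: M_def)
    from smooth_on_compose[OF N(4) this M N(1)] have "smooth_on M (\<lambda>x. f (\<iota> (b x)))" by (simp add: M_def)
    then have "smooth_on M (\<lambda>x. (f \<circ> \<BB>) (\<iota> x))" by (rule smooth_on_cong_imp) (rule fb)
    then have near: "smooth_near T A \<one> (f \<circ> \<BB>)"
      unfolding smooth_near_p_iff using M M0 by (intro exI[of _ M]) (auto simp: M_def dom_b_def)
    have f': "((\<lambda>x. f (\<iota> x)) has_derivative (\<lambda>w. tan w f)) (at (b 0))"
      using smooth_near_derivative[OF True] by (simp add: b_zero)
    have "((\<lambda>x. (f \<circ> \<BB>) (\<iota> x)) has_derivative (\<lambda>w. tan (B' w) f)) (at 0)"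
      by (rule has_derivative_transform_within_open[OF has_derivative_compose[OF b_derivative f'] M M0 fb])
    from tan_eq[OF near this, of w] True show ?thesis unfolding tangent_map_def \<BB>_one by presburger
  qed (simp add: tangent_map_def \<BB>_one tan_not_smooth)
qed

text \<open>The operator in exponential coordinates on its domain and chart coordinates on its range.\<close>

definition h :: "'e \<Rightarrow> 'e" where "h w = b (e w)"

lemma h_zero: "h 0 = 0"
  by (simp add: h_def e_zero b_zero)

text \<open>Strict differentiability is preserved by composition: compare with \<open>e u - e v\<close> in between.\<close>

lemma h_strict:
  assumes "\<epsilon> > 0"
  shows "\<exists>\<delta>>0. \<forall>u v. norm u < \<delta> \<longrightarrow> norm v < \<delta> \<longrightarrow> norm (h u - h v - B' (u - v)) \<le> \<epsilon> * norm (u - v)"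
proof -
  obtain K where K: "K > 0" "\<And>w. norm (B' w) \<le> norm w * K"
    using bounded_linear.pos_bounded[OF has_derivative_bounded_linear[OF b_derivative]] by blast
  obtain d where d: "d > 0" "\<And>p q. p \<in> ball 0 d \<Longrightarrow> q \<in> ball 0 d \<Longrightarrow> norm (b p - b q - B' (p - q)) \<le> (\<epsilon> / 4) * norm (p - q)"
    using smooth_on_strict_derivative[OF b_smooth open_dom_b zero_dom_b, of "\<epsilon> / 4"] assms unfolding B'_def[symmetric] by auto
  define \<delta> where "\<delta> = min (min \<rho> (d / 2)) (\<epsilon> / (8 * L * K))"
  have \<delta>: "\<delta> > 0" using \<rho>(1) d(1) assms L_pos K(1) by (simp add: \<delta>_def)
  have "norm (h u - h v - B' (u - v)) \<le> \<epsilon> * norm (u - v)" if u: "norm u < \<delta>" and v: "norm v < \<delta>" for u v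
  proof -
    have u': "norm u < \<rho>" "2 * norm u < d" and v': "norm v < \<rho>" "2 * norm v < d" using u v by (auto simp: \<delta>_def)
    have "norm (e u - e v - (u - v)) \<le> (1 / 4) * norm (u - v)" by (rule e_expand[OF u'(1) v'(1)])
    then have "norm (e u - e v) \<le> 2 * norm (u - v)"
      using norm_triangle_sub[of "e u - e v" "u - v"] norm_ge_zero[of "u - v"] by argo
    then have "(\<epsilon> / 4) * norm (e u - e v) \<le> (\<epsilon> / 4) * (2 * norm (u - v))" using assms by (intro mult_left_mono) auto
    moreover have "e u \<in> ball 0 d" "e v \<in> ball 0 d" using e_norm[OF u'(1)] e_norm[OF v'(1)] u' v' by auto
    ultimately have 1: "norm (h u - h v - B' (e u - e v)) \<le> (\<epsilon> / 2) * norm (u - v)"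
      using d(2)[of "e u" "e v"] by (simp add: h_def)
    have "norm (e u - e v - (u - v)) \<le> 4 * L * \<delta> * norm (u - v)" using u v u' v' by (intro e_strict) auto
    then have "norm (e u - e v - (u - v)) * K \<le> 4 * L * \<delta> * norm (u - v) * K" using K(1) by (intro mult_right_mono) auto
    also have "\<dots> = (4 * L * K * \<delta>) * norm (u - v)" by simp
    also have "\<dots> \<le> (\<epsilon> / 2) * norm (u - v)"
    proof (rule mult_right_mono)
      have "\<delta> \<le> \<epsilon> / (8 * L * K)" by (simp add: \<delta>_def)
      then have "(8 * L * K) * \<delta> \<le> \<epsilon>" using L_pos K(1) by (simp add: pos_le_divide_eq mult.commute)
      then show "4 * L * K * \<delta> \<le> \<epsilon> / 2" by simp
    qed simp
    finally have 2: "norm (B' (e u - e v - (u - v))) \<le> (\<epsilon> / 2) * norm (u - v)" using K(2) order_trans by blast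
    have "h u - h v - B' (u - v) = (h u - h v - B' (e u - e v)) + B' (e u - e v - (u - v))"
      by (simp add: linear_diff[OF B'_linear])
    also have "norm \<dots> \<le> (\<epsilon> / 2) * norm (u - v) + (\<epsilon> / 2) * norm (u - v)" by (rule norm_triangle_mono[OF 1 2])
    finally show ?thesis by (simp add: field_simps)
  qed
  then show ?thesis using \<delta> by blast
qed

abbreviation br :: "'e \<Rightarrow> 'e \<Rightarrow> 'e" where "br x y \<equiv> \<beta> x y - \<beta> y x"

text \<open>Replace \<open>u\<close> and \<open>v\<close> by \<open>su\<close> and \<open>sv\<close>, and let \<open>W u v s\<close> be the argument on the right-hand side of
  the Rota-Baxter identity, so that \<open>h (W u v s) = m(h(su), h(sv))\<close>. The quotient
  \<open>(h (W u v s) - h (W v u s)) / s\<^sup>2\<close> has two limits: the second-order expansion of \<open>m\<close> gives the bracket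
  on the left, and strict differentiability of \<open>h\<close> gives \<open>B\<close> applied to the limit of
  \<open>(W u v s - W v u s) / s\<^sup>2\<close>.\<close>

lemma coordinate_rota_baxter: "br (B' u) (B' v) = B' (br (B' u) v - br (B' v) u)"
proof -
  interpret \<beta>: bounded_bilinear \<beta> by (rule \<beta>_bilinear)
  define c where "c = (\<lambda>w s. h (s *\<^sub>R w))"
  define W where "W = (\<lambda>u v s. s *\<^sub>R (u + Ad (\<BB> (E (s *\<^sub>R u))) v))"
  have h': "((\<lambda>s. (1 / s) *\<^sub>R c w s) \<longlongrightarrow> B' w) (at_right 0)" for w
  proof -
    have "((\<lambda>s. e (s *\<^sub>R w)) has_derivative (\<lambda>s. s *\<^sub>R w)) (at 0)"
      using e_has_vector_derivative by (simp add: has_vector_derivative_def)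
    from has_derivative_compose[OF this, of b B'] b_derivative
    have "((\<lambda>s. c w s) has_derivative (\<lambda>s. B' (s *\<^sub>R w))) (at 0)" by (simp add: e_zero c_def h_def)
    then have "((\<lambda>s. c w s) has_vector_derivative B' w) (at 0)"
      by (simp add: has_vector_derivative_def linear_scale[OF B'_linear])
    from has_vector_derivative_quotient[OF this]
    have "((\<lambda>s. (1 / s) *\<^sub>R c w s) \<longlongrightarrow> B' w) (at 0)" by (simp add: c_def h_zero)
    then show ?thesis by (rule tendsto_within_subset) simp
  qed
  have id0: "((\<lambda>s::real. s) \<longlongrightarrow> 0) (at_right 0)" by (rule tendsto_ident_at)
  have pos: "\<forall>\<^sub>F s::real in at_right 0. s > 0" by (rule eventually_at_right_less)
  have c0: "((\<lambda>s. c w s) \<longlongrightarrow> 0) (at_right 0)" for w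
  proof -
    have "((\<lambda>s. s *\<^sub>R ((1 / s) *\<^sub>R c w s)) \<longlongrightarrow> 0 *\<^sub>R B' w) (at_right 0)" by (intro tendsto_scaleR id0 h')
    then have "((\<lambda>s. s *\<^sub>R ((1 / s) *\<^sub>R c w s)) \<longlongrightarrow> 0) (at_right 0)" by simp
    then show ?thesis
      by (rule Lim_transform_eventually) (use pos in \<open>eventually_elim, simp\<close>)
  qed
  have small: "\<forall>\<^sub>F s in at_right 0. norm (s *\<^sub>R w) < r" if "r > 0" for w :: 'e and r
  proof -
    have "((\<lambda>s. norm (s *\<^sub>R w)) \<longlongrightarrow> norm (0 *\<^sub>R w)) (at_right 0)" by (intro tendsto_intros id0)
    then show ?thesis using order_tendstoD(2)[of _ "norm (0 *\<^sub>R w)" "at_right 0" r] that by simp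
  qed
  have dom: "\<forall>\<^sub>F s in at_right 0. norm (s *\<^sub>R w) < \<rho> \<and> e (s *\<^sub>R w) \<in> dom_b" for w
  proof -
    have "((\<lambda>s. e (s *\<^sub>R w)) \<longlongrightarrow> 0) (at 0)"
      using has_vector_derivative_continuous[OF e_has_vector_derivative[of w]] by (simp add: continuous_at e_zero)
    then have "((\<lambda>s. e (s *\<^sub>R w)) \<longlongrightarrow> 0) (at_right 0)" by (rule tendsto_within_subset) simp
    from topological_tendstoD[OF this open_dom_b zero_dom_b] small[OF \<rho>(1), of w]
    show ?thesis by eventually_elim simp
  qed
  have \<BB>_c: "\<BB> (E (s *\<^sub>R w)) = \<iota> (c w s) \<and> c w s \<in> \<Omega>" if "norm (s *\<^sub>R w) < \<rho> \<and> e (s *\<^sub>R w) \<in> dom_b" for s w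
    using that E_small[of "s *\<^sub>R w"] \<iota>_b b_\<Omega> by (simp add: c_def h_def)
  have Ad_lim: "((\<lambda>s. (1 / s) *\<^sub>R (Ad (\<BB> (E (s *\<^sub>R u))) v - v)) \<longlongrightarrow> br (B' u) v) (at_right 0)" for u v
  proof -
    have "((\<lambda>s. (1 / s) *\<^sub>R (Ad (\<iota> (c u s)) v - v - br (c u s) v)) \<longlongrightarrow> 0) (at_right 0)"
    proof (rule tendsto_null_of_little_o[OF _ h'[of u]])
      fix \<epsilon> :: real assume "\<epsilon> > 0"
      then obtain \<delta> where \<delta>: "\<delta> > 0" "\<And>x. norm x < \<delta> \<Longrightarrow> norm (Ad (\<iota> x) v - v - br x v) \<le> \<epsilon> * norm x"
        using Ad_derivative[of \<epsilon> v] by blast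
      have "\<forall>\<^sub>F s in at_right 0. norm (c u s) < \<delta>"
        using order_tendstoD(2)[OF tendsto_norm[OF c0[of u]], of \<delta>] \<delta>(1) by simp
      then show "\<forall>\<^sub>F s in at_right 0. norm ((1 / s) *\<^sub>R (Ad (\<iota> (c u s)) v - v - br (c u s) v)) \<le> \<epsilon> * norm ((1 / s) *\<^sub>R c u s)"
        using pos
      proof eventually_elim
        case (elim s)
        have "(1 / s) * norm (Ad (\<iota> (c u s)) v - v - br (c u s) v) \<le> (1 / s) * (\<epsilon> * norm (c u s))"
          using elim \<delta>(2) by (intro mult_left_mono) auto
        with elim show ?case unfolding norm_scaleR by (simp add: mult_ac)
      qed
    qed
    moreover have "((\<lambda>s. br ((1 / s) *\<^sub>R c u s) v) \<longlongrightarrow> br (B' u) v) (at_right 0)"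
      by (intro tendsto_intros \<beta>.tendsto h')
    ultimately have "((\<lambda>s. (1 / s) *\<^sub>R (Ad (\<iota> (c u s)) v - v - br (c u s) v) + br ((1 / s) *\<^sub>R c u s) v) \<longlongrightarrow> 0 + br (B' u) v) (at_right 0)"
      by (rule tendsto_add)
    then have "((\<lambda>s. (1 / s) *\<^sub>R (Ad (\<iota> (c u s)) v - v)) \<longlongrightarrow> br (B' u) v) (at_right 0)"
      by (simp add: \<beta>.scaleR_left \<beta>.scaleR_right scaleR_diff_right)
    then show ?thesis
      by (rule Lim_transform_eventually) (use dom[of u] in \<open>eventually_elim, simp add: \<BB>_c\<close>)
  qed
  have W0: "((\<lambda>s. W u v s) \<longlongrightarrow> 0) (at_right 0)" for u v
  proof -
    have "((\<lambda>s. s *\<^sub>R (u + (s *\<^sub>R ((1 / s) *\<^sub>R (Ad (\<BB> (E (s *\<^sub>R u))) v - v)) + v))) \<longlongrightarrow> 0 *\<^sub>R (u + (0 *\<^sub>R br (B' u) v + v))) (at_right 0)"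
      by (intro tendsto_intros id0 Ad_lim)
    then have "((\<lambda>s. s *\<^sub>R (u + (s *\<^sub>R ((1 / s) *\<^sub>R (Ad (\<BB> (E (s *\<^sub>R u))) v - v)) + v))) \<longlongrightarrow> 0) (at_right 0)" by simp
    then show ?thesis
      by (rule Lim_transform_eventually) (use pos in \<open>eventually_elim, simp add: W_def\<close>)
  qed
  have W_diff: "((\<lambda>s. (1 / s\<^sup>2) *\<^sub>R (W u v s - W v u s)) \<longlongrightarrow> br (B' u) v - br (B' v) u) (at_right 0)"
  proof (rule Lim_transform_eventually[OF tendsto_diff[OF Ad_lim[of u v] Ad_lim[of v u]]])
    show "\<forall>\<^sub>F s in at_right 0. (1 / s) *\<^sub>R (Ad (\<BB> (E (s *\<^sub>R u))) v - v) - (1 / s) *\<^sub>R (Ad (\<BB> (E (s *\<^sub>R v))) u - u)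
        = (1 / s\<^sup>2) *\<^sub>R (W u v s - W v u s)"
      using pos
    proof eventually_elim
      case (elim s)
      have "W u v s - W v u s = s *\<^sub>R ((Ad (\<BB> (E (s *\<^sub>R u))) v - v) - (Ad (\<BB> (E (s *\<^sub>R v))) u - u))"
        by (simp add: W_def algebra_simps)
      then show ?case using elim by (simp add: power2_eq_square scaleR_diff_right)
    qed
  qed
  have hW: "\<forall>\<^sub>F s in at_right 0. h (W u v s) = m (c u s, c v s)" for u v
  proof -
    have "\<forall>\<^sub>F s in at_right 0. norm (W u v s) < \<rho>"
      using order_tendstoD(2)[OF tendsto_norm[OF W0[of u v]], of \<rho>] \<rho>(1) by simp
    then show ?thesis using dom[of u] dom[of v]
    proof eventually_elim
      case (elim s)
      have "\<BB> (E (s *\<^sub>R u)) \<otimes> \<BB> (E (s *\<^sub>R v)) = \<BB> (E (W u v s))"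
        using rota_baxter_identity[of "s *\<^sub>R u" "s *\<^sub>R v"] by (simp add: W_def Ad_scale scaleR_add_right)
      then have "\<kappa> (\<iota> (c u s) \<otimes> \<iota> (c v s)) = \<kappa> (\<BB> (E (W u v s)))"
        using \<BB>_c[OF elim(2)] \<BB>_c[OF elim(3)] by simp
      then show ?case by (simp add: m_def h_def b_def E_small[OF elim(1)])
    qed
  qed
  have lhs: "((\<lambda>s. (1 / s\<^sup>2) *\<^sub>R (h (W u v s) - h (W v u s))) \<longlongrightarrow> br (B' u) (B' v)) (at_right 0)"
  proof -
    have rem: "((\<lambda>s. (1 / s\<^sup>2) *\<^sub>R (m (c u s, c v s) - c u s - c v s - \<beta> (c u s) (c v s))) \<longlongrightarrow> 0) (at_right 0)" for u v
    proof (rule tendsto_null_of_little_o)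
      show "((\<lambda>s. norm ((1 / s) *\<^sub>R c u s) * norm ((1 / s) *\<^sub>R c v s)) \<longlongrightarrow> norm (B' u) * norm (B' v)) (at_right 0)"
        by (intro tendsto_intros h')
      fix \<epsilon> :: real assume "\<epsilon> > 0"
      then obtain \<delta> where \<delta>: "\<delta> > 0" "\<And>x y. x \<in> ball 0 \<delta> \<Longrightarrow> y \<in> ball 0 \<delta> \<Longrightarrow>
          norm (m (x, y) - x - y - \<beta> x y) \<le> \<epsilon> * norm x * norm y"
        using m_second_order[of \<epsilon>] by blast
      have sm: "\<forall>\<^sub>F s in at_right 0. norm (c w s) < \<delta>" for w
        using order_tendstoD(2)[OF tendsto_norm[OF c0[of w]], of \<delta>] \<delta>(1) by simp
      show "\<forall>\<^sub>F s in at_right 0. norm ((1 / s\<^sup>2) *\<^sub>R (m (c u s, c v s) - c u s - c v s - \<beta> (c u s) (c v s)))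
          \<le> \<epsilon> * norm (norm ((1 / s) *\<^sub>R c u s) * norm ((1 / s) *\<^sub>R c v s))"
        using sm[of u] sm[of v] pos
      proof eventually_elim
        case (elim s)
        have "(1 / s\<^sup>2) * norm (m (c u s, c v s) - c u s - c v s - \<beta> (c u s) (c v s))
            \<le> (1 / s\<^sup>2) * (\<epsilon> * norm (c u s) * norm (c v s))"
          using elim \<delta>(2) by (intro mult_left_mono) auto
        with elim show ?case unfolding norm_scaleR by (simp add: power2_eq_square mult_ac abs_mult)
      qed
    qed
    have "((\<lambda>s. (1 / s\<^sup>2) *\<^sub>R (m (c u s, c v s) - c u s - c v s - \<beta> (c u s) (c v s))
        - (1 / s\<^sup>2) *\<^sub>R (m (c v s, c u s) - c v s - c u s - \<beta> (c v s) (c u s))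
        + br ((1 / s) *\<^sub>R c u s) ((1 / s) *\<^sub>R c v s)) \<longlongrightarrow> 0 - 0 + br (B' u) (B' v)) (at_right 0)"
      by (intro tendsto_intros rem \<beta>.tendsto h')
    then have "((\<lambda>s. (1 / s\<^sup>2) *\<^sub>R (m (c u s, c v s) - c u s - c v s - \<beta> (c u s) (c v s))
        - (1 / s\<^sup>2) *\<^sub>R (m (c v s, c u s) - c v s - c u s - \<beta> (c v s) (c u s))
        + br ((1 / s) *\<^sub>R c u s) ((1 / s) *\<^sub>R c v s)) \<longlongrightarrow> br (B' u) (B' v)) (at_right 0)" by simp
    then show ?thesis
    proof (rule Lim_transform_eventually)
      show "\<forall>\<^sub>F s in at_right 0. (1 / s\<^sup>2) *\<^sub>R (m (c u s, c v s) - c u s - c v s - \<beta> (c u s) (c v s))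
        - (1 / s\<^sup>2) *\<^sub>R (m (c v s, c u s) - c v s - c u s - \<beta> (c v s) (c u s))
        + br ((1 / s) *\<^sub>R c u s) ((1 / s) *\<^sub>R c v s) = (1 / s\<^sup>2) *\<^sub>R (h (W u v s) - h (W v u s))"
        using hW[of u v] hW[of v u]
      proof eventually_elim
        case (elim s)
        show ?case unfolding elim
          by (simp add: \<beta>.scaleR_left \<beta>.scaleR_right power2_eq_square algebra_simps)
      qed
    qed
  qed
  have rem: "((\<lambda>s. (1 / s\<^sup>2) *\<^sub>R (h (W u v s) - h (W v u s) - B' (W u v s - W v u s))) \<longlongrightarrow> 0) (at_right 0)"
  proof (rule tendsto_null_of_little_o[OF _ W_diff])
    fix \<epsilon> :: real assume "\<epsilon> > 0"
    then obtain \<delta> where \<delta>: "\<delta> > 0" "\<And>u v. norm u < \<delta> \<Longrightarrow> norm v < \<delta> \<Longrightarrow> norm (h u - h v - B' (u - v)) \<le> \<epsilon> * norm (u - v)"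
      using h_strict[of \<epsilon>] by blast
    have sm: "\<forall>\<^sub>F s in at_right 0. norm (W u v s) < \<delta>" for u v
      using order_tendstoD(2)[OF tendsto_norm[OF W0[of u v]], of \<delta>] \<delta>(1) by simp
    show "\<forall>\<^sub>F s in at_right 0. norm ((1 / s\<^sup>2) *\<^sub>R (h (W u v s) - h (W v u s) - B' (W u v s - W v u s)))
        \<le> \<epsilon> * norm ((1 / s\<^sup>2) *\<^sub>R (W u v s - W v u s))"
      using sm[of u v] sm[of v u]
    proof eventually_elim
      case (elim s)
      have "(1 / s\<^sup>2) * norm (h (W u v s) - h (W v u s) - B' (W u v s - W v u s)) \<le> (1 / s\<^sup>2) * (\<epsilon> * norm (W u v s - W v u s))"
        using elim \<delta>(2) by (intro mult_left_mono) auto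
      then show ?case unfolding norm_scaleR by (simp add: mult_ac)
    qed
  qed
  have combine: "(1 / s\<^sup>2) *\<^sub>R (x - B' y) + B' ((1 / s\<^sup>2) *\<^sub>R y) = (1 / s\<^sup>2) *\<^sub>R x" for s :: real and x y
    by (subst linear_scale[OF B'_linear]) (simp add: scaleR_diff_right)
  have lin: "((\<lambda>s. B' ((1 / s\<^sup>2) *\<^sub>R (W u v s - W v u s))) \<longlongrightarrow> B' (br (B' u) v - br (B' v) u)) (at_right 0)"
    by (rule bounded_linear.tendsto[OF has_derivative_bounded_linear[OF b_derivative] W_diff])
  have "((\<lambda>s. (1 / s\<^sup>2) *\<^sub>R (h (W u v s) - h (W v u s) - B' (W u v s - W v u s)) + B' ((1 / s\<^sup>2) *\<^sub>R (W u v s - W v u s)))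
      \<longlongrightarrow> 0 + B' (br (B' u) v - br (B' v) u)) (at_right 0)" by (rule tendsto_add[OF rem lin])
  then have "((\<lambda>s. (1 / s\<^sup>2) *\<^sub>R (h (W u v s) - h (W v u s))) \<longlongrightarrow> B' (br (B' u) v - br (B' v) u)) (at_right 0)"
    by (simp only: combine add_0)
  from tendsto_unique[OF trivial_limit_at_right_real lhs this] show ?thesis .
qed

lemma rota_baxter_bracket:
  defines "\<B> \<equiv> tangent_map T A T A \<BB> \<one>" and "bracket \<equiv> lie_bracket G T A"
  shows "bracket (\<B> (tan u)) (\<B> (tan v)) = \<B> (bracket (\<B> (tan u)) (tan v) + bracket (tan u) (\<B> (tan v)))"
proof -
  have "br (B' u) (B' v) = B' (br (B' u) v + br u (B' v))"
    using coordinate_rota_baxter[of u v] by (simp add: algebra_simps)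
  then show ?thesis
    by (simp only: \<B>_def bracket_def tangent_map_tan lie_bracket_tan linear_add[OF tan_linear, symmetric])
qed

theorem rota_baxter_lie_algebra:
  defines "\<B> \<equiv> tangent_map T A T A \<BB> \<one>" and "bracket \<equiv> lie_bracket G T A"
  shows "rota_baxter_lie_algebra_limit_weight (range tan) bracket X
           (\<lambda>n u. (1 / real n) *\<^sub>R u) (\<lambda>n u. real n *\<^sub>R u) \<B>"
    and "rota_baxter_lie_algebra_weight_zero (range tan) bracket \<B>"
proof -
  interpret \<beta>: bounded_bilinear \<beta> by (rule \<beta>_bilinear)
  have \<B>: "\<B> (tan u) = tan (B' u)" for u by (simp add: \<B>_def tangent_map_tan)
  have bracket: "bracket (tan u) (tan v) = tan (br u v)" for u v by (simp add: bracket_def lie_bracket_tan)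
  have scale: "c *\<^sub>R tan u = tan (c *\<^sub>R u)" for c u by (simp add: linear_scale[OF tan_linear])
  have add: "tan u + tan v = tan (u + v)" for u v by (simp add: linear_add[OF tan_linear])
  have br_scale: "br (c *\<^sub>R u) v = c *\<^sub>R br u v" "br u (c *\<^sub>R v) = c *\<^sub>R br u v" for c u v
    by (simp_all add: \<beta>.scaleR_left \<beta>.scaleR_right scaleR_diff_right)
  have lie: "lie_algebra_on (range tan) bracket"
    unfolding bracket_def by (rule lie_algebra)
  have lin_\<B>: "linear_endo_on (range tan) \<B>"
    unfolding linear_endo_on_def
    by (auto simp: \<B> add scale linear_add[OF B'_linear] linear_scale[OF B'_linear])
  have lin_scale: "linear_endo_on (range tan) (\<lambda>u. c *\<^sub>R u)" for c :: real
    unfolding linear_endo_on_def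
    by (auto simp: add scale tan_inject scaleR_add_right)
  have inv_n: "(\<lambda>n. 1 / real n) \<longlonglongrightarrow> 0" by (rule lim_1_over_n)
  have sync: "synchronized X (\<lambda>n u v. real n *\<^sub>R bracket ((1 / real n) *\<^sub>R u) ((1 / real n) *\<^sub>R v))"
    unfolding synchronized_def
  proof (intro ballI)
    fix a b assume "a \<in> topspace X" "b \<in> topspace X"
    then obtain u v where ab: "a = tan u" "b = tan v" by (auto simp: topspace_X)
    have lim: "unique_limit X (\<lambda>n. real n *\<^sub>R bracket ((1 / real n) *\<^sub>R tan (x n)) ((1 / real n) *\<^sub>R tan (y n))) (tan 0)"
      if x: "x \<longlonglongrightarrow> u" and y: "y \<longlonglongrightarrow> v" for x y
    proof (rule unique_limit_X)
      have "(\<lambda>n. (1 / real n) *\<^sub>R br (x n) (y n)) \<longlonglongrightarrow> 0 *\<^sub>R br u v"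
        by (intro tendsto_intros inv_n \<beta>.tendsto x y)
      then show "(\<lambda>n. (1 / real n) *\<^sub>R br (x n) (y n)) \<longlonglongrightarrow> 0" by simp
      show "real n *\<^sub>R bracket ((1 / real n) *\<^sub>R tan (x n)) ((1 / real n) *\<^sub>R tan (y n)) = tan ((1 / real n) *\<^sub>R br (x n) (y n))"
        if "n \<ge> 1" for n
        using that by (simp only: scale bracket br_scale) simp
    qed
    show "\<exists>l. unique_limit X (\<lambda>n. real n *\<^sub>R bracket ((1 / real n) *\<^sub>R a) ((1 / real n) *\<^sub>R b)) l \<and>
       (\<forall>\<alpha> \<gamma>. range \<alpha> \<subseteq> topspace X \<longrightarrow> range \<gamma> \<subseteq> topspace X \<longrightarrow>
          limitin X \<alpha> a sequentially \<longrightarrow> limitin X \<gamma> b sequentially \<longrightarrow>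
          unique_limit X (\<lambda>n. real n *\<^sub>R bracket ((1 / real n) *\<^sub>R \<alpha> n) ((1 / real n) *\<^sub>R \<gamma> n)) l)"
    proof (intro exI[where x="tan 0"] conjI allI impI)
      show "unique_limit X (\<lambda>n. real n *\<^sub>R bracket ((1 / real n) *\<^sub>R a) ((1 / real n) *\<^sub>R b)) (tan 0)"
        unfolding ab by (intro lim tendsto_const)
      fix \<alpha> \<gamma> assume "range \<alpha> \<subseteq> topspace X" "range \<gamma> \<subseteq> topspace X"
        "limitin X \<alpha> a sequentially" "limitin X \<gamma> b sequentially"
      then obtain x y where x: "\<And>n. \<alpha> n = tan (x n)" "x \<longlonglongrightarrow> u" and y: "\<And>n. \<gamma> n = tan (y n)" "y \<longlonglongrightarrow> v"
        unfolding ab using X_sequence by metis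
      show "unique_limit X (\<lambda>n. real n *\<^sub>R bracket ((1 / real n) *\<^sub>R \<alpha> n) ((1 / real n) *\<^sub>R \<gamma> n)) (tan 0)"
        unfolding x(1) y(1) by (rule lim[OF x(2) y(2)])
    qed
  qed
  have cancel: "real n *\<^sub>R ((1 / real n) *\<^sub>R x + (1 / real n) *\<^sub>R y + (1 / real n) *\<^sub>R (1 / real n) *\<^sub>R z)
      = x + y + (1 / real n) *\<^sub>R z" if "n \<ge> 1" for n and x y z :: 'e
    using that by (simp add: scaleR_add_right)
  have limits: "\<exists>l. unique_limit X (\<lambda>n. real n *\<^sub>R bracket (\<B> u) ((1 / real n) *\<^sub>R v)) l"
    "\<exists>l. unique_limit X (\<lambda>n. real n *\<^sub>R (bracket (\<B> u) ((1 / real n) *\<^sub>R v) + bracket ((1 / real n) *\<^sub>R u) (\<B> v)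
       + bracket ((1 / real n) *\<^sub>R u) ((1 / real n) *\<^sub>R v))) l \<and> bracket (\<B> u) (\<B> v) = \<B> l"
    if uv: "u \<in> range tan" "v \<in> range tan" for u v
  proof -
    obtain x y where xy: "u = tan x" "v = tan y" using uv by auto
    have "unique_limit X (\<lambda>n. real n *\<^sub>R bracket (\<B> u) ((1 / real n) *\<^sub>R v)) (tan (br (B' x) y))"
    proof (rule unique_limit_X[OF tendsto_const])
      show "real n *\<^sub>R bracket (\<B> u) ((1 / real n) *\<^sub>R v) = tan (br (B' x) y)" if "n \<ge> 1" for n
        using that by (simp only: xy \<B> scale bracket br_scale) simp
    qed
    then show "\<exists>l. unique_limit X (\<lambda>n. real n *\<^sub>R bracket (\<B> u) ((1 / real n) *\<^sub>R v)) l"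
      by (intro exI[where x="tan (br (B' x) y)"])
    have "unique_limit X (\<lambda>n. real n *\<^sub>R (bracket (\<B> u) ((1 / real n) *\<^sub>R v) + bracket ((1 / real n) *\<^sub>R u) (\<B> v)
       + bracket ((1 / real n) *\<^sub>R u) ((1 / real n) *\<^sub>R v))) (tan (br (B' x) y + br x (B' y)))"
    proof (rule unique_limit_X)
      have "(\<lambda>n. (br (B' x) y + br x (B' y)) + (1 / real n) *\<^sub>R br x y) \<longlonglongrightarrow> (br (B' x) y + br x (B' y)) + 0 *\<^sub>R br x y"
        by (intro tendsto_intros inv_n)
      then show "(\<lambda>n. (br (B' x) y + br x (B' y)) + (1 / real n) *\<^sub>R br x y) \<longlonglongrightarrow> br (B' x) y + br x (B' y)" by simp
      show "real n *\<^sub>R (bracket (\<B> u) ((1 / real n) *\<^sub>R v) + bracket ((1 / real n) *\<^sub>R u) (\<B> v)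
         + bracket ((1 / real n) *\<^sub>R u) ((1 / real n) *\<^sub>R v)) = tan ((br (B' x) y + br x (B' y)) + (1 / real n) *\<^sub>R br x y)"
        if "n \<ge> 1" for n
        by (simp only: xy \<B> scale bracket br_scale add cancel[OF that])
    qed
    moreover have "bracket (\<B> u) (\<B> v) = \<B> (tan (br (B' x) y + br x (B' y)))"
      using rota_baxter_bracket[of x y] unfolding \<B>_def[symmetric] bracket_def[symmetric] xy \<B> bracket add .
    ultimately show "\<exists>l. unique_limit X (\<lambda>n. real n *\<^sub>R (bracket (\<B> u) ((1 / real n) *\<^sub>R v) + bracket ((1 / real n) *\<^sub>R u) (\<B> v)
       + bracket ((1 / real n) *\<^sub>R u) ((1 / real n) *\<^sub>R v))) l \<and> bracket (\<B> u) (\<B> v) = \<B> l"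
      by (intro exI[where x="tan (br (B' x) y + br x (B' y))"] conjI)
  qed
  have inverse: "(1 / real n) *\<^sub>R real n *\<^sub>R u = u" if "n \<ge> 1" "u \<in> range tan" for n u
    using that by (auto simp: scale)
  show "rota_baxter_lie_algebra_limit_weight (range tan) bracket X
           (\<lambda>n u. (1 / real n) *\<^sub>R u) (\<lambda>n u. real n *\<^sub>R u) \<B>"
    unfolding rota_baxter_lie_algebra_limit_weight_def
    by (intro conjI lie topspace_X lin_\<B> sync allI impI ballI lin_scale inverse limits)
  have weight_zero: "bracket (\<B> u) (\<B> v) = \<B> (bracket (\<B> u) v + bracket u (\<B> v))" if "u \<in> range tan" "v \<in> range tan" for u v
    using that rota_baxter_bracket unfolding \<B>_def bracket_def by auto
  show "rota_baxter_lie_algebra_weight_zero (range tan) bracket \<B>"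
    unfolding rota_baxter_lie_algebra_weight_zero_def
    by (intro conjI ballI lie lin_\<B> weight_zero)
qed

end

section \<open>The trivial group\<close>

lemma one_point_smooth_into:
  fixes T :: "'p topology" and A :: "('p, 'e::euclidean_space) chart set" and S :: "'a::euclidean_space set"
  assumes "topspace T = {x}" "open S"
  shows "smooth_into S T A c \<longleftrightarrow> (\<forall>s\<in>S. c s = x)"
proof
  assume "smooth_into S T A c"
  then show "\<forall>s\<in>S. c s = x" using smooth_into_topspace[of S T A c] assms(1) by auto
next
  assume c: "\<forall>s\<in>S. c s = x"
  have "continuous_map (top_of_set S) T (\<lambda>_. x)" using assms(1) by simp
  moreover have "smooth_on {s \<in> S. x \<in> V} (\<lambda>_. \<psi> x)" for V and \<psi> :: "'p \<Rightarrow> 'e"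
    using assms(2) by (cases "x \<in> V") (simp_all add: smooth_on_const)
  ultimately have "smooth_into S T A (\<lambda>_. x)" by (auto simp: smooth_into_def)
  then show "smooth_into S T A c" by (rule smooth_into_cong) (use c in simp)
qed

lemma one_point_velocity:
  assumes "\<epsilon> > 0" "\<And>t. t \<in> {-\<epsilon><..<\<epsilon>} \<Longrightarrow> \<gamma> t = x"
  shows "velocity T A \<gamma> = 0"
proof
  fix f
  have "((\<lambda>t. f (\<gamma> t)) has_real_derivative 0) (at 0)"
  proof (rule has_field_derivative_transform_within_open[of "\<lambda>_. f x"])
    show "f x = f (\<gamma> t)" if "t \<in> {-\<epsilon><..<\<epsilon>}" for t using assms(2)[OF that] by simp
  qed (use assms(1) in auto)
  then show "velocity T A \<gamma> f = 0 f" by (simp add: velocity_def DERIV_imp_deriv)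
qed

lemma trivial_rota_baxter_lie_algebra:
  fixes G :: "('g, 'm) monoid_scheme" and A :: "('g, 'e::euclidean_space) chart set"
  assumes "group G" and T: "topspace T = {\<one>\<^bsub>G\<^esub>}" and V: "V = tangent_space T A \<one>\<^bsub>G\<^esub>"
    and B: "B = tangent_map T A T A \<BB> \<one>\<^bsub>G\<^esub>"
  shows "rota_baxter_lie_algebra_limit_weight V (lie_bracket G T A) (exp_topology G T A)
           (\<lambda>n u. (1 / real n) *\<^sub>R u) (\<lambda>n u. real n *\<^sub>R u) B"
    and "rota_baxter_lie_algebra_weight_zero V (lie_bracket G T A) B"
proof -
  interpret group G by fact
  have V0: "V = {0}"
  proof (intro equalityI subsetI)
    fix u assume "u \<in> V"
    then obtain \<gamma> \<epsilon> where "u = velocity T A \<gamma>" "\<epsilon> > 0" "\<forall>t\<in>{-\<epsilon><..<\<epsilon>}. \<gamma> t = \<one>\<^bsub>G\<^esub>"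
      by (auto simp: V tangent_space_def smooth_curve_on_iff one_point_smooth_into[OF T])
    then show "u \<in> {0}" using one_point_velocity[of \<epsilon> \<gamma> "\<one>\<^bsub>G\<^esub>" T A] by simp
  next
    fix u :: "'g tangent" assume "u \<in> {0}"
    moreover have "velocity T A (\<lambda>t. \<one>\<^bsub>G\<^esub>) = 0" by (rule one_point_velocity[of 1]) auto
    ultimately show "u \<in> V"
      unfolding V tangent_space_def smooth_curve_on_iff
      by (auto simp: one_point_smooth_into[OF T] intro!: exI[of _ "\<lambda>t. \<one>\<^bsub>G\<^esub>"] exI[of _ "1::real"])
  qed
  have "(THE \<gamma>. one_parameter_subgroup G T A \<gamma> \<and> velocity T A \<gamma> = 0) = (\<lambda>t. \<one>\<^bsub>G\<^esub>)"
  proof (rule the_equality)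
    show "one_parameter_subgroup G T A (\<lambda>t. \<one>\<^bsub>G\<^esub>) \<and> velocity T A (\<lambda>t. \<one>\<^bsub>G\<^esub>) = 0"
      using one_point_velocity[of 1 "\<lambda>t. \<one>\<^bsub>G\<^esub>" "\<one>\<^bsub>G\<^esub>" T A]
      by (simp add: one_parameter_subgroup_def smooth_curve_on_iff one_point_smooth_into[OF T])
    show "\<gamma> = (\<lambda>t. \<one>\<^bsub>G\<^esub>)" if "one_parameter_subgroup G T A \<gamma> \<and> velocity T A \<gamma> = 0" for \<gamma>
      using that by (auto simp: one_parameter_subgroup_def smooth_curve_on_iff one_point_smooth_into[OF T])
  qed
  then have "lie_exp G T A 0 = \<one>\<^bsub>G\<^esub>" by (simp add: lie_exp_def)
  then have X: "topspace (exp_topology G T A) = {0}"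
    by (auto simp: exp_topology_def topspace_pullback_topology V[symmetric] V0 T)
  have bracket: "lie_bracket G T A 0 0 = 0"
    by (simp add: lie_bracket_def fun_eq_iff)
  have B0: "B 0 = 0"
    by (simp add: B tangent_map_def fun_eq_iff)
  have limit: "unique_limit (exp_topology G T A) (\<lambda>n. 0) 0"
    using X limitin_topspace by (fastforce simp: unique_limit_def)
  have sync: "synchronized (exp_topology G T A) (\<lambda>n u v. real n *\<^sub>R lie_bracket G T A ((1 / real n) *\<^sub>R u) ((1 / real n) *\<^sub>R v))"
    unfolding synchronized_def X
  proof (intro ballI exI[where x=0] conjI allI impI)
    fix a b :: "'g tangent" and \<alpha> \<beta> :: "nat \<Rightarrow> 'g tangent"
    assume "a \<in> {0}" "b \<in> {0}"
    then show "unique_limit (exp_topology G T A) (\<lambda>n. real n *\<^sub>R lie_bracket G T A ((1 / real n) *\<^sub>R a) ((1 / real n) *\<^sub>R b)) 0"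
      using limit by (simp add: bracket)
    assume "range \<alpha> \<subseteq> {0}" "range \<beta> \<subseteq> {0}"
    then have "\<alpha> n = 0" "\<beta> n = 0" for n by auto
    then show "unique_limit (exp_topology G T A) (\<lambda>n. real n *\<^sub>R lie_bracket G T A ((1 / real n) *\<^sub>R \<alpha> n) ((1 / real n) *\<^sub>R \<beta> n)) 0"
      using limit by (simp add: bracket)
  qed
  show "rota_baxter_lie_algebra_weight_zero V (lie_bracket G T A) B"
    by (simp add: rota_baxter_lie_algebra_weight_zero_def lie_algebra_on_def linear_endo_on_def V0 bracket B0 subspace_single_0)
  show "rota_baxter_lie_algebra_limit_weight V (lie_bracket G T A) (exp_topology G T A)
           (\<lambda>n u. (1 / real n) *\<^sub>R u) (\<lambda>n u. real n *\<^sub>R u) B"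
    using sync limit
    by (auto simp: rota_baxter_lie_algebra_limit_weight_def lie_algebra_on_def linear_endo_on_def V0 X bracket B0 subspace_single_0)
qed

text \<open>In a discrete group a sequence converges only by being eventually constant. So some root of \<open>a\<close>
  equals the identity.\<close>

lemma discrete_Q_group_trivial:
  assumes Q: "Q_group G T" and one: "openin T {\<one>\<^bsub>G\<^esub>}"
  shows "carrier G = {\<one>\<^bsub>G\<^esub>}"
proof -
  interpret group G using Q by (simp add: Q_group_def topological_group_def)
  have "a = \<one>\<^bsub>G\<^esub>" if a: "a \<in> carrier G" for a
  proof -
    have "limitin T (\<lambda>n. group_root G (int n) a) \<one>\<^bsub>G\<^esub> sequentially"
      using Q a by (auto simp: Q_group_def unique_limit_def)
    then have "\<forall>\<^sub>F n in sequentially. group_root G (int n) a = \<one>\<^bsub>G\<^esub>"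
      using one by (auto simp: limitin_def)
    then have "\<forall>\<^sub>F n in sequentially. group_root G (int n) a = \<one>\<^bsub>G\<^esub> \<and> n \<ge> 1"
      using eventually_ge_at_top by (rule eventually_conj)
    then obtain n where n: "group_root G (int n) a = \<one>\<^bsub>G\<^esub>" "n \<ge> 1"
      by (auto dest: eventually_happens'[OF sequentially_bot])
    have "bij_betw (\<lambda>x. x [^]\<^bsub>G\<^esub> int n) (carrier G) (carrier G)"
      using Q n(2) by (simp add: Q_group_def)
    then have "group_root G (int n) a [^]\<^bsub>G\<^esub> int n = a"
      using f_inv_into_f[of a "\<lambda>x. x [^]\<^bsub>G\<^esub> int n" "carrier G"] a by (simp add: group_root_def bij_betw_def)
    then show ?thesis using n(1) by simp
  qed
  then show ?thesis by blast
qed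

section \<open>The Rota-Baxter Lie algebra of a Rota-Baxter Lie group\<close>

theorem theorem3p7:
  fixes G :: "('g, 'm) monoid_scheme" and T :: "'g topology"
    and A :: "('g, 'e::euclidean_space) chart set" and \<BB> :: "'g \<Rightarrow> 'g"
    and \<gg> :: "'g tangent set" and B :: "'g tangent \<Rightarrow> 'g tangent"
  assumes "rota_baxter_lie_Q_group_limit_weight_zero G T A \<BB>"
  defines "\<gg> \<equiv> tangent_space T A \<one>\<^bsub>G\<^esub>"
    and "B \<equiv> tangent_map T A T A \<BB> \<one>\<^bsub>G\<^esub>"
  shows "rota_baxter_lie_algebra_limit_weight \<gg> (lie_bracket G T A) (exp_topology G T A)
           (\<lambda>n u. (1 / real n) *\<^sub>R u) (\<lambda>n u. real n *\<^sub>R u) B \<and>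
         rota_baxter_lie_algebra_weight_zero \<gg> (lie_bracket G T A) B"
proof -
  have lie: "lie_group G T A" and Q: "Q_group G T"
    and RB: "rota_baxter_operator_limit_weight_zero G T \<BB>" and smooth: "smooth_map T A T A \<BB>"
    using assms(1) by (auto simp: rota_baxter_lie_Q_group_limit_weight_zero_def)
  have grp: "group G" and top: "topspace T = carrier G" and atlas: "smooth_atlas T A"
    using lie by (auto simp: lie_group_def smooth_manifold_def)
  have cover: "\<exists>U \<phi>. (U, \<phi>) \<in> A \<and> q \<in> U" if q: "q \<in> topspace T" for q
  proof -
    have "q \<in> (\<Union>(U, \<phi>)\<in>A. U)" using atlas q by (simp add: smooth_atlas_def)
    then show ?thesis by (auto simp: case_prod_unfold)
  qed
  have "\<one>\<^bsub>G\<^esub> \<in> topspace T" using grp by (simp add: top group.is_monoid monoid.one_closed)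
  then obtain U \<phi> where U: "(U, \<phi>) \<in> A" "\<one>\<^bsub>G\<^esub> \<in> U"
    using cover by blast
  obtain M :: "'e set" where M: "M \<in> {UNIV, {0}}"
    and all_charts: "\<forall>(V, \<psi>)\<in>A. openin T V \<and> openin (top_of_set M) (\<psi> ` V) \<and>
        homeomorphic_map (subtopology T V) (top_of_set (\<psi> ` V)) \<psi>"
    using atlas unfolding smooth_atlas_def by (elim conjE bexE)
  have charts: "openin T V \<and> openin (top_of_set M) (\<psi> ` V) \<and>
        homeomorphic_map (subtopology T V) (top_of_set (\<psi> ` V)) \<psi>" if "(V, \<psi>) \<in> A" for V \<psi>
    using bspec[OF all_charts that] by simp
  have transitions: "\<forall>(V, \<psi>)\<in>A. \<forall>(V', \<psi>')\<in>A. smooth_on (\<psi> ` (V \<inter> V')) (\<psi>' \<circ> inv_into V \<psi>)"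
    using atlas unfolding smooth_atlas_def by (elim conjE)
  \<comment> \<open>the alternative \<open>M = {0}\<close> makes every chart domain a point, so the group is discrete\<close>
  show ?thesis
  proof (cases "M = UNIV")
    case True
    have "lie_group_chart G T A U \<phi>"
    proof
      show "\<exists>U \<phi>. (U, \<phi>) \<in> A \<and> q \<in> U" if "q \<in> topspace T" for q
        by (rule cover[OF that])
      show "smooth_on (\<psi> ` (V \<inter> V')) (\<psi>' \<circ> inv_into V \<psi>)" if "(V, \<psi>) \<in> A" "(V', \<psi>') \<in> A" for V \<psi> V' \<psi>'
        using bspec[OF bspec[OF transitions that(1), unfolded prod.case] that(2)] by simp
    qed (use charts True U lie in auto)
    then interpret lie_group_chart G T A U \<phi> .
    obtain R L where RL: "0 < R" "0 < L" "L * R \<le> 1" "ball 0 R \<times> ball 0 R \<subseteq> D"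
      "\<forall>x\<in>ball 0 R. \<forall>x'\<in>ball 0 R. \<forall>y\<in>ball 0 R. \<forall>y'\<in>ball 0 R.
        norm (m (x, y) - m (x', y) - m (x, y') + m (x', y')) \<le> L * norm (x - x') * norm (y - y')"
      using exists_radius by blast
    then interpret bounded: bounded_local_lie_group m D R L
      by unfold_locales auto
    interpret rota_baxter_lie_Q_group G T A U \<phi> R L \<BB>
      by unfold_locales (fact bounded.bounded_local_lie_group_axioms Q RB smooth)+
    show ?thesis
      unfolding \<gg>_def B_def tangent_space_eq by (intro conjI rota_baxter_lie_algebra)
  next
    case False
    then have "M = {0}" using M by simp
    then have "openin (top_of_set {0}) (\<phi> ` U)" using charts[OF U(1)] by simp
    then have sub: "\<phi> ` U \<subseteq> {0}" by (rule openin_imp_subset)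
    have "topspace (subtopology T U) = U"
      using charts[OF U(1)] openin_subset[of T U] by auto
    then have inj: "inj_on \<phi> U"
      using homeomorphic_imp_injective_map[of "subtopology T U" "top_of_set (\<phi> ` U)" \<phi>] charts[OF U(1)] by simp
    have "q = \<one>\<^bsub>G\<^esub>" if q: "q \<in> U" for q
    proof (rule inj_onD[OF inj _ q U(2)])
      show "\<phi> q = \<phi> \<one>\<^bsub>G\<^esub>" using subsetD[OF sub imageI[OF q]] subsetD[OF sub imageI[OF U(2)]] by simp
    qed
    then have "U = {\<one>\<^bsub>G\<^esub>}" using U(2) by blast
    then have "carrier G = {\<one>\<^bsub>G\<^esub>}" using discrete_Q_group_trivial[OF Q] charts[OF U(1)] by simp
    then show ?thesis
      using trivial_rota_baxter_lie_algebra[OF grp _ \<gg>_def[THEN meta_eq_to_obj_eq] B_def[THEN meta_eq_to_obj_eq]]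
      by (simp add: top)
  qed
qed

end
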